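(* Let $F$ be a genus $0$ fatgraph and $L\subset S^3$ its associated link, with an arbitrary orientation. Then for all $i,j$, \[ H^i_j(\widetilde{\mathcal C}(F))\cong\bigoplus_{p+q+r=j}\Big(\Big(\big(\widetilde{HK}^i_p(L)\otimes\overline\Delta(R^{\otimes(i-1)})_q\big)\oplus\big(Z^i_p(L)\otimes R^{\otimes i}_q/\overline\Delta(R^{\otimes(i-1)})_q\big)\Big)\otimes (V^{\otimes v(F)})_r\Big), \] where $M_p$ denotes the degree-$p$ part of a graded module $M$, $\overline\Delta=\overline\Delta_{i-1}$, $\widetilde{HK}(L)$ is the homology of the unnormalized Khovanov complex $\widetilde{\mathcal C}(L)$ and $Z^i_p(L)=\ker(\widetilde d^i)_p$ are its cycles. Moreover $H^i_j(\mathcal C(F))=H^{i+e(F)}_j(\widetilde{\mathcal C}(F))$.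
   Context: A fatgraph is a finite graph (loops and multiple edges allowed) with a cyclic order of half-edges at each vertex; it determines a compact orientable surface with boundary; genus $0$ means it comes from an embedding in the sphere. For a fatgraph $H$: $v(H),e(H)$ numbers of vertices and edges, $p(H)$ boundary components, $g(H)$ genus. A state is a spanning fatsubgraph $H=(V(F),W)$, $W\subseteq E(F)$, of height $h(H)=e(F)-e(H)$. $M\{l\}_m=M_{m-l}$; $(\mathcal C[s])^i=\mathcal C^{i-s}$. Modules and maps: $V$ free graded $\mathbb Z$-module on $v_\pm$ in degrees $\pm1$; $R$ free on $x_{-2},x_0$ in degrees $-2,0$. $\widetilde m':V\otimes V\to V$, $v_+\otimes v_+\mapsto v_+$, $v_\pm\otimes v_\mp\mapsto v_-$, $v_-\otimes v_-\mapsto0$; $\widetilde\Delta':V\to V\otimes V$, $v_+\mapsto v_+\otimes v_-+v_-\otimes v_+$, $v_-\mapsto v_-\otimes v_-$; $\overline\Delta_h:R^{\otimes h}\to R^{\otimes(h+1)}$ is $1\mapsto x_0$ for $h=0$ and for $h\ge1$ acts on the last factor by $x_0\mapsto x_0\otimes x_0$, $x_{-2}\mapsto x_{-2}\otimes x_0+x_0\otimes x_{-2}$. Number edges $1,\dots,n$, encode states by $\alpha\in\{0,1\}^n$ ($\alpha_i=0$ iff edge $i$ present); for edge $j\in H$, deleting it either merges two boundary components of $H$ or splits one (for genus $0$ the genus stays $0$). Chromatic complex (genus 0): state $H$ gets $A(H)=V^{\otimes v(H)}\otimes V^{\otimes p(H)}\otimes R^{\otimes h(H)}\{h(H)\}$;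 the per-edge map $A(H)\to A(H-e_j)$ is $(-1)^{\sum_{i<j}\alpha_i}$ times (identity on $V^{\otimes v}$)$\otimes$($\widetilde m'$ on merging boundary factors or $\widetilde\Delta'$ on a splitting factor, identity elsewhere)$\otimes\overline\Delta_{h(H)}$; $\widetilde{\mathcal C}^h(F)=\bigoplus_{h(H)=h}A(H)$ with differential the sum of per-edge maps; $\mathcal C(F)=\widetilde{\mathcal C}(F)[-e(F)]$; $H$ denotes homology. Associated link: embed $F$ in $S^2$ and form the alternating link diagram $L$ with one crossing per edge of $F$ (the medial construction), connected according to the cyclic orders at the vertices, such that at the crossing of edge $e$ the $0$-smoothing corresponds to keeping the edge $e$ and the $1$-smoothing to deleting it; thus for every state $H$, smoothing the crossings of edges of $H$ by $0$ and the others by $1$ yields a set of circles in bijection with the boundary components of $H$, and the number of $1$-smoothings is $h(H)$. Unnormalized Khovanov complex $\widetilde{\mathcal C}(L)$: the smoothing corresponding to $H$ gets $V^{\otimes p(H)}\{h(H)\}$, per-edge maps $(-1)^{\sum_{i<j}\alpha_i}\widetilde m'$ or $(-1)^{\sum_{i<j}\alpha_i}\widetilde\Delta'$ on merging/splitting circles, $\widetilde{\mathcal C}^i(L)$ the direct sum over smoothings with $i$ one-smoothings, differential $\widetilde d^i$ the sum of per-edge maps. For an orientation of $L$ with $n_\pm$ positive/negative crossings, the Khovanov complex is $\widetilde{\mathcal C}(L)[-n_-]\{n_+-2n_-\}$, whose homology is the Khovanov homology $HK(L)$. *)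

theory Defs
  imports "HOL-Algebra.Free_Abelian_Groups"
begin

section \<open>Tensor product of abelian groups\<close>

definition tensor_relators ::
    "('a, 'm) monoid_scheme \<Rightarrow> ('b, 'n) monoid_scheme \<Rightarrow> ('a \<times> 'b \<Rightarrow>\<^sub>0 int) set" where
  "tensor_relators G H =
     {frag_of (x \<otimes>\<^bsub>G\<^esub> x', y) - frag_of (x, y) - frag_of (x', y) | x x' y.
        x \<in> carrier G \<and> x' \<in> carrier G \<and> y \<in> carrier H} \<union>
     {frag_of (x, y \<otimes>\<^bsub>H\<^esub> y') - frag_of (x, y) - frag_of (x, y') | x y y'.
        x \<in> carrier G \<and> y \<in> carrier H \<and> y' \<in> carrier H}"

definition tensor_group ::
    "('a, 'm) monoid_scheme \<Rightarrow> ('b, 'n) monoid_scheme \<Rightarrow> ('a \<times> 'b \<Rightarrow>\<^sub>0 int) set monoid" where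
  "tensor_group G H =
     free_Abelian_group (carrier G \<times> carrier H) Mod
       generate (free_Abelian_group (carrier G \<times> carrier H)) (tensor_relators G H)"


section \<open>Bigraded complexes of free abelian groups with a chosen basis\<close>

text \<open>
  \<open>basis K i j\<close> is a basis of the part of homological degree \<open>i\<close> and internal degree \<open>j\<close>.
  The differential is given on basis elements; it raises \<open>i\<close> by one and preserves \<open>j\<close>.
\<close>

record 'b gcomplex =
  basis :: "int \<Rightarrow> int \<Rightarrow> 'b set"
  diff :: "'b \<Rightarrow> ('b \<Rightarrow>\<^sub>0 int)"

definition chains :: "'b gcomplex \<Rightarrow> int \<Rightarrow> int \<Rightarrow> ('b \<Rightarrow>\<^sub>0 int) monoid" where
  "chains K i j = free_Abelian_group (basis K i j)"

definition cycles :: "'b gcomplex \<Rightarrow> int \<Rightarrow> int \<Rightarrow> ('b \<Rightarrow>\<^sub>0 int) monoid" where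
  "cycles K i j =
     (chains K i j)\<lparr>carrier := kernel (chains K i j) (chains K (i + 1) j) (frag_extend (diff K))\<rparr>"

definition boundaries :: "'b gcomplex \<Rightarrow> int \<Rightarrow> int \<Rightarrow> ('b \<Rightarrow>\<^sub>0 int) set" where
  "boundaries K i j = frag_extend (diff K) ` carrier (chains K (i - 1) j)"

definition homology :: "'b gcomplex \<Rightarrow> int \<Rightarrow> int \<Rightarrow> ('b \<Rightarrow>\<^sub>0 int) set monoid" where
  "homology K i j = cycles K i j Mod boundaries K i j"

text \<open>\<open>shift K s\<close> is \<open>K[s]\<close>, with the convention \<open>(K[s])\<^sup>i = K\<^sup>i\<^sup>-\<^sup>s\<close>.\<close>

definition shift :: "'b gcomplex \<Rightarrow> int \<Rightarrow> 'b gcomplex" where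
  "shift K s = K\<lparr>basis := (\<lambda>i. basis K (i - s))\<rparr>"


section \<open>The graded modules V and R and their structure maps\<close>

text \<open>
  \<open>V\<close> and \<open>R\<close> are free on the types below. A tensor power of a free module is
  free on the corresponding tuples of generators: the power of \<open>V\<close> indexed by a finite set
  \<open>S\<close> is free on the extensional functions from \<open>S\<close> to \<open>vgen\<close>, and
  the \<open>h\<close>-th power of \<open>R\<close> is free on the words of length \<open>h\<close> (hence is zero
  for negative \<open>h\<close>).
\<close>

datatype vgen = VP | VM
datatype rgen = XM2 | X0

fun vdeg :: "vgen \<Rightarrow> int" where
  "vdeg VP = 1"
| "vdeg VM = -1"

fun rdeg :: "rgen \<Rightarrow> int" where
  "rdeg XM2 = -2"
| "rdeg X0 = 0"

fun v_mult :: "vgen \<times> vgen \<Rightarrow> (vgen \<Rightarrow>\<^sub>0 int)" where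
  "v_mult (VP, VP) = frag_of VP"
| "v_mult (VP, VM) = frag_of VM"
| "v_mult (VM, VP) = frag_of VM"
| "v_mult (VM, VM) = 0"

fun v_comult :: "vgen \<Rightarrow> (vgen \<times> vgen \<Rightarrow>\<^sub>0 int)" where
  "v_comult VP = frag_of (VP, VM) + frag_of (VM, VP)"
| "v_comult VM = frag_of (VM, VM)"

fun r_comult :: "rgen \<Rightarrow> (rgen list \<Rightarrow>\<^sub>0 int)" where
  "r_comult X0 = frag_of [X0, X0]"
| "r_comult XM2 = frag_of [XM2, X0] + frag_of [X0, XM2]"

definition r_delta :: "rgen list \<Rightarrow> (rgen list \<Rightarrow>\<^sub>0 int)" where
  "r_delta w =
     (if w = [] then frag_of [X0]
      else frag_extend (\<lambda>t. frag_of (butlast w @ t)) (r_comult (last w)))"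

definition V_words :: "'c set \<Rightarrow> ('c \<Rightarrow> vgen) set" where
  "V_words S = S \<rightarrow>\<^sub>E UNIV"

definition V_deg :: "'c set \<Rightarrow> ('c \<Rightarrow> vgen) \<Rightarrow> int" where
  "V_deg S f = (\<Sum>c\<in>S. vdeg (f c))"

definition R_words :: "int \<Rightarrow> rgen list set" where
  "R_words h = {w. int (length w) = h}"

definition R_deg :: "rgen list \<Rightarrow> int" where
  "R_deg w = sum_list (map rdeg w)"

definition V_power :: "'c set \<Rightarrow> int \<Rightarrow> (('c \<Rightarrow> vgen) \<Rightarrow>\<^sub>0 int) monoid" where
  "V_power S r = free_Abelian_group {f \<in> V_words S. V_deg S f = r}"

definition R_power :: "int \<Rightarrow> int \<Rightarrow> (rgen list \<Rightarrow>\<^sub>0 int) monoid" where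
  "R_power h q = free_Abelian_group {w \<in> R_words h. R_deg w = q}"

text \<open>
  The degree \<open>q\<close> part of the image of the \<open>(h-1)\<close>-st power of \<open>R\<close> in the
  \<open>h\<close>-th one (the map has degree 0); it is zero for \<open>h = 0\<close>.
\<close>

definition R_image :: "int \<Rightarrow> int \<Rightarrow> (rgen list \<Rightarrow>\<^sub>0 int) set" where
  "R_image h q = frag_extend r_delta ` carrier (R_power (h - 1) q)"

text \<open>
  The map from the \<open>S\<close>-indexed to the \<open>T\<close>-indexed power of \<open>V\<close> (on generators)
  when the set of curves \<open>T\<close> arises from \<open>S\<close> by merging two curves or splitting one:
  curves not involved belong to both \<open>S\<close> and \<open>T\<close>. The choice of the order of the two curves
  is immaterial as \<open>v_mult\<close> is commutative and \<open>v_comult\<close> cocommutative.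
\<close>

definition saddle :: "'c set \<Rightarrow> 'c set \<Rightarrow> ('c \<Rightarrow> vgen) \<Rightarrow> (('c \<Rightarrow> vgen) \<Rightarrow>\<^sub>0 int)" where
  "saddle S T f =
     (if \<exists>a b c. a \<noteq> b \<and> S - T = {a, b} \<and> T - S = {c} then
        (let (a, b, c) = (SOME (a, b, c). a \<noteq> b \<and> S - T = {a, b} \<and> T - S = {c})
         in frag_extend (\<lambda>u. frag_of (restrict (f(c := u)) T)) (v_mult (f a, f b)))
      else if \<exists>a b c. b \<noteq> c \<and> S - T = {a} \<and> T - S = {b, c} then
        (let (a, b, c) = (SOME (a, b, c). b \<noteq> c \<and> S - T = {a} \<and> T - S = {b, c})
         in frag_extend (\<lambda>(u, w). frag_of (restrict (f(b := u, c := w)) T)) (v_comult (f a)))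
      else 0)"


section \<open>Fatgraphs\<close>

text \<open>
  \<open>opp\<close> exchanges the two half-edges of an edge, and \<open>nxt\<close> sends a half-edge to its
  successor in the (counterclockwise) cyclic order at its vertex. Vertices without half-edges
  are allowed.
\<close>

record ('v, 'd) fatgraph =
  verts :: "'v set"
  halfs :: "'d set"
  vert :: "'d \<Rightarrow> 'v"
  opp :: "'d \<Rightarrow> 'd"
  nxt :: "'d \<Rightarrow> 'd"

definition is_fatgraph :: "('v, 'd) fatgraph \<Rightarrow> bool" where
  "is_fatgraph F \<longleftrightarrow>
     finite (verts F) \<and> finite (halfs F) \<and> vert F ` halfs F \<subseteq> verts F \<and>
     (\<forall>d\<in>halfs F. opp F d \<in> halfs F \<and> opp F d \<noteq> d \<and> opp F (opp F d) = d) \<and>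
     bij_betw (nxt F) (halfs F) (halfs F) \<and>
     (\<forall>d\<in>halfs F. vert F (nxt F d) = vert F d) \<and>
     (\<forall>d\<in>halfs F. \<forall>d'\<in>halfs F. vert F d = vert F d' \<longrightarrow> (\<exists>k. (nxt F ^^ k) d = d'))"

definition edges :: "('v, 'd) fatgraph \<Rightarrow> 'd set set" where
  "edges F = (\<lambda>d. {d, opp F d}) ` halfs F"

text \<open>
  The spanning fatsubgraph with edge set \<open>W\<close>; the successor of a half-edge is the
  next one in the old cyclic order that belongs to \<open>W\<close>.
\<close>

definition spanning :: "('v, 'd) fatgraph \<Rightarrow> 'd set set \<Rightarrow> ('v, 'd) fatgraph" where
  "spanning F W =
     F\<lparr>halfs := \<Union>W,
       nxt := (\<lambda>d. (nxt F ^^ (LEAST k. 0 < k \<and> (nxt F ^^ k) d \<in> \<Union>W)) d)\<rparr>"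

text \<open>
  Boundary components of the associated surface: the cycles of half-edges obtained by following
  the boundary, and one component for each isolated vertex (whose surface is a disc).
\<close>

definition bd_comps :: "('v, 'd) fatgraph \<Rightarrow> ('d set + 'v) set" where
  "bd_comps F =
     Inl ` (\<lambda>d. {((\<lambda>x. nxt F (opp F x)) ^^ k) d | k. True}) ` halfs F \<union>
     Inr ` (verts F - vert F ` halfs F)"

definition components :: "('v, 'd) fatgraph \<Rightarrow> 'v set set" where
  "components F = verts F // {(vert F d, vert F (opp F d)) | d. d \<in> halfs F}\<^sup>*"

text \<open>
  Capping off the boundary of the associated surface with discs gives a closed orientable
  surface of (even) Euler characteristic \<open>v - e + p\<close>, to be equated with \<open>2 c - 2 g\<close>,
  where \<open>c\<close> is the number of components and \<open>g\<close> is the sum of their genera.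
\<close>

definition genus :: "('v, 'd) fatgraph \<Rightarrow> int" where
  "genus F = (2 * int (card (components F)) -
     (int (card (verts F)) - int (card (edges F)) + int (card (bd_comps F)))) div 2"

definition height :: "('v, 'd) fatgraph \<Rightarrow> 'd set set \<Rightarrow> int" where
  "height F W = int (card (edges F)) - int (card W)"


section \<open>The chromatic complex\<close>

text \<open>
  The list \<open>es\<close> numbers the edges. A generator of \<open>A(H)\<close>, where \<open>H\<close> is the state
  with edge set \<open>W\<close>, is \<open>(W, f, g, w)\<close> with \<open>f\<close>, \<open>g\<close>, \<open>w\<close> generators of the tensor powers
  for the vertices, the boundary components and the height of \<open>H\<close>. As \<open>M{l}\<^sub>m = M\<^sub>m\<^sub>-\<^sub>l\<close>, the shift
  by the height raises degrees by the height.
\<close>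

type_synonym ('v, 'd) chrom_gen =
  "'d set set \<times> ('v \<Rightarrow> vgen) \<times> ('d set + 'v \<Rightarrow> vgen) \<times> rgen list"

definition chrom_basis :: "('v, 'd) fatgraph \<Rightarrow> int \<Rightarrow> int \<Rightarrow> ('v, 'd) chrom_gen set" where
  "chrom_basis F i j =
     {(W, f, g, w). W \<subseteq> edges F \<and> height F W = i \<and>
        f \<in> V_words (verts F) \<and> g \<in> V_words (bd_comps (spanning F W)) \<and> w \<in> R_words (height F W) \<and>
        V_deg (verts F) f + V_deg (bd_comps (spanning F W)) g + R_deg w + height F W = j}"

fun chrom_edge_map ::
    "('v, 'd) fatgraph \<Rightarrow> 'd set \<Rightarrow> ('v, 'd) chrom_gen \<Rightarrow> (('v, 'd) chrom_gen \<Rightarrow>\<^sub>0 int)" where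
  "chrom_edge_map F e (W, f, g, w) =
     frag_extend (\<lambda>g'. frag_extend (\<lambda>w'. frag_of (W - {e}, f, g', w')) (r_delta w))
       (saddle (bd_comps (spanning F W)) (bd_comps (spanning F (W - {e}))) g)"

fun chrom_diff ::
    "('v, 'd) fatgraph \<Rightarrow> 'd set list \<Rightarrow> ('v, 'd) chrom_gen \<Rightarrow> (('v, 'd) chrom_gen \<Rightarrow>\<^sub>0 int)" where
  "chrom_diff F es (W, f, g, w) =
     (\<Sum>k | k < length es \<and> es ! k \<in> W.
        frag_cmul ((-1) ^ card {l. l < k \<and> es ! l \<notin> W}) (chrom_edge_map F (es ! k) (W, f, g, w)))"

definition unnorm_chromatic ::
    "('v, 'd) fatgraph \<Rightarrow> 'd set list \<Rightarrow> ('v, 'd) chrom_gen gcomplex" where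
  "unnorm_chromatic F es = \<lparr>basis = chrom_basis F, diff = chrom_diff F es\<rparr>"

definition chromatic :: "('v, 'd) fatgraph \<Rightarrow> 'd set list \<Rightarrow> ('v, 'd) chrom_gen gcomplex" where
  "chromatic F es = shift (unnorm_chromatic F es) (- int (card (edges F)))"


section \<open>Link diagrams and the unnormalized Khovanov complex\<close>

text \<open>
  A diagram has four ends of strands at each crossing; \<open>rot\<close> sends an end to the
  counterclockwise next end at the same crossing, \<open>over\<close> tells whether an end belongs to the
  overpassing strand (so that \<open>over (rot x) \<longleftrightarrow> \<not> over x\<close>), and \<open>arc\<close> is the
  involution exchanging the two ends of each arc of the diagram. Circles without crossings are
  indexed by \<open>free_circles\<close>.
\<close>

record ('x, 'f) diagram =
  ends :: "'x set"
  rot :: "'x \<Rightarrow> 'x"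
  arc :: "'x \<Rightarrow> 'x"
  over :: "'x \<Rightarrow> bool"
  free_circles :: "'f set"

definition crossings :: "('x, 'f) diagram \<Rightarrow> 'x set set" where
  "crossings L = (\<lambda>x. {x, rot L x, rot L (rot L x), rot L (rot L (rot L x))}) ` ends L"

text \<open>
  An orientation: the set \<open>I\<close> of ends directed towards their crossing, and the set
  \<open>J\<close> of crossingless circles oriented counterclockwise (no condition on the latter).
\<close>

definition link_orientation :: "('x, 'f) diagram \<Rightarrow> 'x set \<times> 'f set \<Rightarrow> bool" where
  "link_orientation L = (\<lambda>(I, J). I \<subseteq> ends L \<and> J \<subseteq> free_circles L \<and>
     (\<forall>x\<in>ends L. (x \<in> I \<longleftrightarrow> rot L (rot L x) \<notin> I) \<and> (x \<in> I \<longleftrightarrow> arc L x \<notin> I)))"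

text \<open>
  The circles of the smoothing in which exactly the crossings in \<open>S\<close> are 1-smoothed. The
  0-smoothing merges the regions swept out by the overpassing strand when it is turned
  counterclockwise, i.e. it joins each under-end to the counterclockwise next (over-)end; the
  1-smoothing joins each over-end to the counterclockwise next (under-)end.
\<close>

definition circles :: "('x, 'f) diagram \<Rightarrow> 'x set set \<Rightarrow> ('x set + 'f) set" where
  "circles L S =
     (let r = {(x, arc L x) | x. x \<in> ends L} \<union>
              {(x, rot L x) | x. x \<in> ends L \<and> (over L x \<longleftrightarrow> x \<in> \<Union>S)}
      in Inl ` (ends L // (r \<union> r\<inverse>)\<^sup>*) \<union> Inr ` free_circles L)"

text \<open>
  The list \<open>cs\<close> numbers the crossings, and a generator is a pair of the set of 1-smoothed crossings and a
  generator of the tensor power for the circles.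
\<close>

type_synonym ('x, 'f) kh_gen = "'x set set \<times> ('x set + 'f \<Rightarrow> vgen)"

definition kh_basis :: "('x, 'f) diagram \<Rightarrow> int \<Rightarrow> int \<Rightarrow> ('x, 'f) kh_gen set" where
  "kh_basis L i j =
     {(S, g). S \<subseteq> crossings L \<and> int (card S) = i \<and> g \<in> V_words (circles L S) \<and>
        V_deg (circles L S) g + int (card S) = j}"

fun kh_edge_map ::
    "('x, 'f) diagram \<Rightarrow> 'x set \<Rightarrow> ('x, 'f) kh_gen \<Rightarrow> (('x, 'f) kh_gen \<Rightarrow>\<^sub>0 int)" where
  "kh_edge_map L c (S, g) =
     frag_extend (\<lambda>g'. frag_of (insert c S, g')) (saddle (circles L S) (circles L (insert c S)) g)"

fun kh_diff ::
    "('x, 'f) diagram \<Rightarrow> 'x set list \<Rightarrow> ('x, 'f) kh_gen \<Rightarrow> (('x, 'f) kh_gen \<Rightarrow>\<^sub>0 int)" where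
  "kh_diff L cs (S, g) =
     (\<Sum>k | k < length cs \<and> cs ! k \<notin> S.
        frag_cmul ((-1) ^ card {l. l < k \<and> cs ! l \<in> S}) (kh_edge_map L (cs ! k) (S, g)))"

definition unnorm_khovanov ::
    "('x, 'f) diagram \<Rightarrow> 'x set list \<Rightarrow> ('x, 'f) kh_gen gcomplex" where
  "unnorm_khovanov L cs = \<lparr>basis = kh_basis L, diff = kh_diff L cs\<rparr>"


section \<open>The link associated to a fatgraph\<close>

text \<open>
  The medial diagram. At the crossing of the edge \<open>{d, opp d}\<close> the four ends lie to the left and
  to the right of \<open>d\<close> and of \<open>opp d\<close>, as seen from their respective vertices. Counterclockwise
  they are: right of \<open>opp d\<close>, left of \<open>d\<close>, right of \<open>d\<close>, left of \<open>opp d\<close>. An arc runs in each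
  corner of \<open>F\<close>, from the left of a half-edge to the right of its counterclockwise successor.
  Left ends are over and right ends are under, so that the diagram is alternating; the
  0-smoothing joins the left of \<open>d\<close> to the right of \<open>opp d\<close> (the strands run along the edge,
  which is kept), and the 1-smoothing joins the left of \<open>d\<close> to the right of \<open>d\<close> (the edge is cut).
\<close>

datatype side = LeftSide | RightSide

definition medial :: "('v, 'd) fatgraph \<Rightarrow> ('d \<times> side, 'v) diagram" where
  "medial F =
     \<lparr>ends = halfs F \<times> UNIV,
      rot = (\<lambda>(d, s). case s of LeftSide \<Rightarrow> (d, RightSide) | RightSide \<Rightarrow> (opp F d, LeftSide)),
      arc = (\<lambda>(d, s). case s of LeftSide \<Rightarrow> (nxt F d, RightSide)
                              | RightSide \<Rightarrow> (inv_into (halfs F) (nxt F) d, LeftSide)),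
      over = (\<lambda>(d, s). s = LeftSide),
      free_circles = verts F - vert F ` halfs F\<rparr>"

definition edge_crossing :: "'d set \<Rightarrow> ('d \<times> side) set" where
  "edge_crossing e = e \<times> UNIV"

end

(*
  The chromatic complex is the tensor product of the Khovanov complex of the medial link, the
  powers of R and the constant factor of the vertices: the boundary components of a state
  correspond to the circles of the smoothing, because the walk that follows an arc of the diagram,
  and then the edge whenever it is present, is the walk along the boundary that also visits the
  absent half-edges. A deleted edge therefore causes the same merging or splitting on both sides;
  if one curve is turned into one curve, then the sets of circles before and after coincide and
  both edge maps are zero.

  The map Delta of the powers of R is injective, and the words that do not end in X0 complete the
  image of Delta to a basis. In this basis a chain is a cycle iff all its coordinates are Khovanov
  cycles, and it is a boundary iff its coordinates on the image of Delta are Khovanov boundaries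
  and the others vanish. A quotient by a subgroup that is not contained in the cycles still makes
  sense, so d o d = 0 need not be established.
*)
theory Submission
  imports Defs
begin

section \<open>Quotients and products of abelian groups\<close>

text \<open>\<open>saddle\<close> detects the curves involved by the differences of two sets of
  curves, so a bijection between circles and boundary components of each single state is not enough:
  the bijections before and after deleting an edge must agree on the uninvolved curves and match the
  differences. Boundary components are orbits of kept half-edges only, while a circle also contains
  the ends of absent ones; hence a circle may survive unchanged as a set although the corresponding
  orbit changes. The adapted basis rests on the fact that the image of a word under Delta contains
  exactly one word ending in \<open>X0\<close>, namely the old word with \<open>X0\<close> appended,
  with coefficient 1. The change of basis is therefore unitriangular over the integers, and only
  coordinates at words ending in \<open>X0\<close>, \<open>XM2\<close> need a correction. Every
  right-hand tensor factor is free of finite rank, so each tensor product is a finite power of its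
  left factor, and the formula reduces to sorting words by degree and by whether they end in
  \<open>X0\<close>.\<close>

lemma comm_group_subgroup_FactGroup:
  assumes "comm_group C" "subgroup Z C" "subgroup B C"
  shows "comm_group ((C\<lparr>carrier := Z\<rparr>) Mod B)"
    and "(\<lambda>z. B #>\<^bsub>C\<^esub> z) \<in> hom (C\<lparr>carrier := Z\<rparr>) ((C\<lparr>carrier := Z\<rparr>) Mod B)"
    and "carrier ((C\<lparr>carrier := Z\<rparr>) Mod B) = (\<lambda>z. B #>\<^bsub>C\<^esub> z) ` Z"
proof -
  interpret C: comm_group C by fact
  interpret B: normal B C by (simp add: C.subgroup_imp_normal assms)
  interpret Q: comm_group "C Mod B" by (simp add: C.abelian_FactGroup assms)
  have k: "(\<lambda>z. B #>\<^bsub>C\<^esub> z) \<in> hom C (C Mod B)" by (rule B.r_coset_hom_Mod)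
  interpret k: group_hom C "C Mod B" "\<lambda>z. B #>\<^bsub>C\<^esub> z"
    by unfold_locales (rule k)
  have sub: "subgroup ((\<lambda>z. B #>\<^bsub>C\<^esub> z) ` Z) (C Mod B)"
    by (rule k.subgroup_img_is_subgroup) fact
  show car: "carrier ((C\<lparr>carrier := Z\<rparr>) Mod B) = (\<lambda>z. B #>\<^bsub>C\<^esub> z) ` Z"
    by (auto simp: FactGroup_def RCOSETS_def r_coset_def)
  \<comment> \<open>The cosets of \<open>B\<close> by elements of \<open>Z\<close> form the image of
    \<open>Z\<close> in \<open>C Mod B\<close>, so the quotient is a subgroup of a known abelian
    group, also when \<open>B\<close> sticks out of \<open>Z\<close>.\<close>
  have eq: "(C\<lparr>carrier := Z\<rparr>) Mod B = (C Mod B)\<lparr>carrier := (\<lambda>z. B #>\<^bsub>C\<^esub> z) ` Z\<rparr>"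
    using car by (simp add: FactGroup_def set_mult_def fun_eq_iff)
  show "comm_group ((C\<lparr>carrier := Z\<rparr>) Mod B)"
    unfolding eq 
    by (rule group.group_comm_groupI[OF Q.subgroup_imp_group[OF sub]])
       (use subgroup.subset[OF sub] Q.m_comm in \<open>simp add: subset_iff\<close>)
  have "Z \<subseteq> carrier C" using assms(2) by (rule subgroup.subset)
  with k show "(\<lambda>z. B #>\<^bsub>C\<^esub> z) \<in> hom (C\<lparr>carrier := Z\<rparr>) ((C\<lparr>carrier := Z\<rparr>) Mod B)"
    unfolding eq hom_def by (auto simp: subset_iff)
qed

text \<open>\<open>B\<close> need not be contained in \<open>Z\<close>: then the quotient is that of \<open>Z\<close> by \<open>Z \<inter> B\<close>.\<close>

lemma subgroup_FactGroup_iso: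
  assumes "comm_group C" "subgroup Z C" "subgroup B C" "group G"
    and h: "h \<in> hom (C\<lparr>carrier := Z\<rparr>) G" "carrier G \<subseteq> h ` Z"
    and ker: "\<And>z. z \<in> Z \<Longrightarrow> h z = \<one>\<^bsub>G\<^esub> \<longleftrightarrow> z \<in> B"
  shows "(C\<lparr>carrier := Z\<rparr>) Mod B \<cong> G"
proof -
  interpret C: comm_group C by fact
  let ?Z = "C\<lparr>carrier := Z\<rparr>"
  have Z: "group ?Z" using assms(2) by (simp add: C.subgroup_imp_group)
  note Q = comm_group_subgroup_FactGroup[OF assms(1-3)]
  interpret h: group_hom ?Z G h
    using Z assms h by (simp add: group_hom_def group_hom_axioms_def)
  interpret k: group_hom ?Z "?Z Mod B" "\<lambda>z. B #>\<^bsub>C\<^esub> z"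
    using Z Q by (simp add: group_hom_def group_hom_axioms_def comm_group_def)
  have ZC: "Z \<subseteq> carrier C" using assms(2) by (rule subgroup.subset)
  \<comment> \<open>The projection and \<open>h\<close> have the same kernel
    \<open>Z \<inter> B\<close>, so the first isomorphism theorem, used twice, identifies their
    targets.\<close>
  have "B #>\<^bsub>C\<^esub> z = B \<longleftrightarrow> z \<in> B" if "z \<in> Z" for z
    using that ZC assms(3) C.coset_join1 C.coset_join2 by (metis subgroup.subset subsetD)
  then have "kernel ?Z (?Z Mod B) (\<lambda>z. B #>\<^bsub>C\<^esub> z) = kernel ?Z G h"
    using ker by (auto simp: kernel_def FactGroup_def)
  moreover have "?Z Mod kernel ?Z G h \<cong> G"
    using h h.hom_closed by (intro h.FactGroup_iso) auto
  moreover have "?Z Mod kernel ?Z (?Z Mod B) (\<lambda>z. B #>\<^bsub>C\<^esub> z) \<cong> ?Z Mod B"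
    using Q(3) by (intro k.FactGroup_iso) auto
  moreover have "group (?Z Mod kernel ?Z G h)"
    by (simp add: h.normal_kernel normal.factorgroup_is_group)
  ultimately show ?thesis
    by (metis group.iso_sym iso_trans)
qed

lemma FactGroup_iso_of_hom:
  assumes "comm_group C" "subgroup B C" "group G"
    and "h \<in> hom C G" "carrier G \<subseteq> h ` carrier C"
    and "\<And>z. z \<in> carrier C \<Longrightarrow> h z = \<one>\<^bsub>G\<^esub> \<longleftrightarrow> z \<in> B"
  shows "C Mod B \<cong> G"
  using subgroup_FactGroup_iso[of C "carrier C" B G h] assms
  by (simp add: group.subgroup_self comm_group.axioms(2))

text \<open>Serves the words not ending in \<open>X0\<close>: their summand is written as a quotient
  by the trivial group so that all words share one formula, while the theorem asks for the cycles
  themselves.\<close>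

lemma iso_FactGroup_trivial:
  assumes "comm_group C" "subgroup Z C"
  shows "C\<lparr>carrier := Z\<rparr> \<cong> (C\<lparr>carrier := Z\<rparr>) Mod {\<one>\<^bsub>C\<^esub>}"
proof -
  interpret C: comm_group C by fact
  have "group (C\<lparr>carrier := Z\<rparr>)" using assms(2) by (simp add: C.subgroup_imp_group)
  moreover have "(C\<lparr>carrier := Z\<rparr>) Mod {\<one>\<^bsub>C\<^esub>} \<cong> C\<lparr>carrier := Z\<rparr>"
    using calculation assms
    by (intro subgroup_FactGroup_iso[where h = id])
       (auto simp: hom_def C.triv_subgroup)
  ultimately show ?thesis
    using comm_group_subgroup_FactGroup(1)[OF assms C.triv_subgroup]
    by (meson comm_group.axioms(2) group.iso_sym)
qed

lemma comm_group_product_group: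
  assumes "\<And>i. i \<in> I \<Longrightarrow> comm_group (G i)"
  shows "comm_group (product_group I G)"
proof (rule group.group_comm_groupI)
  show "group (product_group I G)"
    using assms by (simp add: comm_group.axioms(2))
  show "x \<otimes>\<^bsub>product_group I G\<^esub> y = y \<otimes>\<^bsub>product_group I G\<^esub> x"
    if "x \<in> carrier (product_group I G)" "y \<in> carrier (product_group I G)" for x y
    using that assms
    by (auto intro!: restrict_ext simp: PiE_iff comm_group_def intro: comm_monoid.m_comm)
qed

lemma product_group_Un_iso:
  assumes "\<And>i. i \<in> A \<union> B \<Longrightarrow> group (G i)" "A \<inter> B = {}"
  shows "product_group (A \<union> B) G \<cong> product_group A G \<times>\<times> product_group B G"
proof -
  have gA: "group (product_group A G)" and gB: "group (product_group B G)"
    using assms by auto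
  let ?h = "\<lambda>x. (restrict x A, restrict x B)"
  have hom: "?h \<in> hom (product_group (A \<union> B) G) (product_group A G \<times>\<times> product_group B G)"
    by (auto simp: hom_def fun_eq_iff restrict_def PiE_def Pi_def extensional_def)
  have "bij_betw ?h (carrier (product_group (A \<union> B) G)) (carrier (product_group A G \<times>\<times> product_group B G))"
  proof (rule bij_betw_byWitness[where f' = "\<lambda>(x, y) i. if i \<in> A then x i else y i"])
    show "\<forall>a\<in>carrier (product_group (A \<union> B) G).
        (case ?h a of (x, y) \<Rightarrow> \<lambda>i. if i \<in> A then x i else y i) = a"
      by (auto simp: fun_eq_iff PiE_def extensional_def)
    show "\<forall>a'\<in>carrier (product_group A G \<times>\<times> product_group B G).
        ?h (case a' of (x, y) \<Rightarrow> \<lambda>i. if i \<in> A then x i else y i) = a'"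
      using assms(2) by (fastforce simp: fun_eq_iff PiE_def extensional_def)
    show "?h ` carrier (product_group (A \<union> B) G) \<subseteq> carrier (product_group A G \<times>\<times> product_group B G)"
      by auto
    show "(\<lambda>(x, y) i. if i \<in> A then x i else y i) ` carrier (product_group A G \<times>\<times> product_group B G)
        \<subseteq> carrier (product_group (A \<union> B) G)"
      by (auto simp: PiE_def extensional_def)
  qed
  then show ?thesis using hom by (auto simp: is_iso_def iso_def)
qed

text \<open>Even for an infinite \<open>I\<close> the direct sum agrees with the product here:
  \<open>X\<close> is finite, so \<open>A i \<times> B i\<close> is nonempty for finitely many
  \<open>i\<close> only, and a factor with an empty index set is trivial.\<close>

lemma sum_group_product_group_iso:
  fixes e :: "'i \<Rightarrow> 'a \<Rightarrow> 'b \<Rightarrow> 'x"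
  assumes "finite X" and H: "\<And>x. x \<in> X \<Longrightarrow> group (H x)"
    and e: "bij_betw (\<lambda>(i, a, b). e i a b) (SIGMA i:I. A i \<times> B i) X"
  shows "product_group X H \<cong>
    sum_group I (\<lambda>i. product_group (A i) (\<lambda>a. product_group (B i) (\<lambda>b. H (e i a b))))"
    (is "_ \<cong> sum_group I ?G")
proof -
  have eX: "e i a b \<in> X" if "i \<in> I" "a \<in> A i" "b \<in> B i" for i a b
    using e that unfolding bij_betw_def by force
  have G: "group (?G i)" if "i \<in> I" for i
    using that eX H by (intro product_group) auto
  have carG: "carrier (?G i) = (\<Pi>\<^sub>E a\<in>A i. \<Pi>\<^sub>E b\<in>B i. carrier (H (e i a b)))" for i
    by simp
  let ?h = "\<lambda>y. \<lambda>i\<in>I. \<lambda>a\<in>A i. \<lambda>b\<in>B i. y (e i a b)"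
  obtain e' where e': "bij_betw e' X (SIGMA i:I. A i \<times> B i)"
     "\<And>i a b. i \<in> I \<Longrightarrow> a \<in> A i \<Longrightarrow> b \<in> B i \<Longrightarrow> e' (e i a b) = (i, a, b)"
     "\<And>x. x \<in> X \<Longrightarrow> (case e' x of (i, a, b) \<Rightarrow> e i a b) = x"
  proof
    let ?e = "inv_into (SIGMA i:I. A i \<times> B i) (\<lambda>(i, a, b). e i a b)"
    show "bij_betw ?e X (SIGMA i:I. A i \<times> B i)" by (rule bij_betw_inv_into[OF e])
    show "?e (e i a b) = (i, a, b)" if "i \<in> I" "a \<in> A i" "b \<in> B i" for i a b
      using bij_betw_inv_into_left[OF e, of "(i, a, b)"] that by simp
    show "(case ?e x of (i, a, b) \<Rightarrow> e i a b) = x" if "x \<in> X" for x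
      using bij_betw_inv_into_right[OF e that] by simp
  qed
  have "finite (SIGMA i:I. A i \<times> B i)"
    using e assms(1) bij_betw_finite by blast
  then have fin: "finite (fst ` (SIGMA i:I. A i \<times> B i))" by (rule finite_imageI)
  have fin': "finite {i \<in> I. y i \<noteq> \<one>\<^bsub>?G i\<^esub>}" if "\<And>i. i \<in> I \<Longrightarrow> y i \<in> carrier (?G i)" for y
  proof (rule finite_subset[OF _ fin], rule subsetI)
    fix i assume i: "i \<in> {i \<in> I. y i \<noteq> \<one>\<^bsub>?G i\<^esub>}"
    then have "\<exists>a b. a \<in> A i \<and> b \<in> B i"
    proof -
      have "y i = \<one>\<^bsub>?G i\<^esub>" if "A i = {} \<or> B i = {}"
      proof -
        have "y i \<in> (\<Pi>\<^sub>E a\<in>A i. \<Pi>\<^sub>E b\<in>B i. carrier (H (e i a b)))"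
          using i \<open>\<And>i. i \<in> I \<Longrightarrow> y i \<in> carrier (?G i)\<close> unfolding carG by blast
        then show ?thesis
          using that by (auto simp: PiE_def extensional_def fun_eq_iff Pi_def)
      qed
      then show ?thesis using i by blast
    qed
    with i show "i \<in> fst ` (SIGMA i:I. A i \<times> B i)" by force
  qed
  have car: "carrier (sum_group I ?G) = (\<Pi>\<^sub>E i\<in>I. carrier (?G i))"
    using fin' by (auto simp add: carrier_sum_group[OF G] PiE_mem)
  have hom: "?h \<in> hom (product_group X H) (sum_group I ?G)"
  proof (rule homI)
    show "?h y \<in> carrier (sum_group I ?G)" if "y \<in> carrier (product_group X H)" for y
      unfolding car carG using that eX by (auto simp: PiE_iff)
    show "?h (x \<otimes>\<^bsub>product_group X H\<^esub> y) = ?h x \<otimes>\<^bsub>sum_group I ?G\<^esub> ?h y" for x y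
      using eX by (auto simp: fun_eq_iff)
  qed
  have "bij_betw ?h (carrier (product_group X H)) (carrier (sum_group I ?G))"
  proof (rule bij_betw_byWitness[where f' = "\<lambda>z. \<lambda>x\<in>X. case e' x of (i, a, b) \<Rightarrow> z i a b"])
    have e'X: "\<exists>i a b. e' x = (i, a, b) \<and> i \<in> I \<and> a \<in> A i \<and> b \<in> B i \<and> x = e i a b" if "x \<in> X" for x
      using e'(1,3) that unfolding bij_betw_def by (metis (no_types, lifting) case_prodE imageI
          mem_Sigma_iff old.prod.case prod.exhaust)
    show "\<forall>y\<in>carrier (product_group X H). (\<lambda>x\<in>X. case e' x of (i, a, b) \<Rightarrow> ?h y i a b) = y"
    proof
      fix y assume y: "y \<in> carrier (product_group X H)"
      show "(\<lambda>x\<in>X. case e' x of (i, a, b) \<Rightarrow> ?h y i a b) = y"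
      proof
        fix x
        show "(\<lambda>x\<in>X. case e' x of (i, a, b) \<Rightarrow> ?h y i a b) x = y x"
          using y e'X[of x] by (cases "x \<in> X") (auto simp: PiE_def extensional_def)
      qed
    qed
    show "\<forall>z\<in>carrier (sum_group I ?G). ?h (\<lambda>x\<in>X. case e' x of (i, a, b) \<Rightarrow> z i a b) = z"
    proof
      fix z assume z: "z \<in> carrier (sum_group I ?G)"
      show "?h (\<lambda>x\<in>X. case e' x of (i, a, b) \<Rightarrow> z i a b) = z"
      proof
        fix i
        show "?h (\<lambda>x\<in>X. case e' x of (i, a, b) \<Rightarrow> z i a b) i = z i"
        proof (cases "i \<in> I")
          case True
          then have zi: "z i \<in> (\<Pi>\<^sub>E a\<in>A i. \<Pi>\<^sub>E b\<in>B i. carrier (H (e i a b)))"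
            using z unfolding car carG by auto
          have "(\<lambda>b\<in>B i. z i a b) = z i a" if "a \<in> A i" for a
            using PiE_mem[OF zi that] by (rule PiE_restrict)
          then have "(\<lambda>a\<in>A i. \<lambda>b\<in>B i. z i a b) = z i"
            using PiE_restrict[OF zi] by (simp cong: restrict_cong)
          then show ?thesis
            using True eX e'(2) by (simp cong: restrict_cong)
        next
          case False
          then show ?thesis using z unfolding car by (auto simp: PiE_def extensional_def)
        qed
      qed
    qed
    show "?h ` carrier (product_group X H) \<subseteq> carrier (sum_group I ?G)"
      using hom by (auto simp: hom_def)
    show "(\<lambda>z. \<lambda>x\<in>X. case e' x of (i, a, b) \<Rightarrow> z i a b) ` carrier (sum_group I ?G) \<subseteq> carrier (product_group X H)"
    proof clarify
      fix z assume z: "z \<in> carrier (sum_group I ?G)"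
      have "(case e' x of (i, a, b) \<Rightarrow> z i a b) \<in> carrier (H x)" if x: "x \<in> X" for x
      proof -
        obtain i a b where x: "e' x = (i, a, b)" "i \<in> I" "a \<in> A i" "b \<in> B i" "x = e i a b"
          using e'X[OF x] by blast
        then have "z i \<in> (\<Pi>\<^sub>E a\<in>A i. \<Pi>\<^sub>E b\<in>B i. carrier (H (e i a b)))"
          using z unfolding car carG by auto
        then show ?thesis using x by (auto simp: PiE_iff)
      qed
      then show "(\<lambda>x\<in>X. case e' x of (i, a, b) \<Rightarrow> z i a b) \<in> carrier (product_group X H)"
        by (simp add: PiE_iff)
    qed
  qed
  then show ?thesis using hom by (auto simp: is_iso_def iso_def)
qed

section \<open>Tensor products with free abelian groups\<close>

text \<open>The coordinates of \<open>y\<close> in the basis \<open>S\<close> become exponents of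
  \<open>x\<close>. Bijectivity is not shown through a second homomorphism: \<open>\<psi>\<close> is
  merely a map to representatives, additive modulo the relators, and \<open>c - \<psi> (h c)\<close>
  always lies in the subgroup \<open>N\<close> that they generate.\<close>

lemma tensor_group_free_iso:
  fixes G :: "('a, 'm) monoid_scheme" and H :: "('b, 'n) monoid_scheme" and S :: "'s set"
  assumes G: "comm_group G" and H: "group H" and k: "k \<in> iso (free_Abelian_group S) H"
    and S: "finite S"
  shows "tensor_group G H \<cong> product_group S (\<lambda>_. G)"
proof -
  interpret G: comm_group G by fact
  interpret H: group H by fact
  let ?P = "product_group S (\<lambda>_. G)"
  let ?C = "free_Abelian_group (carrier G \<times> carrier H)"
  let ?F = "free_Abelian_group S"
  interpret C: comm_group ?C by (rule abelian_free_Abelian_group)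
  interpret P: comm_group ?P by (rule comm_group_product_group) (rule G)
  interpret F: comm_group ?F by (rule abelian_free_Abelian_group)
  interpret k: group_hom ?F H k
    using k by unfold_locales (simp add: iso_def)
  define k' where "k' = inv_into (carrier ?F) k"
  have k': "k' \<in> iso H ?F"
    using k by (simp add: k'_def F.iso_set_sym)
  have kk': "k (k' y) = y" if "y \<in> carrier H" for y
    using k that by (simp add: k'_def iso_def bij_betw_inv_into_right)
  have k'k: "k' (k u) = u" if "u \<in> carrier ?F" for u
    using k that by (simp add: k'_def iso_def bij_betw_inv_into_left del: carrier_free_Abelian_group_iff)
  have k'mult: "k' (y \<otimes>\<^bsub>H\<^esub> z) = k' y + k' z" if "y \<in> carrier H" "z \<in> carrier H" for y z
    using k' that by (simp add: iso_def hom_def)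
  have kS[simp]: "k (frag_of s) \<in> carrier H" if "s \<in> S" for s
    using that by (intro k.hom_closed) simp
  define f where "f = (\<lambda>(x, y). \<lambda>s\<in>S. x [^]\<^bsub>G\<^esub> Poly_Mapping.lookup (k' y) s)"
  have "f ` (carrier G \<times> carrier H) \<subseteq> carrier ?P"
    by (auto simp: f_def)
  then obtain h where h: "h \<in> hom ?C ?P"
    and h_of: "\<And>z. z \<in> carrier G \<times> carrier H \<Longrightarrow> h (frag_of z) = f z"
    by (rule P.free_Abelian_group_universal) blast
  interpret h: group_hom ?C ?P h
    using h by unfold_locales
  have h_diff: "h (a - b) s = h a s \<otimes>\<^bsub>G\<^esub> inv\<^bsub>G\<^esub> (h b s)"
    if "a \<in> carrier ?C" "b \<in> carrier ?C" "s \<in> S" for a b s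
  proof -
    have "h (a - b) = h (a \<otimes>\<^bsub>?C\<^esub> inv\<^bsub>?C\<^esub> b)" using that by simp
    also have "\<dots> = h a \<otimes>\<^bsub>?P\<^esub> inv\<^bsub>?P\<^esub> (h b)"
      using that by (simp only: h.hom_mult h.hom_inv C.inv_closed)
    finally show ?thesis
      using that h.hom_closed[OF that(2)] by (simp add: inv_product_group)
  qed
  have hext: "h a = b" if "a \<in> carrier ?C" "b \<in> extensional S" "\<And>s. s \<in> S \<Longrightarrow> h a s = b s" for a b
    using h.hom_closed[OF that(1)] that by (intro extensionalityI[of _ S]) (auto simp: PiE_def)
  have hcl: "h a s \<in> carrier G" if "a \<in> carrier ?C" "s \<in> S" for a s
    using h.hom_closed[OF that(1)] that(2) by auto
  define N where "N = generate ?C (tensor_relators G H)"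
  have rel: "tensor_relators G H \<subseteq> carrier ?C"
    by (auto simp: tensor_relators_def dest!: subsetD[OF keys_diff])
  have N: "subgroup N ?C" unfolding N_def by (rule C.generate_is_subgroup[OF rel])
  have NC: "N \<subseteq> carrier ?C" using N by (rule subgroup.subset)
  have N0: "0 \<in> N" using subgroup.one_closed[OF N] by simp
  have Nadd: "a + b \<in> N" if "a \<in> N" "b \<in> N" for a b
    using subgroup.m_closed[OF N that] by simp
  have Nminus: "- a \<in> N" if "a \<in> N" for a
    using subgroup.m_inv_closed[OF N that] subsetD[OF NC that] by simp
  have Ndiff: "a - b \<in> N" if "a \<in> N" "b \<in> N" for a b
    using Nadd[OF that(1) Nminus[OF that(2)]] by simp
  have Nsum: "sum a A \<in> N" if "\<And>i. i \<in> A \<Longrightarrow> a i \<in> N" for a :: "'s \<Rightarrow> _" and A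
    using that by (induction A rule: infinite_finite_induct) (auto intro: N0 Nadd)
  have N1: "frag_of (x \<otimes>\<^bsub>G\<^esub> x', y) - frag_of (x, y) - frag_of (x', y) \<in> N"
    if "x \<in> carrier G" "x' \<in> carrier G" "y \<in> carrier H" for x x' y
    unfolding N_def by (rule generate.incl) (use that in \<open>auto simp: tensor_relators_def\<close>)
  have N2: "frag_of (x, y \<otimes>\<^bsub>H\<^esub> y') - frag_of (x, y) - frag_of (x, y') \<in> N"
    if "x \<in> carrier G" "y \<in> carrier H" "y' \<in> carrier H" for x y y'
    unfolding N_def by (rule generate.incl) (use that in \<open>auto simp: tensor_relators_def\<close>)
  \<comment> \<open>The relator for \<open>\<one> \<otimes> \<one>\<close> in the first slot
    collapses to minus this generator; \<open>N4\<close> is the same in the second slot.\<close>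
  have N3: "frag_of (\<one>\<^bsub>G\<^esub>, y) \<in> N" if "y \<in> carrier H" for y
    using Nminus[OF N1[of "\<one>\<^bsub>G\<^esub>" "\<one>\<^bsub>G\<^esub>" y]] that by simp
  have N4: "frag_of (x, \<one>\<^bsub>H\<^esub>) \<in> N" if "x \<in> carrier G" for x
    using Nminus[OF N2[of x "\<one>\<^bsub>H\<^esub>" "\<one>\<^bsub>H\<^esub>"]] that by simp
  have "h a = \<one>\<^bsub>?P\<^esub>" if "a \<in> tensor_relators G H" for a
  proof (rule hext)
    show "a \<in> carrier ?C" using that rel by blast
    show "h a s = \<one>\<^bsub>?P\<^esub> s" if s: "s \<in> S" for s
    proof -
      have car: "frag_of (x, y) \<in> carrier ?C" if "x \<in> carrier G" "y \<in> carrier H" for x y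
        using that by simp
      have car2: "frag_of (x, y) - frag_of (x', y') \<in> carrier ?C"
        if "x \<in> carrier G" "y \<in> carrier H" "x' \<in> carrier G" "y' \<in> carrier H" for x y x' y'
        using that by (auto dest!: subsetD[OF keys_diff])
      from \<open>a \<in> tensor_relators G H\<close> show ?thesis
        unfolding tensor_relators_def
      proof (elim UnE CollectE exE conjE)
        fix x x' y assume a: "a = frag_of (x \<otimes>\<^bsub>G\<^esub> x', y) - frag_of (x, y) - frag_of (x', y)"
          and c: "x \<in> carrier G" "x' \<in> carrier G" "y \<in> carrier H"
        show ?thesis
          unfolding a using c s
          by (simp add: h_diff car car2 h_of f_def G.int_pow_distrib G.inv_mult_group G.m_assoc del: carrier_free_Abelian_group_iff)
             (simp add: G.m_assoc[symmetric] G.m_comm)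
      next
        fix x y y' assume a: "a = frag_of (x, y \<otimes>\<^bsub>H\<^esub> y') - frag_of (x, y) - frag_of (x, y')"
          and c: "x \<in> carrier G" "y \<in> carrier H" "y' \<in> carrier H"
        show ?thesis
          unfolding a using c s
          by (simp add: h_diff car car2 h_of f_def k'mult lookup_add G.int_pow_mult del: carrier_free_Abelian_group_iff)
             (simp add: G.m_assoc G.m_comm[of "x [^]\<^bsub>G\<^esub> Poly_Mapping.lookup (k' y) s"])
      qed
    qed
  qed (auto simp: extensional_def)
  then have "tensor_relators G H \<subseteq> kernel ?C ?P h"
    using rel by (auto simp: kernel_def simp del: carrier_free_Abelian_group_iff)
  then have N_ker: "N \<subseteq> kernel ?C ?P h"
    unfolding N_def by (rule C.generate_subgroup_incl[OF _ h.subgroup_kernel])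
  \<comment> \<open>A normal form of tensors: one summand for each basis element, with all
    coefficients moved into the first slot.\<close>
  define \<psi> :: "('s \<Rightarrow> 'a) \<Rightarrow> _" where "\<psi> t = (\<Sum>s\<in>S. frag_of (t s, k (frag_of s)))" for t
  have \<psi>_car: "\<psi> t \<in> carrier ?C" if "\<And>s. s \<in> S \<Longrightarrow> t s \<in> carrier G" for t
    unfolding \<psi>_def using that by (intro sum_closed_free_Abelian_group) simp
  have \<psi>_mult: "\<psi> (\<lambda>s. x s \<otimes>\<^bsub>G\<^esub> y s) - \<psi> x - \<psi> y \<in> N"
    if "\<And>s. s \<in> S \<Longrightarrow> x s \<in> carrier G" "\<And>s. s \<in> S \<Longrightarrow> y s \<in> carrier G" for x y
  proof -
    have "\<psi> (\<lambda>s. x s \<otimes>\<^bsub>G\<^esub> y s) - \<psi> x - \<psi> y =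
        (\<Sum>s\<in>S. frag_of (x s \<otimes>\<^bsub>G\<^esub> y s, k (frag_of s)) - frag_of (x s, k (frag_of s)) - frag_of (y s, k (frag_of s)))"
      by (simp add: \<psi>_def sum_subtractf)
    also have "\<dots> \<in> N" using that by (intro Nsum N1) auto
    finally show ?thesis .
  qed
  have \<psi>_one: "\<psi> (\<lambda>s. \<one>\<^bsub>G\<^esub>) \<in> N"
    unfolding \<psi>_def by (intro Nsum N3) simp
  have \<psi>_cong: "\<psi> x = \<psi> y" if "\<And>s. s \<in> S \<Longrightarrow> x s = y s" for x y
    using that by (simp add: \<psi>_def)
  have gens: "frag_of (x, k u) - \<psi> (\<lambda>s. x [^]\<^bsub>G\<^esub> Poly_Mapping.lookup u s) \<in> N"
    if x: "x \<in> carrier G" and u: "Poly_Mapping.keys u \<subseteq> S" for x u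
    using u
  proof (induction u rule: free_Abelian_group_induct[consumes 1, case_names zero diff gen])
    case zero
    have "k 0 = \<one>\<^bsub>H\<^esub>" using k.hom_one by simp
    then show ?case using x by (simp add: Ndiff N4 \<psi>_one)
  next
    case (diff u v)
    have uv: "Poly_Mapping.keys (u - v) \<subseteq> S"
      using keys_diff[of u v] diff by blast
    have kuv: "k u \<in> carrier H" "k v \<in> carrier H" "k (u - v) \<in> carrier H"
      using diff uv by (auto intro!: k.hom_closed)
    have "k u = k ((u - v) \<otimes>\<^bsub>?F\<^esub> v)" by simp
    also have "\<dots> = k (u - v) \<otimes>\<^bsub>H\<^esub> k v"
      using diff uv by (intro k.hom_mult) auto
    finally have "frag_of (x, k u) - frag_of (x, k (u - v)) - frag_of (x, k v) \<in> N"
      using N2[OF x kuv(3,2)] by simp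
    moreover have "\<psi> (\<lambda>s. x [^]\<^bsub>G\<^esub> Poly_Mapping.lookup u s) - \<psi> (\<lambda>s. x [^]\<^bsub>G\<^esub> Poly_Mapping.lookup (u - v) s)
        - \<psi> (\<lambda>s. x [^]\<^bsub>G\<^esub> Poly_Mapping.lookup v s) \<in> N"
      using \<psi>_mult[of "\<lambda>s. x [^]\<^bsub>G\<^esub> Poly_Mapping.lookup (u - v) s" "\<lambda>s. x [^]\<^bsub>G\<^esub> Poly_Mapping.lookup v s"] x
      by (simp add: G.int_pow_mult[symmetric] lookup_minus)
    \<comment> \<open>Here \<open>a\<close>, \<open>b\<close>, \<open>c\<close> stand for the
      generators of \<open>u\<close>, \<open>v\<close>, \<open>u - v\<close> and \<open>pa\<close>,
      \<open>pb\<close>, \<open>pc\<close> for their normal forms: the claim for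
      \<open>u - v\<close> combines those for \<open>u\<close> and \<open>v\<close> with the two
      defects of additivity.\<close>
    moreover have "(a - pa) - (b - pb) - (a - c - b) + (pa - pc - pb) = c - pc"
      for a b c pa pb pc :: "'a \<times> 'b \<Rightarrow>\<^sub>0 int"
      by simp
    ultimately show ?case
      using Nadd[OF Ndiff[OF Ndiff[OF diff(3,4)]]] by metis
  next
    case (gen s)
    have "\<psi> (\<lambda>t. x [^]\<^bsub>G\<^esub> Poly_Mapping.lookup (frag_of s) t)
        = frag_of (x, k (frag_of s)) + (\<Sum>t\<in>S - {s}. frag_of (\<one>\<^bsub>G\<^esub>, k (frag_of t)))"
      using S gen x by (simp add: \<psi>_def sum.remove[of S s])
    moreover have "(\<Sum>t\<in>S - {s}. frag_of (\<one>\<^bsub>G\<^esub>, k (frag_of t))) \<in> N"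
      by (intro Nsum N3) auto
    ultimately show ?case by (simp add: Nminus)
  qed
  have all: "c - \<psi> (h c) \<in> N" if "Poly_Mapping.keys c \<subseteq> carrier G \<times> carrier H" for c
    using that
  proof (induction c rule: free_Abelian_group_induct[consumes 1, case_names zero diff gen])
    case zero
    have "h 0 = \<one>\<^bsub>?P\<^esub>" using h.hom_one by simp
    then have "\<psi> (h 0) = \<psi> (\<lambda>s. \<one>\<^bsub>G\<^esub>)" by (intro \<psi>_cong) simp
    then show ?case using \<psi>_one by (simp add: Nminus)
  next
    case (diff x y)
    have xy: "Poly_Mapping.keys (x - y) \<subseteq> carrier G \<times> carrier H"
      using keys_diff[of x y] diff by blast
    have "\<psi> (h x) = \<psi> (\<lambda>s. h (x - y) s \<otimes>\<^bsub>G\<^esub> h y s)"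
      using diff by (intro \<psi>_cong) (simp add: h_diff hcl G.m_assoc)
    then have "\<psi> (h x) - \<psi> (h (x - y)) - \<psi> (h y) \<in> N"
      using \<psi>_mult[of "h (x - y)" "h y"] diff xy by (auto simp: hcl)
    then have "(x - \<psi> (h x)) - (y - \<psi> (h y)) + (\<psi> (h x) - \<psi> (h (x - y)) - \<psi> (h y)) \<in> N"
      by (rule Nadd[OF Ndiff[OF diff(3,4)]])
    then show ?case by simp
  next
    case (gen a)
    obtain x y where a: "a = (x, y)" "x \<in> carrier G" "y \<in> carrier H" using gen by auto
    have "\<psi> (h (frag_of a)) = \<psi> (\<lambda>s. x [^]\<^bsub>G\<^esub> Poly_Mapping.lookup (k' y) s)"
      by (rule \<psi>_cong) (simp add: h_of a f_def)
    moreover have "Poly_Mapping.keys (k' y) \<subseteq> S"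
      using hom_in_carrier[of k' H ?F y] k' a by (simp add: iso_def)
    ultimately show ?case using gens[of x "k' y"] a by (simp add: kk')
  qed
  have ker: "h c = \<one>\<^bsub>?P\<^esub> \<longleftrightarrow> c \<in> N" if c: "c \<in> carrier ?C" for c
  proof
    assume "h c = \<one>\<^bsub>?P\<^esub>"
    \<comment> \<open>The normal form of a kernel element is a sum of generators with first entry
      \<open>\<one>\<close>, which lie in \<open>N\<close>.\<close>
    then have "\<psi> (h c) = \<psi> (\<lambda>s. \<one>\<^bsub>G\<^esub>)" by (intro \<psi>_cong) simp
    then show "c \<in> N" using all[of c] Nadd[OF _ \<psi>_one] c by fastforce
  qed (use N_ker in \<open>auto simp: kernel_def\<close>)
  have surj: "t \<in> h ` carrier ?C" if t: "t \<in> carrier ?P" for t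
  proof -
    have tG: "t s \<in> carrier G" if "s \<in> S" for s using t that by auto
    have "h (\<Sum>s\<in>A. frag_of (t s, k (frag_of s))) = (\<lambda>s\<in>S. if s \<in> A then t s else \<one>\<^bsub>G\<^esub>)"
      if "A \<subseteq> S" for A
      using finite_subset[OF that S] that
    proof (induction A)
      case empty
      then show ?case using h.hom_one by (auto simp: restrict_def)
    next
      case (insert a A)
      have "h (\<Sum>s\<in>insert a A. frag_of (t s, k (frag_of s)))
          = h (frag_of (t a, k (frag_of a)) \<otimes>\<^bsub>?C\<^esub> (\<Sum>s\<in>A. frag_of (t s, k (frag_of s))))"
        using insert by simp
      also have "\<dots> = h (frag_of (t a, k (frag_of a))) \<otimes>\<^bsub>?P\<^esub> h (\<Sum>s\<in>A. frag_of (t s, k (frag_of s)))"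
        using insert tG by (intro h.hom_mult sum_closed_free_Abelian_group) auto
      also have "\<dots> = (\<lambda>s\<in>S. if s \<in> insert a A then t s else \<one>\<^bsub>G\<^esub>)"
        using insert tG by (auto simp: h_of f_def k'k fun_eq_iff)
      finally show ?case .
    qed
    from this[of S] have "h (\<psi> t) = restrict t S"
      by (simp add: \<psi>_def cong: restrict_cong)
    also have "\<dots> = t" using t by (auto simp: PiE_restrict)
    finally show ?thesis using \<psi>_car[of t] tG by (metis imageI)
  qed
  show ?thesis
    unfolding tensor_group_def N_def[symmetric]
    using N h surj ker C.comm_group_axioms P.group_axioms
    by (intro FactGroup_iso_of_hom[of _ _ _ h]) (auto simp del: carrier_free_Abelian_group_iff carrier_product_group)
qed

section \<open>Tensoring a complex with the powers of R\<close>

lemma frag_hom_eqI: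
  fixes \<phi> \<psi> :: "('a \<Rightarrow>\<^sub>0 int) \<Rightarrow> 'b :: ab_group_add"
  assumes "\<And>x y. \<phi> (x - y) = \<phi> x - \<phi> y" "\<And>x y. \<psi> (x - y) = \<psi> x - \<psi> y"
    and "\<And>b. b \<in> Poly_Mapping.keys c \<Longrightarrow> \<phi> (frag_of b) = \<psi> (frag_of b)"
  shows "\<phi> c = \<psi> c"
proof -
  have "\<phi> 0 = 0" "\<psi> 0 = 0" using assms(1,2)[of 0 0] by simp_all
  with order_refl[of "Poly_Mapping.keys c"] show ?thesis
    by (rule_tac frag_induction[of c "Poly_Mapping.keys c" "\<lambda>c. \<phi> c = \<psi> c"]) (simp_all add: assms)
qed

lemma frag_cmul_diff: "frag_cmul k (x - y) = frag_cmul k x - frag_cmul k y"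
  by (rule poly_mapping_eqI) (simp add: lookup_minus algebra_simps)

lemma frag_extend_frag_extend:
  "frag_extend f (frag_extend g c) = frag_extend (\<lambda>x. frag_extend f (g x)) c"
  by (rule frag_hom_eqI) (simp_all add: frag_extend_diff)

text \<open>Not the total complex of a tensor product: the word length equals the homological
  degree, so each step of the differential of \<open>K\<close> goes with exactly one step of
  \<open>r_delta\<close>. The set \<open>A\<close>, with degrees \<open>dg\<close>, is a constant
  factor, and \<open>K\<close> carries the remaining internal degree.\<close>

definition tensor_complex :: "'b gcomplex \<Rightarrow> 'a set \<Rightarrow> ('a \<Rightarrow> int) \<Rightarrow> ('a \<times> 'b \<times> rgen list) gcomplex" where
  "tensor_complex K A dg =
     \<lparr>basis = (\<lambda>i j. {(a, b, w). a \<in> A \<and> b \<in> basis K i (j - dg a - R_deg w) \<and> w \<in> R_words i}),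
      diff = (\<lambda>(a, b, w). frag_extend (\<lambda>b'. frag_extend (\<lambda>w'. frag_of (a, b', w')) (r_delta w)) (diff K b))\<rparr>"

definition slice :: "('a \<times> 'b \<times> 'w \<Rightarrow>\<^sub>0 int) \<Rightarrow> 'a \<Rightarrow> 'w \<Rightarrow> ('b \<Rightarrow>\<^sub>0 int)" where
  "slice c a w = frag_extend (\<lambda>(a', b, w'). if a' = a \<and> w' = w then frag_of b else 0) c"

text \<open>
  The coordinates with respect to the basis of a power of \<open>R\<close> that consists of the images under
  \<open>r_delta\<close> of the words of length one less and of the words not ending in \<open>X0\<close>.
\<close>

definition reslice :: "('a \<times> 'b \<times> rgen list \<Rightarrow>\<^sub>0 int) \<Rightarrow> 'a \<Rightarrow> rgen list \<Rightarrow> ('b \<Rightarrow>\<^sub>0 int)" where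
  "reslice c a w = slice c a w -
     (if \<exists>u. w = u @ [X0, XM2] then slice c a (butlast (butlast w) @ [XM2, X0]) else 0)"

abbreviation ends_X0 :: "rgen list \<Rightarrow> bool" where
  "ends_X0 w \<equiv> \<exists>u. w = u @ [X0]"

lemma slice_diff: "slice (c - d) a w = slice c a w - slice d a w"
  by (simp add: slice_def frag_extend_diff)

lemma slice_0 [simp]: "slice 0 a w = 0"
  by (simp add: slice_def)

lemma reslice_diff: "reslice (c - d) a w = reslice c a w - reslice d a w"
  by (simp add: reslice_def slice_diff)

lemma slice_of: "slice (frag_of (a', b, w')) a w = (if a' = a \<and> w' = w then frag_of b else 0)"
  by (simp add: slice_def)

lemma lookup_slice: "Poly_Mapping.lookup (slice c a w) b = Poly_Mapping.lookup c (a, b, w)"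
  by (rule frag_hom_eqI[of "\<lambda>c. Poly_Mapping.lookup (slice c a w) b" "\<lambda>c. Poly_Mapping.lookup c (a, b, w)"])
     (auto simp: slice_diff lookup_minus slice_of split: if_splits)

lemma slice_ext: "(\<And>a w. slice c a w = slice d a w) \<Longrightarrow> c = d"
  by (rule poly_mapping_eqI) (metis lookup_slice prod_cases3)

lemma keys_slice: "Poly_Mapping.keys (slice c a w) = {b. (a, b, w) \<in> Poly_Mapping.keys c}"
  by (auto simp: in_keys_iff lookup_slice)

text \<open>The change of coordinates is unitriangular: only words ending in \<open>X0\<close>,
  \<open>XM2\<close> are corrected, and the correcting word ends in \<open>XM2\<close>,
  \<open>X0\<close>, where coordinate and slice coincide.\<close>

lemma reslice_ext:
  assumes "\<And>a w. reslice c a w = reslice d a w"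
  shows "c = d"
proof (rule slice_ext)
  have *: "slice c a w = slice d a w" if "\<nexists>u. w = u @ [X0, XM2]" for a w
    using assms[of a w] that by (simp add: reslice_def)
  show "slice c a w = slice d a w" for a w
  proof (cases "\<exists>u. w = u @ [X0, XM2]")
    case True
    have "slice c a (butlast (butlast w) @ [XM2, X0]) = slice d a (butlast (butlast w) @ [XM2, X0])"
      by (rule *) auto
    with assms[of a w] True show ?thesis by (simp add: reslice_def)
  qed (rule *)
qed

lemma slice_tensor:
  "slice (frag_extend (\<lambda>b'. frag_extend (\<lambda>w'. frag_of (a', b', w')) \<omega>) x) a w =
    (if a' = a then frag_cmul (Poly_Mapping.lookup \<omega> w) x else 0)"
proof -
  have 1: "slice (frag_extend (\<lambda>w'. frag_of (a', b, w')) \<omega>) a w =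
      (if a' = a then frag_cmul (Poly_Mapping.lookup \<omega> w) (frag_of b) else 0)" for b
    by (rule frag_hom_eqI[where c = \<omega>])
       (auto simp: slice_diff frag_extend_diff slice_of lookup_minus frag_cmul_diff_distrib)
  show ?thesis
    by (rule frag_hom_eqI[where c = x])
       (auto simp: slice_diff frag_extend_diff 1 frag_cmul_diff)
qed

lemma r_delta_simps:
  "r_delta [] = frag_of [X0]"
  "r_delta (u @ [X0]) = frag_of (u @ [X0, X0])"
  "r_delta (u @ [XM2]) = frag_of (u @ [XM2, X0]) + frag_of (u @ [X0, XM2])"
  by (simp_all add: r_delta_def frag_extend_add)

text \<open>The word \<open>v @ [X0]\<close> leads. For \<open>v = u @ [XM2]\<close> the second term
  \<open>u @ [X0, XM2]\<close> has the same coefficient as \<open>u @ [XM2, X0]\<close>, so the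
  subtraction removes it; images of other words contain neither.\<close>

lemma r_delta_coordinates:
  "Poly_Mapping.lookup (r_delta v) w -
     (if \<exists>u. w = u @ [X0, XM2] then Poly_Mapping.lookup (r_delta v) (butlast (butlast w) @ [XM2, X0]) else 0)
   = (if w = v @ [X0] then 1 else 0)"
proof (cases v rule: rev_cases)
  case Nil
  then show ?thesis by (auto simp: r_delta_simps)
next
  case (snoc u x)
  then show ?thesis
    by (cases x) (auto simp: r_delta_simps lookup_add butlast_append)
qed

text \<open>In the adapted coordinates the differential decouples: \<open>r_delta v\<close> is the
  single basis vector with index \<open>v @ [X0]\<close>, so the coordinate at \<open>w\<close> sees
  only the slice one letter shorter.\<close>

lemma reslice_tensor_diff:
  fixes e :: "'a \<times> 'b \<times> rgen list \<Rightarrow>\<^sub>0 int"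
  shows "reslice (frag_extend (diff (tensor_complex K A dg)) e) a w =
    (if ends_X0 w then frag_extend (diff K) (slice e a (butlast w)) else 0)"
proof (rule frag_hom_eqI[where c = e])
  fix g :: "'a \<times> 'b \<times> rgen list"
  obtain a' b v where g: "g = (a', b, v)" by (cases g)
  let ?l = "Poly_Mapping.lookup (r_delta v)"
  have "reslice (frag_extend (diff (tensor_complex K A dg)) (frag_of g)) a w =
     (if a' = a then frag_cmul (?l w -
        (if \<exists>u. w = u @ [X0, XM2] then ?l (butlast (butlast w) @ [XM2, X0]) else 0)) (diff K b) else 0)"
    by (simp add: g reslice_def tensor_complex_def slice_tensor frag_cmul_diff_distrib)
  also have "\<dots> = (if ends_X0 w then frag_extend (diff K) (slice (frag_of g) a (butlast w)) else 0)"
    by (auto simp: g r_delta_coordinates slice_of)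
  finally show "reslice (frag_extend (diff (tensor_complex K A dg)) (frag_of g)) a w = \<dots>" .
qed (simp_all add: reslice_diff frag_extend_diff slice_diff)

lemma slice_assemble:
  fixes s :: "'a \<Rightarrow> 'w \<Rightarrow> ('b \<Rightarrow>\<^sub>0 int)"
  assumes "finite X"
  shows "slice (\<Sum>(a, w)\<in>X. frag_extend (\<lambda>b. frag_of (a, b, w)) (s a w)) a' w' =
    (if (a', w') \<in> X then s a' w' else 0)"
proof -
  have 1: "slice (frag_extend (\<lambda>b. frag_of (a, b, w)) x) a' w' = (if a = a' \<and> w = w' then x else 0)"
    for a w x
    by (rule frag_hom_eqI[where c = x]) (auto simp: slice_diff frag_extend_diff slice_of)
  have "slice (\<Sum>(a, w)\<in>X. frag_extend (\<lambda>b. frag_of (a, b, w)) (s a w)) a' w' =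
      (\<Sum>(a, w)\<in>X. if a = a' \<and> w = w' then s a w else 0)"
    unfolding slice_def[of "sum _ _"] frag_extend_sum[OF assms]
    by (rule sum.cong) (auto simp flip: slice_def simp: 1)
  also have "\<dots> = (\<Sum>x\<in>X. if x = (a', w') then s a' w' else 0)"
    by (rule sum.cong) (auto split: if_splits)
  finally show ?thesis using assms by (simp add: sum.delta)
qed

section \<open>Words of R; cycles and boundaries in a common ambient group\<close>

lemma finite_R_words: "finite (R_words i)"
proof -
  have "finite (UNIV :: rgen set)"
    by (rule finite_subset[of _ "{XM2, X0}"]) (auto intro: rgen.exhaust)
  then have "finite {w :: rgen list. set w \<subseteq> UNIV \<and> length w = nat i}"
    by (rule finite_lists_length_eq)
  then show ?thesis
    by (rule finite_subset[rotated]) (auto simp: R_words_def)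
qed

lemma R_words_swap: "u @ [X0, XM2] \<in> R_words i \<longleftrightarrow> u @ [XM2, X0] \<in> R_words i"
  by (simp add: R_words_def)

lemma R_deg_append [simp]: "R_deg (u @ v) = R_deg u + R_deg v"
  by (simp add: R_deg_def)

lemma R_deg_simps [simp]: "R_deg [] = 0" "R_deg (x # w) = rdeg x + R_deg w"
  by (simp_all add: R_deg_def)

text \<open>Boundaries are not known to be chains of the expected bidegree, so cycles and boundaries
  are compared as subgroups of the free group on all generators.\<close>

abbreviation frags :: "('a \<Rightarrow>\<^sub>0 int) monoid" where
  "frags \<equiv> free_Abelian_group UNIV"

lemma subgroup_fragsI:
  assumes "0 \<in> Z" "\<And>x y. x \<in> Z \<Longrightarrow> y \<in> Z \<Longrightarrow> x - y \<in> Z"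
  shows "subgroup Z frags"
proof
  show "Z \<subseteq> carrier frags" by auto
  show "x \<otimes>\<^bsub>frags\<^esub> y \<in> Z" if "x \<in> Z" "y \<in> Z" for x y
    using assms(2)[OF that(1) assms(2)[OF assms(1) that(2)]] by simp
  show "inv\<^bsub>frags\<^esub> x \<in> Z" if "x \<in> Z" for x
    using assms(2)[OF assms(1) that] by simp
qed (use assms in simp)

definition cycle_set :: "'b gcomplex \<Rightarrow> int \<Rightarrow> int \<Rightarrow> ('b \<Rightarrow>\<^sub>0 int) set" where
  "cycle_set K i j = {c. Poly_Mapping.keys c \<subseteq> basis K i j \<and> frag_extend (diff K) c = 0}"

text \<open>Free abelian groups on different sets differ in their carriers only, and
  \<open>cycles\<close> overwrites the carrier; the target of the differential enters the kernel
  only through its unit.\<close>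

lemma cycles_eq: "cycles K i j = frags\<lparr>carrier := cycle_set K i j\<rparr>"
  by (auto simp: cycles_def chains_def free_Abelian_group_def kernel_def cycle_set_def)

lemma subgroup_cycle_set: "subgroup (cycle_set K i j) frags"
  by (rule subgroup_fragsI) (auto simp: cycle_set_def frag_extend_diff dest: subsetD[OF keys_diff])

lemma boundaries_eq:
  "boundaries K i j = {frag_extend (diff K) c | c. Poly_Mapping.keys c \<subseteq> basis K (i - 1) j}"
  by (auto simp: boundaries_def chains_def)

lemma subgroup_boundaries: "subgroup (boundaries K i j) frags"
proof (rule subgroup_fragsI)
  show "0 \<in> boundaries K i j"
    unfolding boundaries_eq by (auto intro!: exI[of _ 0])
  show "x - y \<in> boundaries K i j" if xy: "x \<in> boundaries K i j" "y \<in> boundaries K i j" for x y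
  proof -
    obtain c d where "x = frag_extend (diff K) c" "Poly_Mapping.keys c \<subseteq> basis K (i - 1) j"
      "y = frag_extend (diff K) d" "Poly_Mapping.keys d \<subseteq> basis K (i - 1) j"
      using xy unfolding boundaries_eq by auto
    then show ?thesis
      unfolding boundaries_eq using keys_diff[of c d]
      by (auto intro!: exI[of _ "c - d"] simp: frag_extend_diff)
  qed
qed

lemma homology_eq: "homology K i j = (frags\<lparr>carrier := cycle_set K i j\<rparr>) Mod boundaries K i j"
  by (simp add: homology_def cycles_eq)

lemma comm_group_homology: "comm_group (homology K i j)"
  unfolding homology_eq
  by (rule comm_group_subgroup_FactGroup(1)[OF abelian_free_Abelian_group subgroup_cycle_set subgroup_boundaries])

lemma comm_group_cycles: "comm_group (cycles K i j)"
proof (rule group.group_comm_groupI)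
  show "group (cycles K i j)"
    unfolding cycles_eq by (rule group.subgroup_imp_group[OF group_free_Abelian_group subgroup_cycle_set])
qed (simp add: cycles_eq add.commute)

lemma subgroup_zero_frags: "subgroup {0} frags"
  by (rule subgroup_fragsI) auto

text \<open>The isomorphism takes the cosets of all \<open>reslice\<close> coordinates. Nothing is
  divided out at words not ending in \<open>X0\<close>, since by \<open>reslice_tensor_diff\<close>
  a boundary has no coordinate there.\<close>

lemma homology_tensor_complex:
  fixes K :: "'b gcomplex" and dg :: "'a \<Rightarrow> int"
  assumes A: "finite A"
  shows "homology (tensor_complex K A dg) i j \<cong>
    product_group (A \<times> R_words i) (\<lambda>(a, w). cycles K i (j - dg a - R_deg w) Mod
      (if ends_X0 w then boundaries K i (j - dg a - R_deg w) else {0}))"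
proof -
  let ?T = "tensor_complex K A dg"
  let ?X = "A \<times> R_words i"
  define p where "p = (\<lambda>(a, w). j - dg a - R_deg w)"
  define B where "B x = (if ends_X0 (snd x) then boundaries K i (p x) else {0})" for x :: "'a \<times> rgen list"
  let ?Q = "\<lambda>x. (frags\<lparr>carrier := cycle_set K i (p x)\<rparr>) Mod B x"
  let ?P = "product_group ?X ?Q"
  have finX: "finite ?X" using A finite_R_words by blast
  have B: "subgroup (B x) frags" for x
    by (simp add: B_def subgroup_boundaries subgroup_zero_frags)
  have Q: "comm_group (?Q x)"
    "(\<lambda>z. B x #>\<^bsub>frags\<^esub> z) \<in> hom (frags\<lparr>carrier := cycle_set K i (p x)\<rparr>) (?Q x)"
    "carrier (?Q x) = (\<lambda>z. B x #>\<^bsub>frags\<^esub> z) ` cycle_set K i (p x)" for x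
    by (rule comm_group_subgroup_FactGroup[OF abelian_free_Abelian_group subgroup_cycle_set B])+
  have keys_cT: "Poly_Mapping.keys c \<subseteq> basis ?T k j \<longleftrightarrow> (\<forall>a w. Poly_Mapping.keys (slice c a w) \<subseteq>
     (if (a, w) \<in> A \<times> R_words k then basis K k (j - dg a - R_deg w) else {}))" for c k
    unfolding keys_slice by (auto simp: tensor_complex_def split: if_splits)
  have slice_out: "slice c a w = 0" if "Poly_Mapping.keys c \<subseteq> basis ?T k j" "(a, w) \<notin> A \<times> R_words k" for c k a w
    using that(1)[unfolded keys_cT, rule_format, of a w] that(2) by auto
  have slice_in: "Poly_Mapping.keys (slice c a w) \<subseteq> basis K k (j - dg a - R_deg w)"
    if "Poly_Mapping.keys c \<subseteq> basis ?T k j" for c k a w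
    using that[unfolded keys_cT, rule_format, of a w] by (auto split: if_splits)
  \<comment> \<open>The correcting word arises by exchanging two letters, so it has the length and
    the degree of \<open>w\<close>: the correction never leaves the bidegree.\<close>
  have reslice_out: "reslice c a w = 0" if "Poly_Mapping.keys c \<subseteq> basis ?T i j" "(a, w) \<notin> ?X" for c a w
    using that slice_out[OF that(1)] R_words_swap by (auto simp: reslice_def butlast_append)
  have reslice_in: "Poly_Mapping.keys (reslice c a w) \<subseteq> basis K i (p (a, w))"
    if "Poly_Mapping.keys c \<subseteq> basis ?T i j" for c a w
  proof -
    have "Poly_Mapping.keys (slice c a (butlast (butlast w) @ [XM2, X0])) \<subseteq> basis K i (p (a, w))"
      if "w = u @ [X0, XM2]" for u
      using slice_in[OF \<open>Poly_Mapping.keys c \<subseteq> basis ?T i j\<close>, of a "u @ [XM2, X0]"] that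
      by (simp add: p_def butlast_append)
    moreover have "Poly_Mapping.keys (slice c a w) \<subseteq> basis K i (p (a, w))"
      using slice_in[OF that] by (simp add: p_def)
    ultimately show ?thesis
      unfolding reslice_def by (auto dest!: subsetD[OF keys_diff])
  qed
  have cycle: "reslice c a w \<in> cycle_set K i (p (a, w))" if c: "c \<in> cycle_set ?T i j" for c a w
  proof -
    have dc: "frag_extend (diff ?T) c = 0" "Poly_Mapping.keys c \<subseteq> basis ?T i j"
      using c by (auto simp: cycle_set_def)
    \<comment> \<open>The coordinate of the vanishing differential at \<open>u @ [X0]\<close>
      isolates the slice at \<open>u\<close>, for every \<open>u\<close>.\<close>
    have "frag_extend (diff K) (slice c a u) = 0" for u
      using reslice_tensor_diff[of K A dg c a "u @ [X0]"] dc(1) by (simp add: reslice_def)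
    then show ?thesis
      using reslice_in[OF dc(2)] by (simp add: cycle_set_def reslice_def frag_extend_diff)
  qed
  have cycleI: "c \<in> cycle_set ?T i j"
    if c: "Poly_Mapping.keys c \<subseteq> basis ?T i j" and z: "\<And>a w. (a, w) \<in> ?X \<Longrightarrow> frag_extend (diff K) (reslice c a w) = 0" for c
  proof -
    have z': "frag_extend (diff K) (reslice c a w) = 0" for a w
      by (cases "(a, w) \<in> ?X") (simp_all only: z reslice_out[OF c] frag_extend_0 not_False_eq_True)
    have *: "frag_extend (diff K) (slice c a w) = 0" if "\<nexists>u. w = u @ [X0, XM2]" for a w
      using z'[of a w] that by (simp add: reslice_def)
    have "frag_extend (diff K) (slice c a w) = 0" for a w
    proof (cases "\<exists>u. w = u @ [X0, XM2]")
      case True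
      have "frag_extend (diff K) (slice c a (butlast (butlast w) @ [XM2, X0])) = 0"
        by (rule *) auto
      with z'[of a w] True show ?thesis by (simp add: reslice_def frag_extend_diff)
    qed (rule *)
    then have "frag_extend (diff ?T) c = 0"
      by (intro reslice_ext) (simp add: reslice_tensor_diff, simp add: reslice_def)
    with c show ?thesis by (simp add: cycle_set_def)
  qed
  have bound: "c \<in> boundaries ?T i j \<longleftrightarrow> (\<forall>(a, w)\<in>?X. reslice c a w \<in> B (a, w))"
    if c: "Poly_Mapping.keys c \<subseteq> basis ?T i j" for c
  proof
    assume "c \<in> boundaries ?T i j"
    then obtain e where e: "c = frag_extend (diff ?T) e" "Poly_Mapping.keys e \<subseteq> basis ?T (i - 1) j"
      unfolding boundaries_eq by auto
    show "\<forall>(a, w)\<in>?X. reslice c a w \<in> B (a, w)"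
    proof clarify
      fix a w
      show "reslice c a w \<in> B (a, w)"
        using slice_in[OF e(2), of a "butlast w"]
        by (auto simp: e(1) reslice_tensor_diff B_def p_def boundaries_eq)
    qed
  next
    assume r: "\<forall>(a, w)\<in>?X. reslice c a w \<in> B (a, w)"
    \<comment> \<open>Labels one letter shorter; as \<open>X0\<close> has degree 0, \<open>p\<close>
      takes the same value at \<open>u\<close> and at \<open>u @ [X0]\<close>.\<close>
    let ?Y = "A \<times> R_words (i - 1)"
    have "\<exists>e. frag_extend (diff K) e = reslice c a (u @ [X0]) \<and> Poly_Mapping.keys e \<subseteq> basis K (i - 1) (p (a, u))"
      if "(a, u) \<in> ?Y" for a u
    proof -
      have "(a, u @ [X0]) \<in> ?X" using that by (auto simp: R_words_def)
      then have "reslice c a (u @ [X0]) \<in> boundaries K i (p (a, u))"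
        using r by (fastforce simp: B_def p_def)
      then show ?thesis by (auto simp: boundaries_eq)
    qed
    then obtain s where s: "\<And>a u. (a, u) \<in> ?Y \<Longrightarrow> frag_extend (diff K) (s a u) = reslice c a (u @ [X0])"
      "\<And>a u. (a, u) \<in> ?Y \<Longrightarrow> Poly_Mapping.keys (s a u) \<subseteq> basis K (i - 1) (p (a, u))"
      by metis
    define e where "e = (\<Sum>(a, u)\<in>?Y. frag_extend (\<lambda>b. frag_of (a, b, u)) (s a u))"
    have "finite ?Y" using A finite_R_words by blast
    then have e: "slice e a u = (if (a, u) \<in> ?Y then s a u else 0)" for a u
      unfolding e_def by (rule slice_assemble)
    have "Poly_Mapping.keys e \<subseteq> basis ?T (i - 1) j"
      unfolding keys_cT e using s(2) by (simp add: p_def)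
    moreover have "frag_extend (diff ?T) e = c"
    proof (rule reslice_ext)
      fix a w
      show "reslice (frag_extend (diff ?T) e) a w = reslice c a w"
      proof (cases "(a, w) \<in> ?X")
        case True
        then have "\<not> ends_X0 w \<Longrightarrow> reslice c a w = 0"
          using r by (fastforce simp: B_def)
        moreover have "(a, u) \<in> ?Y" if "w = u @ [X0]" for u
          using True that by (auto simp: R_words_def)
        ultimately show ?thesis
          using s(1) by (auto simp: reslice_tensor_diff e)
      next
        case False
        then have "(a, u) \<notin> ?Y" if "w = u @ [X0]" for u
          using that by (auto simp: R_words_def)
        then show ?thesis
          using reslice_out[OF c False] by (auto simp: reslice_tensor_diff e)
      qed
    qed
    ultimately show "c \<in> boundaries ?T i j"
      unfolding boundaries_eq by auto
  qed
  define h where "h c = (\<lambda>x\<in>?X. B x #>\<^bsub>frags\<^esub> reslice c (fst x) (snd x))" for c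
  have "homology ?T i j \<cong> ?P"
    unfolding homology_eq
  proof (rule subgroup_FactGroup_iso[where h = h])
    show "group ?P" using Q(1) by (auto intro!: product_group simp: comm_group_def)
    show "h \<in> hom (frags\<lparr>carrier := cycle_set ?T i j\<rparr>) ?P"
    proof (rule homI)
      show "h x \<in> carrier ?P" if "x \<in> carrier (frags\<lparr>carrier := cycle_set ?T i j\<rparr>)" for x
        using that cycle by (auto simp: h_def Q(3))
      show "h (x \<otimes>\<^bsub>frags\<lparr>carrier := cycle_set ?T i j\<rparr>\<^esub> y) = h x \<otimes>\<^bsub>?P\<^esub> h y"
        if "x \<in> carrier (frags\<lparr>carrier := cycle_set ?T i j\<rparr>)" "y \<in> carrier (frags\<lparr>carrier := cycle_set ?T i j\<rparr>)" for x y
      proof -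
        have "reslice (x + y) a w = reslice x a w + reslice y a w" for a w
          using reslice_diff[of "x + y" y a w] by simp
        moreover have "B (a, w) #>\<^bsub>frags\<^esub> (reslice x a w + reslice y a w) =
          (B (a, w) #>\<^bsub>frags\<^esub> reslice x a w) \<otimes>\<^bsub>?Q (a, w)\<^esub> (B (a, w) #>\<^bsub>frags\<^esub> reslice y a w)" for a w
          using hom_mult[OF Q(2)[of "(a, w)"], of "reslice x a w" "reslice y a w"] cycle that by simp
        ultimately show ?thesis
          by (auto simp: h_def fun_eq_iff simp del: mult_FactGroup)
      qed
    qed
    show "carrier ?P \<subseteq> h ` cycle_set ?T i j"
    proof
      fix y assume "y \<in> carrier ?P"
      then have y: "y \<in> extensional ?X" and "\<And>x. x \<in> ?X \<Longrightarrow> \<exists>z \<in> cycle_set K i (p x). y x = B x #>\<^bsub>frags\<^esub> z"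
        by (auto simp: PiE_iff Q(3) image_iff)
      then obtain z where z: "\<And>x. x \<in> ?X \<Longrightarrow> z x \<in> cycle_set K i (p x)"
         "\<And>x. x \<in> ?X \<Longrightarrow> y x = B x #>\<^bsub>frags\<^esub> z x" by metis
      \<comment> \<open>Undoes the triangular change: the slice at \<open>u @ [X0, XM2]\<close> is
        the prescribed coordinate plus the one at \<open>u @ [XM2, X0]\<close>.\<close>
      define s where "s a w = z (a, w) +
        (if \<exists>u. w = u @ [X0, XM2] then z (a, butlast (butlast w) @ [XM2, X0]) else 0)" for a w
      define c where "c = (\<Sum>(a, w)\<in>?X. frag_extend (\<lambda>b. frag_of (a, b, w)) (s a w))"
      have slice: "slice c a w = (if (a, w) \<in> ?X then s a w else 0)" for a w
        unfolding c_def by (rule slice_assemble[OF finX])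
      have keys_z: "Poly_Mapping.keys (z (a, w)) \<subseteq> basis K i (p (a, w))" if "(a, w) \<in> ?X" for a w
        using z(1)[OF that] by (simp add: cycle_set_def)
      have swap: "p (a, u @ [XM2, X0]) = p (a, u @ [X0, XM2])" for a u
        by (simp add: p_def)
      have "Poly_Mapping.keys (s a w) \<subseteq> basis K i (p (a, w))" if x: "(a, w) \<in> ?X" for a w
      proof (cases "\<exists>u. w = u @ [X0, XM2]")
        case True
        then obtain u where u: "w = u @ [X0, XM2]" by blast
        have "Poly_Mapping.keys (z (a, u @ [XM2, X0])) \<subseteq> basis K i (p (a, w))"
          using keys_z[of a "u @ [XM2, X0]"] x u R_words_swap[of u i] swap[of a u] by auto
        then show ?thesis
          using keys_z[OF x] u keys_add[of "z (a, w)" "z (a, u @ [XM2, X0])"]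
          by (auto simp: s_def butlast_append)
      qed (use keys_z[OF x] in \<open>simp add: s_def\<close>)
      then have c: "Poly_Mapping.keys c \<subseteq> basis ?T i j"
        unfolding keys_cT slice by (simp add: p_def)
      have re: "reslice c a w = z (a, w)" if x: "(a, w) \<in> ?X" for a w
        using x by (auto simp: reslice_def slice s_def butlast_append R_words_swap)
      have "c \<in> cycle_set ?T i j"
        using z(1) by (intro cycleI c) (auto simp: re cycle_set_def)
      moreover have "h c = y"
        using y by (intro extensionalityI[of _ ?X]) (auto simp: h_def re z(2))
      ultimately show "y \<in> h ` cycle_set ?T i j" by blast
    qed
    show "h z = \<one>\<^bsub>?P\<^esub> \<longleftrightarrow> z \<in> boundaries ?T i j" if z: "z \<in> cycle_set ?T i j" for z
    proof -
      have "h z = \<one>\<^bsub>?P\<^esub> \<longleftrightarrow> (\<forall>x\<in>?X. B x #>\<^bsub>frags\<^esub> reslice z (fst x) (snd x) = B x)"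
        by (auto simp: h_def fun_eq_iff restrict_def FactGroup_def)
      also have "\<dots> \<longleftrightarrow> (\<forall>x\<in>?X. reslice z (fst x) (snd x) \<in> B x)"
      proof (rule ball_cong[OF refl])
        fix x
        show "B x #>\<^bsub>frags\<^esub> reslice z (fst x) (snd x) = B x \<longleftrightarrow> reslice z (fst x) (snd x) \<in> B x"
          using group.coset_join1[OF group_free_Abelian_group _ _ B] group.coset_join2[OF group_free_Abelian_group _ B]
            subgroup.subset[OF B]
          by (metis carrier_free_Abelian_group_iff subset_UNIV)
      qed
      also have "\<dots> \<longleftrightarrow> z \<in> boundaries ?T i j"
        using z by (subst bound) (auto simp: cycle_set_def)
      finally show ?thesis .
    qed
  qed (auto intro: abelian_free_Abelian_group subgroup_cycle_set subgroup_boundaries)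
  also have "?P = product_group ?X (\<lambda>(a, w). cycles K i (j - dg a - R_deg w) Mod
      (if ends_X0 w then boundaries K i (j - dg a - R_deg w) else {0}))"
    by (intro arg_cong[of _ _ "product_group ?X"]) (auto simp: B_def p_def cycles_eq)
  finally show ?thesis .
qed

section \<open>Direct products and tensor powers; image and cokernel of Delta\<close>

lemma comm_group_tensor_group:
  assumes "group G" "group H"
  shows "comm_group (tensor_group G H)"
proof -
  interpret G: group G by fact
  interpret H: group H by fact
  have "tensor_relators G H \<subseteq> carrier (free_Abelian_group (carrier G \<times> carrier H))"
    by (auto simp: tensor_relators_def dest!: subsetD[OF keys_diff])
  then show ?thesis
    unfolding tensor_group_def
    by (intro comm_group.abelian_FactGroup abelian_free_Abelian_group group.generate_is_subgroup) auto
qed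

lemma comm_group_DirProd:
  assumes "comm_group G" "comm_group H"
  shows "comm_group (G \<times>\<times> H)"
  using assms
  by (intro group.group_comm_groupI DirProd_group) (auto simp: comm_group_def comm_monoid.m_comm)

lemma DirProd_isoI:
  assumes "G \<cong> G'" "H \<cong> H'"
  shows "G \<times>\<times> H \<cong> G' \<times>\<times> H'"
proof -
  obtain g h where "g \<in> iso G G'" "h \<in> iso H H'" using assms by (auto simp: is_iso_def)
  then have "(\<lambda>(x, y). (g x, h y)) \<in> iso (G \<times>\<times> H) (G' \<times>\<times> H')"
    by (auto simp: iso_def hom_def intro!: bij_betw_map_prod[unfolded map_prod_def])
  then show ?thesis by (auto simp: is_iso_def)
qed

lemma product_group_cong:
  assumes "\<And>i. i \<in> I \<Longrightarrow> G i = H i"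
  shows "product_group I G = product_group I H"
  using assms by (simp add: product_group_def cong: PiE_cong restrict_cong)

lemma tensor_group_iso_power:
  assumes "comm_group G" "group H" "free_Abelian_group S \<cong> H" "finite S"
  shows "tensor_group G H \<cong> product_group S (\<lambda>_. G)"
  using assms tensor_group_free_iso unfolding is_iso_def by blast

text \<open>The scalar version of \<open>reslice\<close>: the same change of basis on the powers of
  R alone, where the image of Delta and the quotient by it have to be identified.\<close>

definition rcoord :: "(rgen list \<Rightarrow>\<^sub>0 int) \<Rightarrow> rgen list \<Rightarrow> int" where
  "rcoord x w = Poly_Mapping.lookup x w -
     (if \<exists>u. w = u @ [X0, XM2] then Poly_Mapping.lookup x (butlast (butlast w) @ [XM2, X0]) else 0)"

lemma rcoord_diff: "rcoord (x - y) w = rcoord x w - rcoord y w"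
  by (simp add: rcoord_def lookup_minus)

lemma rcoord_delta:
  "rcoord (frag_extend r_delta c) w = (if ends_X0 w then Poly_Mapping.lookup c (butlast w) else 0)"
proof (rule frag_hom_eqI[where c = c])
  show "rcoord (frag_extend r_delta (frag_of v)) w =
      (if ends_X0 w then Poly_Mapping.lookup (frag_of v) (butlast w) else 0)" for v
    using r_delta_coordinates[of v w] by (auto simp: rcoord_def)
qed (simp_all add: rcoord_diff frag_extend_diff lookup_minus)

lemma rcoord_ext:
  assumes "\<And>w. rcoord x w = rcoord y w"
  shows "x = y"
proof (rule poly_mapping_eqI)
  have *: "Poly_Mapping.lookup x w = Poly_Mapping.lookup y w" if "\<nexists>u. w = u @ [X0, XM2]" for w
    using assms[of w] that by (simp add: rcoord_def)
  show "Poly_Mapping.lookup x w = Poly_Mapping.lookup y w" for w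
  proof (cases "\<exists>u. w = u @ [X0, XM2]")
    case True
    have "Poly_Mapping.lookup x (butlast (butlast w) @ [XM2, X0]) = Poly_Mapping.lookup y (butlast (butlast w) @ [XM2, X0])"
      by (rule *) auto
    with assms[of w] True show ?thesis by (simp add: rcoord_def)
  qed (rule *)
qed

definition R_basis :: "int \<Rightarrow> int \<Rightarrow> rgen list set" where
  "R_basis h q = {w \<in> R_words h. R_deg w = q}"

lemma R_power_eq: "R_power h q = free_Abelian_group (R_basis h q)"
  by (simp add: R_power_def R_basis_def)

lemma finite_R_basis: "finite (R_basis h q)"
  by (simp add: R_basis_def finite_R_words)

lemma R_basis_Suc: "u @ [X0] \<in> R_basis h q \<longleftrightarrow> u \<in> R_basis (h - 1) q"
  by (auto simp: R_basis_def R_words_def)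

lemma R_image_eq: "R_image h q = {frag_extend r_delta c | c. Poly_Mapping.keys c \<subseteq> R_basis (h - 1) q}"
  by (auto simp: R_image_def R_power_eq)

lemma keys_r_delta: "u \<in> R_basis (h - 1) q \<Longrightarrow> Poly_Mapping.keys (r_delta u) \<subseteq> R_basis h q"
proof (cases u rule: rev_cases)
  case (snoc v x)
  assume "u \<in> R_basis (h - 1) q"
  then show ?thesis
    using snoc keys_add[of "frag_of (v @ [XM2, X0])" "frag_of (v @ [X0, XM2])"]
    by (cases x) (auto simp: r_delta_simps R_basis_def R_words_def)
qed (auto simp: r_delta_simps R_basis_def R_words_def)

lemma R_image_subset: "R_image h q \<subseteq> carrier (R_power h q)"
proof
  fix x assume "x \<in> R_image h q"
  then obtain c where "x = frag_extend r_delta c" "Poly_Mapping.keys c \<subseteq> R_basis (h - 1) q"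
    by (auto simp: R_image_eq)
  then show "x \<in> carrier (R_power h q)"
    using keys_frag_extend[of r_delta c] keys_r_delta[of _ h q] by (auto simp: R_power_eq)
qed

lemma subgroup_R_image: "subgroup (R_image h q) (R_power h q)"
proof -
  have sub: "x - y \<in> R_image h q" if xy: "x \<in> R_image h q" "y \<in> R_image h q" for x y
  proof -
    obtain c d where "x = frag_extend r_delta c" "Poly_Mapping.keys c \<subseteq> R_basis (h - 1) q"
      "y = frag_extend r_delta d" "Poly_Mapping.keys d \<subseteq> R_basis (h - 1) q"
      using xy unfolding R_image_eq by auto
    then show ?thesis
      unfolding R_image_eq using keys_diff[of c d]
      by (auto intro!: exI[of _ "c - d"] simp: frag_extend_diff)
  qed
  have zero: "0 \<in> R_image h q"
    unfolding R_image_eq by (auto intro!: exI[of _ 0])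
  show ?thesis
  proof
    show "R_image h q \<subseteq> carrier (R_power h q)" by (rule R_image_subset)
    show "x \<otimes>\<^bsub>R_power h q\<^esub> y \<in> R_image h q" if "x \<in> R_image h q" "y \<in> R_image h q" for x y
      using sub[OF that(1) sub[OF zero that(2)]] by (simp add: R_power_eq)
    show "inv\<^bsub>R_power h q\<^esub> x \<in> R_image h q" if "x \<in> R_image h q" for x
      using sub[OF zero that] R_image_subset that by (fastforce simp: R_power_eq)
  qed (simp add: zero R_power_eq)
qed

text \<open>Words one letter shorter would index the image as well; labels ending in
  \<open>X0\<close> are chosen so that, together with the words of the quotient, they partition
  \<open>R_basis h q\<close>. Injectivity holds since \<open>rcoord_delta\<close> recovers the
  coefficients.\<close>

lemma free_iso_R_image:
  "free_Abelian_group {w \<in> R_basis h q. ends_X0 w} \<cong> (R_power h q)\<lparr>carrier := R_image h q\<rparr>"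
proof -
  let ?U = "{w \<in> R_basis h q. ends_X0 w}"
  let ?k = "frag_extend (\<lambda>w. r_delta (butlast w))"
  let ?b = "frag_extend (\<lambda>w. frag_of (butlast w))"
  have k: "?k c = frag_extend r_delta (?b c)" for c
    by (simp add: frag_extend_frag_extend)
  have b: "Poly_Mapping.keys (?b c) \<subseteq> R_basis (h - 1) q" if "Poly_Mapping.keys c \<subseteq> ?U" for c
    using that keys_frag_extend[of "\<lambda>w. frag_of (butlast w)" c] by (fastforce simp: R_basis_Suc)
  have "inj_on ?k (carrier (free_Abelian_group ?U))"
  proof (rule inj_on_inverseI[of _ "frag_extend (\<lambda>w. frag_of (w @ [X0])) \<circ> the_inv (frag_extend r_delta)"])
    fix c assume "c \<in> carrier (free_Abelian_group ?U)"
    then have c: "Poly_Mapping.keys c \<subseteq> ?U" by simp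
    have "inj (frag_extend r_delta)"
    proof (rule injI)
      fix c d assume "frag_extend r_delta c = frag_extend r_delta d"
      then show "c = d"
        using rcoord_delta[of c "w @ [X0]" for w] rcoord_delta[of d "w @ [X0]" for w]
        by (intro poly_mapping_eqI) simp
    qed
    then have "the_inv (frag_extend r_delta) (?k c) = ?b c"
      unfolding k by (rule the_inv_f_f)
    then have "(frag_extend (\<lambda>w. frag_of (w @ [X0])) \<circ> the_inv (frag_extend r_delta)) (?k c)
        = frag_extend (\<lambda>w. frag_of (butlast w @ [X0])) c"
      by (simp add: frag_extend_frag_extend)
    also have "\<dots> = frag_extend frag_of c"
      using c by (intro frag_extend_eq) auto
    finally show "(frag_extend (\<lambda>w. frag_of (w @ [X0])) \<circ> the_inv (frag_extend r_delta)) (?k c) = c"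
      by (simp flip: frag_expansion)
  qed
  moreover have "?k ` carrier (free_Abelian_group ?U) = R_image h q"
  proof
    show "?k ` carrier (free_Abelian_group ?U) \<subseteq> R_image h q"
    proof
      fix x assume "x \<in> ?k ` carrier (free_Abelian_group ?U)"
      then obtain c where "x = frag_extend r_delta (?b c)" "Poly_Mapping.keys c \<subseteq> ?U"
        unfolding k by auto
      then show "x \<in> R_image h q" using b[of c] by (auto simp only: R_image_eq)
    qed
    show "R_image h q \<subseteq> ?k ` carrier (free_Abelian_group ?U)"
    proof
      fix x assume "x \<in> R_image h q"
      then obtain c where c: "x = frag_extend r_delta c" "Poly_Mapping.keys c \<subseteq> R_basis (h - 1) q"
        by (auto simp: R_image_eq)
      then have "x = ?k (frag_extend (\<lambda>w. frag_of (w @ [X0])) c)"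
        by (simp add: frag_extend_frag_extend)
      moreover have "Poly_Mapping.keys (frag_extend (\<lambda>w. frag_of (w @ [X0])) c) \<subseteq> ?U"
        using c keys_frag_extend[of "\<lambda>w. frag_of (w @ [X0])" c]
        by (fastforce simp: R_basis_Suc dest: subsetD)
      ultimately show "x \<in> ?k ` carrier (free_Abelian_group ?U)" by auto
    qed
  qed
  ultimately show ?thesis
    by (auto simp: is_iso_def iso_def hom_def bij_betw_def frag_extend_add R_power_eq intro!: exI[of _ ?k])
qed

text \<open>Modulo the image, \<open>u @ [XM2, X0]\<close> is minus \<open>u @ [X0, XM2]\<close>,
  and every other word ending in \<open>X0\<close> is zero; \<open>\<phi>\<close> performs this
  normalisation.\<close>

lemma free_iso_R_quotient:
  "free_Abelian_group {w \<in> R_basis h q. \<not> ends_X0 w} \<cong> R_power h q Mod R_image h q"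
proof -
  let ?N = "{w \<in> R_basis h q. \<not> ends_X0 w}"
  define \<phi> where "\<phi> = frag_extend (\<lambda>w. if ends_X0 w then
     (if \<exists>u. w = u @ [XM2, X0] then - frag_of (butlast (butlast w) @ [X0, XM2]) else 0) else frag_of w)"
  have \<phi>: "Poly_Mapping.lookup (\<phi> x) w = (if ends_X0 w then 0 else rcoord x w)" for x w
  proof (rule frag_hom_eqI[where c = x])
    fix v :: "rgen list"
    show "Poly_Mapping.lookup (\<phi> (frag_of v)) w = (if ends_X0 w then 0 else rcoord (frag_of v) w)"
    proof (cases v rule: rev_cases)
      case (snoc u y)
      then show ?thesis
      proof (cases u rule: rev_cases)
        case (snoc u' z)
        then show ?thesis using \<open>v = u @ [y]\<close>
          by (cases y; cases z) (auto simp: \<phi>_def rcoord_def butlast_append)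
      qed (cases y, auto simp: \<phi>_def rcoord_def)
    qed (auto simp: \<phi>_def rcoord_def)
  qed (auto simp: \<phi>_def frag_extend_diff lookup_minus rcoord_diff)
  have keys_\<phi>: "Poly_Mapping.keys (\<phi> x) \<subseteq> ?N" if "Poly_Mapping.keys x \<subseteq> R_basis h q" for x
  proof
    fix w assume "w \<in> Poly_Mapping.keys (\<phi> x)"
    then have w: "\<not> ends_X0 w" "rcoord x w \<noteq> 0" by (auto simp: in_keys_iff \<phi> split: if_splits)
    have "w \<in> R_basis h q"
    proof (cases "w \<in> Poly_Mapping.keys x")
      case False
      with w obtain u where "w = u @ [X0, XM2]" "u @ [XM2, X0] \<in> Poly_Mapping.keys x"
        by (auto simp: rcoord_def in_keys_iff butlast_append split: if_splits)
      then show ?thesis using that by (auto simp: R_basis_def R_words_def)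
    qed (use that in blast)
    with w show "w \<in> ?N" by simp
  qed
  have "R_power h q Mod R_image h q \<cong> free_Abelian_group ?N"
  proof (rule FactGroup_iso_of_hom[where h = \<phi>])
    show "comm_group (R_power h q)" by (simp add: R_power_eq abelian_free_Abelian_group)
    show "\<phi> \<in> hom (R_power h q) (free_Abelian_group ?N)"
      using keys_\<phi> by (auto simp: hom_def R_power_eq) (auto simp: \<phi>_def frag_extend_add)
    show "carrier (free_Abelian_group ?N) \<subseteq> \<phi> ` carrier (R_power h q)"
    proof
      fix c assume "c \<in> carrier (free_Abelian_group ?N)"
      then have c: "Poly_Mapping.keys c \<subseteq> ?N" by simp
      have "\<phi> c = frag_extend frag_of c"
        unfolding \<phi>_def using c by (intro frag_extend_eq) auto
      with c show "c \<in> \<phi> ` carrier (R_power h q)"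
        by (auto simp: R_power_eq image_iff simp flip: frag_expansion intro!: bexI[of _ c])
    qed
    show "\<phi> x = \<one>\<^bsub>free_Abelian_group ?N\<^esub> \<longleftrightarrow> x \<in> R_image h q" if "x \<in> carrier (R_power h q)" for x
    proof
      assume "x \<in> R_image h q"
      then show "\<phi> x = \<one>\<^bsub>free_Abelian_group ?N\<^esub>"
        by (auto simp: R_image_eq \<phi> rcoord_delta intro!: poly_mapping_eqI)
    next
      assume "\<phi> x = \<one>\<^bsub>free_Abelian_group ?N\<^esub>"
      then have 0: "rcoord x w = 0" if "\<not> ends_X0 w" for w
        using \<phi>[of x w] that by simp
      \<comment> \<open>When the other coordinates vanish, the coefficients at words ending in
        \<open>X0\<close> are the coefficients of a preimage under Delta.\<close>
      define c where "c = frag_extend (\<lambda>w. if ends_X0 w then frag_of (butlast w) else 0) x"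
      have c: "Poly_Mapping.lookup c u = Poly_Mapping.lookup x (u @ [X0])" for u
        unfolding c_def
        by (rule frag_hom_eqI[where c = x])
           (auto simp: frag_extend_diff lookup_minus, metis append_butlast_last_id snoc_eq_iff_butlast)
      have "x = frag_extend r_delta c"
        by (rule rcoord_ext) (auto simp: rcoord_delta 0 c, simp add: rcoord_def)
      moreover have "Poly_Mapping.keys c \<subseteq> R_basis (h - 1) q"
        using that by (auto simp: in_keys_iff c R_power_eq simp flip: R_basis_Suc)
      ultimately show "x \<in> R_image h q" by (auto simp: R_image_eq)
    qed
  qed (auto intro: subgroup_R_image)
  moreover have "group (R_power h q Mod R_image h q)"
    using comm_group.abelian_FactGroup[OF abelian_free_Abelian_group subgroup_R_image[unfolded R_power_eq]]
    by (simp add: R_power_eq comm_group_def)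
  ultimately show ?thesis by (simp add: group.iso_sym)
qed

section \<open>Sorting the homology by degrees\<close>

lemma finite_V_words: "finite S \<Longrightarrow> finite (V_words S)"
proof -
  have "finite (UNIV :: vgen set)"
    by (rule finite_subset[of _ "{VP, VM}"]) (auto intro: vgen.exhaust)
  then show "finite S \<Longrightarrow> finite (V_words S)"
    unfolding V_words_def by (intro finite_PiE) auto
qed

text \<open>The product over pairs of a vertex generator and a word is sorted by their degrees
  \<open>r\<close> and \<open>q\<close>, which determine \<open>p\<close>. For each triple the words
  are split by whether they end in \<open>X0\<close>, which yields as many factors as the ranks of
  the image and of the quotient. For \<open>i = 0\<close> only the empty word occurs, so only cycles
  remain, in accordance with the image of Delta being zero there.\<close>

lemma homology_tensor_complex_sum:
  assumes S: "finite S"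
  shows "homology (tensor_complex K (V_words S) (V_deg S)) i j \<cong>
      sum_group {(p, q, r). p + q + r = j} (\<lambda>(p, q, r).
        tensor_group
          (tensor_group (homology K i p) ((R_power i q)\<lparr>carrier := R_image i q\<rparr>) \<times>\<times>
           tensor_group (cycles K i p) (R_power i q Mod R_image i q))
          (V_power S r))"
    (is "_ \<cong> sum_group ?I ?G")
proof -
  let ?X = "V_words S \<times> R_words i"
  define Q where "Q w p = cycles K i p Mod (if ends_X0 w then boundaries K i p else {0})" for w p
  let ?H = "\<lambda>(f, w). Q w (j - V_deg S f - R_deg w)"
  have Q: "comm_group (Q w p)" for w p
    unfolding Q_def cycles_eq
    by (rule comm_group_subgroup_FactGroup(1)[OF abelian_free_Abelian_group subgroup_cycle_set])
       (simp add: subgroup_boundaries subgroup_zero_frags)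
  have gQ: "group (Q w p)" for w p using Q by (simp add: comm_group_def)
  let ?A = "\<lambda>(p, q, r). {f \<in> V_words S. V_deg S f = r}"
  let ?B = "\<lambda>(p, q, r). R_basis i q"
  have finX: "finite ?X" using S by (simp add: finite_V_words finite_R_words)
  have "bij_betw (\<lambda>(t, f, w). (f, w)) (SIGMA t:?I. ?A t \<times> ?B t) ?X"
    by (rule bij_betw_byWitness[where f' = "\<lambda>(f, w). ((j - V_deg S f - R_deg w, R_deg w, V_deg S f), f, w)"])
       (auto simp: R_basis_def)
  then have regroup: "product_group ?X ?H \<cong> sum_group ?I (\<lambda>t. product_group (?A t) (\<lambda>f. product_group (?B t) (\<lambda>w. ?H (f, w))))"
    using gQ by (intro sum_group_product_group_iso[of ?X ?H "\<lambda>t f w. (f, w)"] finX) auto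
  have flat: "homology (tensor_complex K (V_words S) (V_deg S)) i j \<cong> product_group ?X ?H"
    unfolding Q_def by (rule homology_tensor_complex[OF finite_V_words[OF S]])
  have summands: "sum_group ?I (\<lambda>t. product_group (?A t) (\<lambda>f. product_group (?B t) (\<lambda>w. ?H (f, w)))) \<cong> sum_group ?I ?G"
  proof (rule iso_sum_groupI)
    fix t assume "t \<in> ?I"
    then obtain p q r where t: "t = (p, q, r)" "p + q + r = j" by auto
    let ?U = "{w \<in> R_basis i q. ends_X0 w}" and ?N = "{w \<in> R_basis i q. \<not> ends_X0 w}"
    let ?TU = "tensor_group (homology K i p) ((R_power i q)\<lparr>carrier := R_image i q\<rparr>)"
    let ?TN = "tensor_group (cycles K i p) (R_power i q Mod R_image i q)"
    have gI: "group ((R_power i q)\<lparr>carrier := R_image i q\<rparr>)"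
      by (rule group.subgroup_imp_group[OF _ subgroup_R_image]) (simp add: R_power_eq)
    have gN: "group (R_power i q Mod R_image i q)"
      using comm_group.abelian_FactGroup[OF abelian_free_Abelian_group subgroup_R_image[unfolded R_power_eq]]
      by (simp add: R_power_eq comm_group_def)
    have cTU: "comm_group ?TU" and cTN: "comm_group ?TN"
      using comm_group_homology[of K i p] comm_group_cycles[of K i p] gI gN
      by (auto intro!: comm_group_tensor_group dest: comm_group.axioms(2))
    have TU: "?TU \<cong> product_group ?U (\<lambda>w. Q w p)"
    proof -
      have "?TU \<cong> product_group ?U (\<lambda>_. homology K i p)"
        by (rule tensor_group_iso_power[OF comm_group_homology gI free_iso_R_image])
           (simp add: finite_R_basis)
      also have "product_group ?U (\<lambda>_. homology K i p) = product_group ?U (\<lambda>w. Q w p)"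
        by (rule product_group_cong) (auto simp: Q_def homology_def)
      finally show ?thesis .
    qed
    have TN: "?TN \<cong> product_group ?N (\<lambda>w. Q w p)"
    proof -
      have "?TN \<cong> product_group ?N (\<lambda>_. cycles K i p)"
        by (rule tensor_group_iso_power[OF comm_group_cycles gN free_iso_R_quotient])
           (simp add: finite_R_basis)
      also have "product_group ?N (\<lambda>_. cycles K i p) \<cong> product_group ?N (\<lambda>w. Q w p)"
      proof (rule iso_product_groupI)
        fix w assume "w \<in> ?N"
        then show "cycles K i p \<cong> Q w p"
          using iso_FactGroup_trivial[OF abelian_free_Abelian_group subgroup_cycle_set[of K i p]]
          by (simp add: Q_def cycles_eq)
      qed (use comm_group_cycles gQ in \<open>auto simp: comm_group_def\<close>)
      finally show ?thesis .
    qed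
    have gA: "group (product_group (R_basis i q) (\<lambda>w. Q w p))"
      using gQ by (intro product_group) auto
    have "product_group (?U \<union> ?N) (\<lambda>w. Q w p) \<cong> product_group ?U (\<lambda>w. Q w p) \<times>\<times> product_group ?N (\<lambda>w. Q w p)"
      using gQ by (intro product_group_Un_iso) auto
    moreover have "?U \<union> ?N = R_basis i q" by auto
    moreover have "product_group ?U (\<lambda>w. Q w p) \<times>\<times> product_group ?N (\<lambda>w. Q w p) \<cong> ?TU \<times>\<times> ?TN"
      by (rule DirProd_isoI[OF group.iso_sym[OF comm_group.axioms(2)[OF cTU] TU]
            group.iso_sym[OF comm_group.axioms(2)[OF cTN] TN]])
    ultimately have inner: "product_group (R_basis i q) (\<lambda>w. Q w p) \<cong> ?TU \<times>\<times> ?TN"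
      by (simp only:) (rule iso_trans)
    have cD: "comm_group (?TU \<times>\<times> ?TN)" by (rule comm_group_DirProd[OF cTU cTN])
    have "product_group (?A t) (\<lambda>f. product_group (?B t) (\<lambda>w. ?H (f, w)))
        = product_group {f \<in> V_words S. V_deg S f = r} (\<lambda>_. product_group (R_basis i q) (\<lambda>w. Q w p))"
    proof -
      have p: "j - r - q = p" using t by simp
      show ?thesis
        unfolding t prod.case by (intro product_group_cong) (use p in \<open>auto simp: R_basis_def\<close>)
    qed
    also have "\<dots> \<cong> product_group {f \<in> V_words S. V_deg S f = r} (\<lambda>_. ?TU \<times>\<times> ?TN)"
      by (intro iso_product_groupI inner gA comm_group.axioms(2)[OF cD])
    also have "\<dots> \<cong> tensor_group (?TU \<times>\<times> ?TN) (V_power S r)"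
    proof (rule group.iso_sym)
      show "group (tensor_group (?TU \<times>\<times> ?TN) (V_power S r))"
        by (rule comm_group.axioms(2)[OF comm_group_tensor_group[OF comm_group.axioms(2)[OF cD]]])
           (simp add: V_power_def)
      show "tensor_group (?TU \<times>\<times> ?TN) (V_power S r) \<cong> product_group {f \<in> V_words S. V_deg S f = r} (\<lambda>_. ?TU \<times>\<times> ?TN)"
        unfolding V_power_def using finite_V_words[OF S]
        by (intro tensor_group_iso_power cD iso_refl) auto
    qed
    finally show "product_group (?A t) (\<lambda>f. product_group (?B t) (\<lambda>w. ?H (f, w))) \<cong> ?G t"
      by (simp add: t)
    show "group (product_group (?A t) (\<lambda>f. product_group (?B t) (\<lambda>w. ?H (f, w))))"
      using gQ by (intro product_group) auto
    show "group (?G t)"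
      unfolding t prod.case
      by (rule comm_group.axioms(2)[OF comm_group_tensor_group[OF comm_group.axioms(2)[OF cD]]])
         (simp add: V_power_def)
  qed
  show ?thesis by (rule iso_trans[OF flat iso_trans[OF regroup summands]])
qed

section \<open>Transport of homology along a relabelling of generators\<close>

text \<open>
  The differential need not respect the bigrading, so injectivity is required on a set \<open>D\<close> that
  contains the values of the differential as well.
\<close>

lemma homology_relabel:
  assumes bij: "\<And>i. bij_betw \<gamma> (basis K i j) (basis L i j)"
    and inj: "inj_on \<gamma> D" and basD: "\<And>i. basis K i j \<subseteq> D"
    and difD: "\<And>i b. b \<in> basis K i j \<Longrightarrow> Poly_Mapping.keys (diff K b) \<subseteq> D"
    and dif: "\<And>i b. b \<in> basis K i j \<Longrightarrow> diff L (\<gamma> b) = frag_extend (\<lambda>x. frag_of (\<gamma> x)) (diff K b)"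
  shows "homology K i j \<cong> homology L i j"
proof -
  \<comment> \<open>\<open>?g'\<close> inverts the relabelling on all of \<open>D\<close>, so it can
    be applied to differentials that are not known to lie in any \<open>basis K i j\<close>.\<close>
  let ?g = "frag_extend (\<lambda>x. frag_of (\<gamma> x))" and ?g' = "frag_extend (\<lambda>x. frag_of (inv_into D \<gamma> x))"
  have g'g: "?g' (?g c) = c" if "Poly_Mapping.keys c \<subseteq> D" for c
  proof -
    have "?g' (?g c) = frag_extend (\<lambda>x. frag_of (inv_into D \<gamma> (\<gamma> x))) c"
      by (simp add: frag_extend_frag_extend)
    also have "\<dots> = frag_extend frag_of c"
      using that inj by (intro frag_extend_eq) (auto simp: inv_into_f_f)
    finally show ?thesis by (simp flip: frag_expansion)
  qed
  have g_keys: "Poly_Mapping.keys (?g c) \<subseteq> basis L k j" if "Poly_Mapping.keys c \<subseteq> basis K k j" for c k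
    using that keys_frag_extend[of "\<lambda>x. frag_of (\<gamma> x)" c] bij[of k] by (fastforce simp: bij_betw_def)
  have g_onto: "\<exists>c. Poly_Mapping.keys c \<subseteq> basis K k j \<and> ?g c = c'" if "Poly_Mapping.keys c' \<subseteq> basis L k j" for c' k
  proof (intro exI conjI)
    let ?c = "frag_extend (\<lambda>x. frag_of (inv_into (basis K k j) \<gamma> x)) c'"
    show "Poly_Mapping.keys ?c \<subseteq> basis K k j"
      using that keys_frag_extend[of "\<lambda>x. frag_of (inv_into (basis K k j) \<gamma> x)" c'] bij[of k]
      by (fastforce simp: bij_betw_def inv_into_into)
    have "?g ?c = frag_extend (\<lambda>x. frag_of (\<gamma> (inv_into (basis K k j) \<gamma> x))) c'"
      by (simp add: frag_extend_frag_extend)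
    also have "\<dots> = frag_extend frag_of c'"
      using that bij[of k] by (intro frag_extend_eq) (auto simp: bij_betw_inv_into_right)
    finally show "?g ?c = c'" by (simp flip: frag_expansion)
  qed
  have gd: "frag_extend (diff L) (?g c) = ?g (frag_extend (diff K) c)" if "Poly_Mapping.keys c \<subseteq> basis K k j" for c k
    using that dif unfolding frag_extend_frag_extend frag_extend_of by (intro frag_extend_eq) auto
  have d_keys: "Poly_Mapping.keys (frag_extend (diff K) c) \<subseteq> D" if "Poly_Mapping.keys c \<subseteq> basis K k j" for c k
    using that difD keys_frag_extend[of "diff K" c] by blast
  have bnd: "?g c \<in> boundaries L i j \<longleftrightarrow> c \<in> boundaries K i j" if c: "Poly_Mapping.keys c \<subseteq> basis K i j" for c
  proof
    assume "c \<in> boundaries K i j"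
    then obtain e where "c = frag_extend (diff K) e" "Poly_Mapping.keys e \<subseteq> basis K (i - 1) j"
      by (auto simp: boundaries_eq)
    then show "?g c \<in> boundaries L i j"
      using g_keys gd by (auto simp: boundaries_eq intro!: exI[of _ "?g e"])
  next
    assume "?g c \<in> boundaries L i j"
    then obtain e where e: "?g c = frag_extend (diff L) (?g e)" "Poly_Mapping.keys e \<subseteq> basis K (i - 1) j"
      using g_onto by (auto simp: boundaries_eq) metis
    then have "?g' (?g c) = ?g' (?g (frag_extend (diff K) e))" by (simp only: gd[OF e(2)])
    moreover have "Poly_Mapping.keys c \<subseteq> D" using c basD[of i] by blast
    ultimately have "c = frag_extend (diff K) e"
      using d_keys[OF e(2)] by (simp add: g'g)
    with e(2) show "c \<in> boundaries K i j" by (auto simp: boundaries_eq)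
  qed
  have cyc: "?g c \<in> cycle_set L i j \<longleftrightarrow> c \<in> cycle_set K i j" if c: "Poly_Mapping.keys c \<subseteq> basis K i j" for c
  proof -
    have "?g (frag_extend (diff K) c) = 0 \<longleftrightarrow> frag_extend (diff K) c = 0"
      using g'g[OF d_keys[OF c]] by (metis frag_extend_0)
    then show ?thesis using c g_keys[OF c] by (simp add: cycle_set_def gd)
  qed
  let ?h = "\<lambda>c. boundaries L i j #>\<^bsub>frags\<^esub> ?g c"
  note QL = comm_group_subgroup_FactGroup[OF abelian_free_Abelian_group subgroup_cycle_set[of L i j] subgroup_boundaries[of L i j]]
  show ?thesis
    unfolding homology_eq
  proof (rule subgroup_FactGroup_iso[where h = ?h])
    let ?QL = "(frags\<lparr>carrier := cycle_set L i j\<rparr>) Mod boundaries L i j"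
    have cycK: "Poly_Mapping.keys c \<subseteq> basis K i j" if "c \<in> cycle_set K i j" for c
      using that by (simp add: cycle_set_def)
    show "group ?QL" using QL(1) by (simp add: comm_group_def)
    show "?h \<in> hom (frags\<lparr>carrier := cycle_set K i j\<rparr>) ?QL"
    proof (rule homI)
      show "?h x \<in> carrier ?QL" if "x \<in> carrier (frags\<lparr>carrier := cycle_set K i j\<rparr>)" for x
        using that cyc cycK by (auto simp: QL(3))
      show "?h (x \<otimes>\<^bsub>frags\<lparr>carrier := cycle_set K i j\<rparr>\<^esub> y) = ?h x \<otimes>\<^bsub>?QL\<^esub> ?h y"
        if "x \<in> carrier (frags\<lparr>carrier := cycle_set K i j\<rparr>)" "y \<in> carrier (frags\<lparr>carrier := cycle_set K i j\<rparr>)" for x y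
        using that hom_mult[OF QL(2), of "?g x" "?g y"] cyc cycK by (simp add: frag_extend_add)
    qed
    show "carrier ?QL \<subseteq> ?h ` cycle_set K i j"
    proof
      fix y assume "y \<in> carrier ?QL"
      then obtain z where z: "z \<in> cycle_set L i j" "y = boundaries L i j #>\<^bsub>frags\<^esub> z"
        by (auto simp: QL(3))
      then obtain c where "Poly_Mapping.keys c \<subseteq> basis K i j" "?g c = z"
        using g_onto[of z i] by (auto simp: cycle_set_def)
      with z cyc[of c] show "y \<in> ?h ` cycle_set K i j" by blast
    qed
    show "?h z = \<one>\<^bsub>?QL\<^esub> \<longleftrightarrow> z \<in> boundaries K i j" if "z \<in> cycle_set K i j" for z
    proof -
      have "?h z = boundaries L i j \<longleftrightarrow> ?g z \<in> boundaries L i j"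
        using group.coset_join1[OF group_free_Abelian_group _ _ subgroup_boundaries]
          group.coset_join2[OF group_free_Abelian_group _ subgroup_boundaries] subgroup.subset[OF subgroup_boundaries]
        by (metis carrier_free_Abelian_group_iff subset_UNIV)
      then show ?thesis using bnd[OF cycK[OF that]] by (simp add: FactGroup_def)
    qed
  qed (auto intro: abelian_free_Abelian_group subgroup_cycle_set subgroup_boundaries)
qed

text \<open>An equality and not just an isomorphism: shifting reindexes the bases and leaves
  generators and differential alone.\<close>

lemma homology_shift: "homology (shift K s) i j = homology K (i - s) j"
proof -
  have "boundaries (shift K s) i j = boundaries K (i - s) j"
    by (simp add: boundaries_def chains_def shift_def algebra_simps)
  moreover have "cycles (shift K s) i j = cycles K (i - s) j"
    by (simp add: cycles_eq cycle_set_def shift_def)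
  ultimately show ?thesis by (simp add: homology_def)
qed

section \<open>Saddles\<close>

lemma v_mult_commute: "v_mult (x, y) = v_mult (y, x)"
  by (cases x; cases y) simp_all

text \<open>Replaces the choice in \<open>saddle\<close> by an arbitrary naming of the curves, so
  that they can be named independently on the two sides of a transport.\<close>

lemma saddle_merge:
  assumes "a \<noteq> b" "S - T = {a, b}" "T - S = {c}"
  shows "saddle S T f = frag_extend (\<lambda>u. frag_of (restrict (f(c := u)) T)) (v_mult (f a, f b))"
proof -
  let ?P = "\<lambda>(a, b, c). a \<noteq> b \<and> S - T = {a, b} \<and> T - S = {c}"
  obtain a' b' c' where s: "(SOME x. ?P x) = (a', b', c')" by (rule prod_cases3)
  have "?P (a, b, c)" using assms by simp
  then have "?P (SOME x. ?P x)" by (rule someI)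
  then have "a' \<noteq> b'" "{a', b'} = {a, b}" "c' = c" using s assms by auto
  then have sym: "v_mult (f a', f b') = v_mult (f a, f b)"
    by (metis doubleton_eq_iff v_mult_commute)
  have ex: "\<exists>a b c. a \<noteq> b \<and> S - T = {a, b} \<and> T - S = {c}" using assms by blast
  have eq: "saddle S T f = frag_extend (\<lambda>u. frag_of (restrict (f(c' := u)) T)) (v_mult (f a', f b'))"
    unfolding saddle_def if_P[OF ex] s Let_def prod.case ..
  show ?thesis unfolding eq \<open>c' = c\<close> sym ..
qed

lemma saddle_split:
  assumes "b \<noteq> c" "S - T = {a}" "T - S = {b, c}"
  shows "saddle S T f = frag_extend (\<lambda>(u, w). frag_of (restrict (f(b := u, c := w)) T)) (v_comult (f a))"
proof -
  let ?P = "\<lambda>(a, b, c). b \<noteq> c \<and> S - T = {a} \<and> T - S = {b, c}"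
  obtain a' b' c' where s: "(SOME x. ?P x) = (a', b', c')" by (rule prod_cases3)
  have "?P (a, b, c)" using assms by simp
  then have "?P (SOME x. ?P x)" by (rule someI)
  then have 1: "b' \<noteq> c'" "{b', c'} = {b, c}" "a' = a" using s assms by auto
  have sym: "frag_extend (\<lambda>(u, w). frag_of (restrict (f(b' := u, c' := w)) T)) (v_comult (f a))
      = frag_extend (\<lambda>(u, w). frag_of (restrict (f(b := u, c := w)) T)) (v_comult (f a))"
  proof (cases "b' = b")
    case True
    then show ?thesis using 1 by (simp add: doubleton_eq_iff)
  next
    case False
    then have "b' = c" "c' = b" using 1 by (auto simp: doubleton_eq_iff)
    \<comment> \<open>Exchanging the names swaps the tensor factors; the updates commute because
      \<open>b \<noteq> c\<close>, and the comultiplication is symmetric.\<close>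
    moreover have "f(c := u, b := w) = f(b := w, c := u)" for u w
      using assms(1) by (auto simp: fun_eq_iff)
    ultimately show ?thesis
      by (cases "f a") (simp_all add: frag_extend_add add.commute)
  qed
  have ex: "\<exists>a b c. b \<noteq> c \<and> S - T = {a} \<and> T - S = {b, c}" using assms by blast
  \<comment> \<open>\<open>saddle\<close> tests for merging before splitting, so that case has to be
    excluded.\<close>
  have nex: "\<nexists>a b c. a \<noteq> b \<and> S - T = {a, b} \<and> T - S = {c}" using assms by auto
  have eq: "saddle S T f = frag_extend (\<lambda>(u, w). frag_of (restrict (f(b' := u, c' := w)) T)) (v_comult (f a'))"
    unfolding saddle_def if_not_P[OF nex] if_P[OF ex] s Let_def prod.case ..
  show ?thesis unfolding eq \<open>a' = a\<close> by (rule sym)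
qed

lemma saddle_zero:
  assumes "\<not> (card (S - T) = 2 \<and> card (T - S) = 1)" "\<not> (card (S - T) = 1 \<and> card (T - S) = 2)"
  shows "saddle S T f = 0"
proof -
  have "\<nexists>a b c. b \<noteq> c \<and> S - T = {a} \<and> T - S = {b, c}" "\<nexists>a b c. a \<noteq> b \<and> S - T = {a, b} \<and> T - S = {c}"
    using assms unfolding One_nat_def card_2_iff card_1_singleton_iff by blast+
  then show ?thesis by (simp only: saddle_def if_not_P not_False_eq_True)
qed

lemma keys_frag_extend_subset:
  assumes "\<And>x. x \<in> Poly_Mapping.keys c \<Longrightarrow> Poly_Mapping.keys (f x) \<subseteq> A"
  shows "Poly_Mapping.keys (frag_extend f c) \<subseteq> A"
  using keys_frag_extend[of f c] assms by blast

lemma keys_saddle: "Poly_Mapping.keys (saddle S T f) \<subseteq> V_words T"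
proof -
  consider a b c where "a \<noteq> b" "S - T = {a, b}" "T - S = {c}"
    | a b c where "b \<noteq> c" "S - T = {a}" "T - S = {b, c}"
    | "\<not> (card (S - T) = 2 \<and> card (T - S) = 1)" "\<not> (card (S - T) = 1 \<and> card (T - S) = 2)"
    by (metis card_1_singletonE card_2_iff)
  then show ?thesis
  proof cases
    case 1
    show ?thesis
      unfolding saddle_merge[OF 1] V_words_def
      by (rule keys_frag_extend_subset) (simp add: case_prod_beta restrict_PiE_iff)
  next
    case 2
    show ?thesis
      unfolding saddle_split[OF 2] V_words_def
      by (rule keys_frag_extend_subset) (simp add: case_prod_beta restrict_PiE_iff)
  qed (simp add: saddle_zero)
qed

text \<open>\<open>saddle\<close> depends on the curves only through the two differences and the
  labels of the common curves; so it suffices that the bijections agree on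
  \<open>S' \<inter> T'\<close> and match the differences.\<close>

lemma saddle_transport:
  assumes \<Phi>: "bij_betw \<Phi> S' S" and \<Psi>: "bij_betw \<Psi> T' T"
    and eq: "\<And>x. x \<in> S' \<Longrightarrow> x \<in> T' \<Longrightarrow> \<Phi> x = \<Psi> x"
    and ST: "\<Phi> ` (S' - T') = S - T" and TS: "\<Psi> ` (T' - S') = T - S"
  shows "saddle S' T' (restrict (g \<circ> \<Phi>) S') =
    frag_extend (\<lambda>g'. frag_of (restrict (g' \<circ> \<Psi>) T')) (saddle S T g)"
proof -
  have inj: "inj_on \<Phi> S'" "inj_on \<Psi> T'" using \<Phi> \<Psi> by (auto simp: bij_betw_def)
  consider a b c where "a \<noteq> b" "S' - T' = {a, b}" "T' - S' = {c}"
    | a b c where "b \<noteq> c" "S' - T' = {a}" "T' - S' = {b, c}"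
    | "\<not> (card (S' - T') = 2 \<and> card (T' - S') = 1)" "\<not> (card (S' - T') = 1 \<and> card (T' - S') = 2)"
    by (metis card_1_singletonE card_2_iff)
  then show ?thesis
  proof cases
    case 1
    have mem: "a \<in> S'" "b \<in> S'" "c \<in> T'" using 1(2,3) by blast+
    then have ab: "\<Phi> a \<noteq> \<Phi> b" "a \<in> S'" "b \<in> S'"
      using 1(1) inj(1) by (auto simp: inj_on_def)
    have "S - T = {\<Phi> a, \<Phi> b}" "T - S = {\<Psi> c}" using 1 ST TS by auto
    note m = saddle_merge[OF ab(1) this]
    \<comment> \<open>A curve of \<open>T'\<close> other than \<open>c\<close> also lies in
      \<open>S'\<close>, where the two bijections agree; at \<open>c\<close> both sides give
      \<open>u\<close>.\<close>
    have "restrict ((restrict (g \<circ> \<Phi>) S')(c := u)) T' = restrict (restrict (g(\<Psi> c := u)) T \<circ> \<Psi>) T'" for u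
    proof
      fix x
      have "x \<in> S'" "\<Psi> x \<noteq> \<Psi> c" if "x \<in> T'" "x \<noteq> c"
        using that 1(3) mem inj(2) by (blast, auto simp: inj_on_def)
      then show "restrict ((restrict (g \<circ> \<Phi>) S')(c := u)) T' x = restrict (restrict (g(\<Psi> c := u)) T \<circ> \<Psi>) T' x"
        using eq \<Psi> by (auto simp: bij_betw_def)
    qed
    then show ?thesis
      using ab unfolding m saddle_merge[OF 1] by (simp add: frag_extend_frag_extend)
  next
    case 2
    have mem: "a \<in> S'" "b \<in> T'" "c \<in> T'" using 2(2,3) by blast+
    then have bc: "\<Psi> b \<noteq> \<Psi> c" "a \<in> S'"
      using 2(1) inj(2) by (auto simp: inj_on_def)
    have "S - T = {\<Phi> a}" "T - S = {\<Psi> b, \<Psi> c}" using 2 ST TS by auto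
    note m = saddle_split[OF bc(1) this]
    have "restrict ((restrict (g \<circ> \<Phi>) S')(b := u, c := w)) T' = restrict (restrict (g(\<Psi> b := u, \<Psi> c := w)) T \<circ> \<Psi>) T'" for u w
    proof
      fix x
      have "x \<in> S'" "\<Psi> x \<noteq> \<Psi> c" "\<Psi> x \<noteq> \<Psi> b" if "x \<in> T'" "x \<noteq> c" "x \<noteq> b"
        using that 2(3) mem inj(2) by (blast, auto simp: inj_on_def)
      then show "restrict ((restrict (g \<circ> \<Phi>) S')(b := u, c := w)) T' x
          = restrict (restrict (g(\<Psi> b := u, \<Psi> c := w)) T \<circ> \<Psi>) T' x"
        using eq \<Psi> bc by (auto simp: bij_betw_def)
    qed
    then show ?thesis
      using bc unfolding m saddle_split[OF 2] case_prod_beta by (simp add: frag_extend_frag_extend)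
  next
    case 3
    have "card (S - T) = card (S' - T')"
      unfolding ST[symmetric] by (rule card_image[OF inj_on_subset[OF inj(1) Diff_subset]])
    moreover have "card (T - S) = card (T' - S')"
      unfolding TS[symmetric] by (rule card_image[OF inj_on_subset[OF inj(2) Diff_subset]])
    ultimately show ?thesis using 3 by (simp add: saddle_zero)
  qed
qed

section \<open>Boundary components and circles of the medial diagram\<close>

locale wf_fatgraph =
  fixes F :: "('v, 'd) fatgraph"
  assumes wf: "is_fatgraph F"
begin

abbreviation darts :: "'d set set \<Rightarrow> 'd set" where
  "darts W \<equiv> \<Union>W"

definition hits :: "'d set \<Rightarrow> 'd \<Rightarrow> bool" where
  "hits D d \<longleftrightarrow> (\<exists>k. (nxt F ^^ k) d \<in> D)"

text \<open>Unlike the successor in \<open>spanning\<close>, the search begins at \<open>d\<close>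
  itself, so that a kept half-edge is its own \<open>first\<close>. One step of \<open>nxt\<close>
  before the search reconciles the two, see \<open>spanning_nxt\<close>.\<close>

definition first :: "'d set \<Rightarrow> 'd \<Rightarrow> 'd" where
  "first D d = (nxt F ^^ (LEAST k. (nxt F ^^ k) d \<in> D)) d"

definition face :: "'d set set \<Rightarrow> 'd \<Rightarrow> 'd" where
  "face W d = nxt (spanning F W) (opp F d)"

definition orb :: "'d set set \<Rightarrow> 'd \<Rightarrow> 'd set" where
  "orb W d = {(face W ^^ k) d | k. True}"

lemma opp: "d \<in> halfs F \<Longrightarrow> opp F d \<in> halfs F" "d \<in> halfs F \<Longrightarrow> opp F (opp F d) = d"
  using wf by (auto simp: is_fatgraph_def)

lemma nxt_bij: "bij_betw (nxt F) (halfs F) (halfs F)"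
  using wf by (simp add: is_fatgraph_def)

lemma nxt_closed: "d \<in> halfs F \<Longrightarrow> nxt F d \<in> halfs F"
  using nxt_bij by (auto simp: bij_betw_def)

lemma vert_nxt: "d \<in> halfs F \<Longrightarrow> vert F (nxt F d) = vert F d"
  using wf by (simp add: is_fatgraph_def)

lemma vert_cycle: "d \<in> halfs F \<Longrightarrow> d' \<in> halfs F \<Longrightarrow> vert F d = vert F d' \<Longrightarrow> \<exists>k. (nxt F ^^ k) d = d'"
  using wf by (simp add: is_fatgraph_def)

lemma finite_halfs: "finite (halfs F)"
  using wf by (simp add: is_fatgraph_def)

lemma vert_closed: "d \<in> halfs F \<Longrightarrow> vert F d \<in> verts F"
  using wf by (auto simp: is_fatgraph_def)

lemma nxt_pow_closed: "d \<in> halfs F \<Longrightarrow> (nxt F ^^ k) d \<in> halfs F"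
  by (induction k) (simp_all add: nxt_closed)

lemma vert_nxt_pow: "d \<in> halfs F \<Longrightarrow> vert F ((nxt F ^^ k) d) = vert F d"
  by (induction k) (simp_all add: nxt_pow_closed vert_nxt)

lemma edge_eq: "e \<in> edges F \<Longrightarrow> d \<in> e \<Longrightarrow> e = {d, opp F d} \<and> d \<in> halfs F"
  using opp by (auto simp: edges_def)

lemma edge_disjoint: "e \<in> edges F \<Longrightarrow> e' \<in> edges F \<Longrightarrow> d \<in> e \<Longrightarrow> d \<in> e' \<Longrightarrow> e = e'"
  using edge_eq by blast

lemma darts_subset: "W \<subseteq> edges F \<Longrightarrow> darts W \<subseteq> halfs F"
  using edge_eq by blast

lemma darts_opp: "W \<subseteq> edges F \<Longrightarrow> d \<in> darts W \<Longrightarrow> opp F d \<in> darts W"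
  using edge_eq by blast

lemma darts_remove: "W \<subseteq> edges F \<Longrightarrow> e \<in> W \<Longrightarrow> darts (W - {e}) = darts W - e"
  using edge_disjoint by blast

lemma first_in: "hits D d \<Longrightarrow> first D d \<in> D"
  unfolding hits_def first_def by (rule LeastI_ex)

lemma first_self: "d \<in> D \<Longrightarrow> first D d = d"
  unfolding first_def by (subst Least_eq_0) simp_all

lemma hits_self: "d \<in> D \<Longrightarrow> hits D d"
  unfolding hits_def by (rule exI[of _ 0]) simp

lemma first_step:
  assumes "d \<notin> D" "hits D d"
  shows "first D d = first D (nxt F d)"
proof -
  obtain k where "(nxt F ^^ k) d \<in> D" using assms by (auto simp: hits_def)
  then have "(LEAST k. (nxt F ^^ k) d \<in> D) = Suc (LEAST k. (nxt F ^^ Suc k) d \<in> D)"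
    by (rule Least_Suc) (use assms in simp)
  then show ?thesis by (simp add: first_def funpow_swap1)
qed

lemma hits_iff:
  assumes "d \<in> halfs F" "D \<subseteq> halfs F"
  shows "hits D d \<longleftrightarrow> vert F d \<in> vert F ` D"
proof
  assume "hits D d"
  then obtain k where "(nxt F ^^ k) d \<in> D" by (auto simp: hits_def)
  then show "vert F d \<in> vert F ` D" using vert_nxt_pow[OF assms(1)] by (metis image_eqI)
next
  assume "vert F d \<in> vert F ` D"
  then obtain d' where "d' \<in> D" "vert F d = vert F d'" by blast
  then show "hits D d" using vert_cycle[OF assms(1), of d'] assms(2) by (auto simp: hits_def)
qed

lemma spanning_nxt:
  assumes "hits (darts W) (nxt F d)"
  shows "nxt (spanning F W) d = first (darts W) (nxt F d)"
proof -
  obtain k where "(nxt F ^^ k) (nxt F d) \<in> darts W" using assms by (auto simp: hits_def)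
  then have "0 < Suc k \<and> (nxt F ^^ Suc k) d \<in> darts W" by (simp add: funpow_swap1)
  then have "(LEAST k. 0 < k \<and> (nxt F ^^ k) d \<in> darts W) = Suc (LEAST k. 0 < Suc k \<and> (nxt F ^^ Suc k) d \<in> darts W)"
    by (rule Least_Suc) simp
  then show ?thesis by (simp add: spanning_def first_def funpow_swap1)
qed

text \<open>If \<open>y\<close> needs at least as many steps as \<open>x\<close>, injectivity of the
  powers of \<open>nxt\<close> puts \<open>x\<close> itself on the path of \<open>y\<close>; a
  positive distance would make \<open>x\<close> an earlier element of \<open>D\<close> on that path,
  against minimality.\<close>

lemma first_nxt_eq:
  assumes D: "D \<subseteq> halfs F" and d: "d \<in> D" "d' \<in> D" and h: "hits D (nxt F d)" "hits D (nxt F d')"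
    and eq: "first D (nxt F d) = first D (nxt F d')"
  shows "d = d'"
proof -
  define k where "k x = (LEAST k. (nxt F ^^ k) (nxt F x) \<in> D)" for x
  have k: "(nxt F ^^ Suc (k x)) x = first D (nxt F x)" for x
    by (simp add: k_def first_def funpow_swap1)
  have *: "x = y" if le: "k x \<le> k y" and xy: "x \<in> D" "y \<in> D" and e: "first D (nxt F x) = first D (nxt F y)" for x y
  proof -
    have "(nxt F ^^ Suc (k x)) x = (nxt F ^^ (Suc (k x) + (k y - k x))) y"
      using k[of x] k[of y] e le by simp
    also have "\<dots> = (nxt F ^^ Suc (k x)) ((nxt F ^^ (k y - k x)) y)"
      by (simp only: funpow_add comp_apply)
    finally have eq: "(nxt F ^^ Suc (k x)) x = (nxt F ^^ Suc (k x)) ((nxt F ^^ (k y - k x)) y)" .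
    have H: "x \<in> halfs F" "y \<in> halfs F" using xy D by blast+
    have x: "x = (nxt F ^^ (k y - k x)) y"
      by (rule inj_onD[OF bij_betw_imp_inj_on[OF bij_betw_funpow[OF nxt_bij]] eq H(1) nxt_pow_closed[OF H(2)]])
    show ?thesis
    proof (cases "k y - k x")
      case (Suc m)
      then have "(nxt F ^^ m) (nxt F y) \<in> D" using x xy by (simp add: funpow_swap1)
      then have "k y \<le> m" unfolding k_def by (rule Least_le)
      then show ?thesis using Suc by linarith
    qed (use x in simp)
  qed
  show ?thesis
    using *[of d d'] *[of d' d] d eq by (metis nat_le_linear)
qed

lemma hits_nxt_opp:
  assumes W: "W \<subseteq> edges F" and d: "d \<in> darts W"
  shows "hits (darts W) (nxt F (opp F d))"
proof -
  have o: "opp F d \<in> darts W" by (rule darts_opp[OF W d])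
  then have H: "opp F d \<in> halfs F" using darts_subset[OF W] by blast
  show ?thesis
    unfolding hits_iff[OF nxt_closed[OF H] darts_subset[OF W]] vert_nxt[OF H] using o by blast
qed

lemma face_eq: "W \<subseteq> edges F \<Longrightarrow> d \<in> darts W \<Longrightarrow> face W d = first (darts W) (nxt F (opp F d))"
  by (simp add: face_def spanning_nxt hits_nxt_opp)

lemma face_closed: "W \<subseteq> edges F \<Longrightarrow> d \<in> darts W \<Longrightarrow> face W d \<in> darts W"
  by (simp add: face_eq first_in hits_nxt_opp del: Union_iff)

lemma face_pow_closed: "W \<subseteq> edges F \<Longrightarrow> d \<in> darts W \<Longrightarrow> (face W ^^ k) d \<in> darts W"
  by (induction k) (simp_all add: face_closed del: Union_iff)

lemma inj_on_face:
  assumes W: "W \<subseteq> edges F"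
  shows "inj_on (face W) (darts W)"
proof (rule inj_onI)
  fix d d' assume d: "d \<in> darts W" "d' \<in> darts W" and eq: "face W d = face W d'"
  have "opp F d = opp F d'"
    using eq unfolding face_eq[OF W d(1)] face_eq[OF W d(2)]
    by (rule first_nxt_eq[OF darts_subset[OF W] darts_opp[OF W d(1)] darts_opp[OF W d(2)]
          hits_nxt_opp[OF W d(1)] hits_nxt_opp[OF W d(2)]])
  then show "d = d'" using d darts_subset[OF W] opp(2) by (metis subsetD)
qed

lemma orb_self: "d \<in> orb W d"
  unfolding orb_def by (auto intro: exI[of _ 0])

text \<open>Injectivity on the finite set of kept half-edges makes each forward orbit a cycle, which
  has no distinguished starting point.\<close>

lemma orb_face:
  assumes W: "W \<subseteq> edges F" and d: "d \<in> darts W"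
  shows "orb W (face W d) = orb W d"
proof -
  \<comment> \<open>Extended by the identity so as to be injective on the whole type.\<close>
  let ?p = "\<lambda>x. if x \<in> darts W then face W x else x"
  have p: "(?p ^^ k) d = (face W ^^ k) d" for k
    by (induction k) (simp_all add: face_pow_closed[OF W d] del: Union_iff)
  have "inj ?p"
  proof (rule injI)
    fix x y assume "?p x = ?p y"
    then show "x = y"
      using inj_onD[OF inj_on_face[OF W], of x y] face_closed[OF W, of x] face_closed[OF W, of y]
      by (cases "x \<in> darts W"; cases "y \<in> darts W") (auto simp del: Union_iff)
  qed
  moreover have "finite {y. \<exists>n. y = (?p ^^ n) d}"
    by (rule finite_subset[OF _ finite_subset[OF darts_subset[OF W] finite_halfs]])
       (auto simp: p face_pow_closed[OF W d] simp del: Union_iff)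
  ultimately obtain n where n: "n > 0" "(face W ^^ n) d = d"
    by (rule funpow_inj_finite) (auto simp: p simp del: Union_iff)
  have n': "(face W ^^ (n - 1)) (face W d) = d"
    using n by (metis Suc_diff_1 funpow_Suc_right comp_apply)
  show ?thesis
  proof
    show "orb W (face W d) \<subseteq> orb W d"
      unfolding orb_def by (auto intro: exI[of _ "Suc k" for k] simp: funpow_swap1)
    show "orb W d \<subseteq> orb W (face W d)"
    proof
      fix x assume "x \<in> orb W d"
      then obtain k where "x = (face W ^^ k) d" by (auto simp: orb_def)
      then have "x = (face W ^^ (k + (n - 1))) (face W d)" by (simp only: funpow_add comp_apply n')
      then show "x \<in> orb W (face W d)" by (auto simp: orb_def)
    qed
  qed
qed

lemma bd_comps_spanning:
  "bd_comps (spanning F W) = Inl ` orb W ` darts W \<union> Inr ` (verts F - vert F ` darts W)"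
proof -
  have "halfs (spanning F W) = darts W" "vert (spanning F W) = vert F" "verts (spanning F W) = verts F"
    "(\<lambda>x. nxt (spanning F W) (opp (spanning F W) x)) = face W"
    by (simp_all add: spanning_def face_def fun_eq_iff)
  then show ?thesis by (simp only: bd_comps_def orb_def image_image)
qed

text \<open>The boundary component running past an end. A boundary walk passes the right of
  \<open>d\<close>, the left of \<open>opp F d\<close> and then an arc to the right of the next
  half-edge. So a left end inherits the component of the right end across its arc, and the right of
  an absent half-edge belongs to the first kept one after it. If no half-edge is kept at the vertex,
  the component is that of the isolated vertex.\<close>

definition kappa :: "'d set set \<Rightarrow> 'd \<times> side \<Rightarrow> 'd set + 'v" where
  "kappa W x = (let d = (case snd x of RightSide \<Rightarrow> fst x | LeftSide \<Rightarrow> nxt F (fst x)) in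
     if hits (darts W) d then Inl (orb W (first (darts W) d)) else Inr (vert F d))"

lemma kappa_simps [simp]:
  "kappa W (d, RightSide) = (if hits (darts W) d then Inl (orb W (first (darts W) d)) else Inr (vert F d))"
  "kappa W (d, LeftSide) = kappa W (nxt F d, RightSide)"
  by (simp_all add: kappa_def)

text \<open>The relation underlying \<open>circles\<close> for the state \<open>W\<close>, with the
  1-smoothed crossings described by absent half-edges.\<close>

definition strand :: "'d set set \<Rightarrow> (('d \<times> side) \<times> ('d \<times> side)) set" where
  "strand W = {(x, arc (medial F) x) | x. x \<in> ends (medial F)} \<union>
     {(x, rot (medial F) x) | x. x \<in> ends (medial F) \<and> (over (medial F) x \<longleftrightarrow> fst x \<notin> darts W)}"

definition conn :: "'d set set \<Rightarrow> (('d \<times> side) \<times> ('d \<times> side)) set" where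
  "conn W = (strand W \<union> (strand W)\<inverse>)\<^sup>*"

definition state_circles :: "'d set set \<Rightarrow> (('d \<times> side) set + 'v) set" where
  "state_circles W = circles (medial F) (edge_crossing ` (edges F - W))"

lemma ends_medial: "ends (medial F) = halfs F \<times> UNIV"
  by (simp add: medial_def)

lemma state_circles_eq:
  assumes "W \<subseteq> edges F"
  shows "state_circles W = Inl ` ((halfs F \<times> UNIV) // conn W) \<union> Inr ` (verts F - vert F ` halfs F)"
proof -
  \<comment> \<open>Distinct edges are disjoint, so an end lies in a 1-smoothed crossing exactly
    when its half-edge belongs to no kept edge.\<close>
  have cut: "x \<in> \<Union> (edge_crossing ` (edges F - W)) \<longleftrightarrow> fst x \<notin> darts W" if xE: "x \<in> halfs F \<times> UNIV" for x
  proof -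
    obtain d s where x: "x = (d, s)" "d \<in> halfs F" using xE by (cases x) auto
    have "{d, opp F d} \<in> edges F" using x by (auto simp: edges_def)
    then show ?thesis
      using x assms edge_disjoint[of _ "{d, opp F d}" d] by (auto simp: edge_crossing_def)
  qed
  have "{(x, rot (medial F) x) |x. x \<in> ends (medial F) \<and> (over (medial F) x \<longleftrightarrow> x \<in> \<Union> (edge_crossing ` (edges F - W)))}
    = {(x, rot (medial F) x) |x. x \<in> ends (medial F) \<and> (over (medial F) x \<longleftrightarrow> fst x \<notin> darts W)}"
    unfolding ends_medial by (intro Collect_cong ex_cong1 conj_cong refl) (simp only: cut)
  then show ?thesis
    unfolding state_circles_def circles_def conn_def strand_def Let_def
    by (simp only: ends_medial) (simp add: medial_def)
qed

lemma sym_conn: "sym (conn W)"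
  unfolding conn_def by (intro sym_rtrancl sym_Un_converse)

lemma conn_sym: "(x, y) \<in> conn W \<Longrightarrow> (y, x) \<in> conn W"
  using sym_conn by (rule symD)

lemma conn_trans: "(x, y) \<in> conn W \<Longrightarrow> (y, z) \<in> conn W \<Longrightarrow> (x, z) \<in> conn W"
  unfolding conn_def by (rule rtrancl_trans)

lemma conn_refl: "(x, x) \<in> conn W"
  by (simp add: conn_def)

lemma conn_class_eq: "(x, y) \<in> conn W \<Longrightarrow> conn W `` {x} = conn W `` {y}"
  using conn_sym conn_trans by blast

lemma strand_conn: "(x, y) \<in> strand W \<Longrightarrow> (x, y) \<in> conn W"
  unfolding conn_def by blast

lemma conn_arc: "d \<in> halfs F \<Longrightarrow> ((d, LeftSide), (nxt F d, RightSide)) \<in> conn W"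
  by (rule strand_conn) (simp add: strand_def medial_def)

lemma conn_keep: "d \<in> halfs F \<Longrightarrow> d \<in> darts W \<Longrightarrow> ((d, RightSide), (opp F d, LeftSide)) \<in> conn W"
  by (rule strand_conn) (simp add: strand_def medial_def)

lemma conn_cut: "d \<in> halfs F \<Longrightarrow> d \<notin> darts W \<Longrightarrow> ((d, LeftSide), (d, RightSide)) \<in> conn W"
  by (rule strand_conn) (simp add: strand_def medial_def)

lemma conn_nxt: "d \<in> halfs F \<Longrightarrow> d \<notin> darts W \<Longrightarrow> ((d, RightSide), (nxt F d, RightSide)) \<in> conn W"
  using conn_sym[OF conn_cut] conn_arc conn_trans by blast

lemma conn_nxt_pow:
  assumes "d \<in> halfs F" "\<And>l. l < k \<Longrightarrow> (nxt F ^^ l) d \<notin> darts W"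
  shows "((d, RightSide), ((nxt F ^^ k) d, RightSide)) \<in> conn W"
  using assms(2)
proof (induction k)
  case (Suc k)
  then have "((d, RightSide), ((nxt F ^^ k) d, RightSide)) \<in> conn W" by simp
  moreover have "(nxt F ^^ k) d \<notin> darts W" by (rule Suc.prems) simp
  then have "(((nxt F ^^ k) d, RightSide), ((nxt F ^^ Suc k) d, RightSide)) \<in> conn W"
    using conn_nxt[OF nxt_pow_closed[OF assms(1)]] by simp
  ultimately show ?case by (rule conn_trans)
qed (simp add: conn_refl)

lemma conn_first: "d \<in> halfs F \<Longrightarrow> ((d, RightSide), (first (darts W) d, RightSide)) \<in> conn W"
  unfolding first_def by (rule conn_nxt_pow) (auto dest: not_less_Least)

lemma conn_face:
  assumes W: "W \<subseteq> edges F" and d: "d \<in> darts W"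
  shows "((d, RightSide), (face W d, RightSide)) \<in> conn W"
proof -
  have H: "d \<in> halfs F" "opp F d \<in> halfs F" using d darts_subset[OF W] opp by blast+
  show ?thesis
    unfolding face_eq[OF W d]
    using conn_keep[OF H(1) d] conn_arc[OF H(2)] conn_first[OF nxt_closed[OF H(2)]] conn_trans by blast
qed

lemma conn_orb:
  assumes W: "W \<subseteq> edges F" and d: "d \<in> darts W" and y: "y \<in> orb W d"
  shows "((d, RightSide), (y, RightSide)) \<in> conn W"
proof -
  obtain k where "y = (face W ^^ k) d" using y by (auto simp: orb_def)
  moreover have "((d, RightSide), ((face W ^^ k) d, RightSide)) \<in> conn W" for k
    by (induction k) (simp_all add: conn_refl, metis conn_face[OF W] conn_trans face_pow_closed[OF W d])
  ultimately show ?thesis by simp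
qed

text \<open>Arcs preserve \<open>kappa\<close> by its definition. A cut moves past an absent
  half-edge, which does not change the first kept one; a kept edge advances the walk by one
  \<open>face\<close> step, which does not change the orbit.\<close>

lemma kappa_strand:
  assumes W: "W \<subseteq> edges F" and xy: "(x, y) \<in> strand W"
  shows "kappa W x = kappa W y"
proof -
  obtain d s where x: "x = (d, s)" by (cases x)
  then have d: "d \<in> halfs F" using xy by (auto simp: strand_def medial_def)
  have inv: "nxt F (inv_into (halfs F) (nxt F) d) = d"
    using nxt_bij d by (rule bij_betw_inv_into_right)
  consider "s = LeftSide" "y = (nxt F d, RightSide)"
    | "s = RightSide" "y = (inv_into (halfs F) (nxt F) d, LeftSide)"
    | "s = LeftSide" "d \<notin> darts W" "y = (d, RightSide)"
    | "s = RightSide" "d \<in> darts W" "y = (opp F d, LeftSide)"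
    using xy x by (cases s) (auto simp: strand_def medial_def)
  then show ?thesis
  proof cases
    case 3
    have "hits (darts W) (nxt F d) \<longleftrightarrow> hits (darts W) d"
      using d darts_subset[OF W] by (simp add: hits_iff nxt_closed vert_nxt)
    then show ?thesis
      using 3 x d first_step[of d "darts W"] by (simp add: vert_nxt del: Union_iff)
  next
    case 4
    have "kappa W x = Inl (orb W d)"
      using x 4 by (simp add: hits_self first_self del: Union_iff)
    also have "\<dots> = Inl (orb W (face W d))" using orb_face[OF W] 4 by simp
    also have "\<dots> = kappa W y"
      using 4 hits_nxt_opp[OF W, of d] face_eq[OF W, of d] by (simp del: Union_iff)
    finally show ?thesis .
  qed (simp_all add: x inv del: kappa_simps(1))
qed

lemma kappa_conn:
  assumes W: "W \<subseteq> edges F" and "(x, y) \<in> conn W"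
  shows "kappa W x = kappa W y"
  using assms(2) unfolding conn_def
  by (induction rule: rtrancl_induct) (use kappa_strand[OF W] in auto)

text \<open>Every end is connected to a right end, and this one to the right end of the first kept
  half-edge, from where the orbit is followed. At a vertex with no kept half-edge the circle runs
  around the vertex and meets all right ends there.\<close>

lemma kappa_eq_conn:
  assumes W: "W \<subseteq> edges F" and x: "x \<in> halfs F \<times> UNIV" "y \<in> halfs F \<times> UNIV" and eq: "kappa W x = kappa W y"
  shows "(x, y) \<in> conn W"
proof -
  have right: "\<exists>d\<in>halfs F. (z, (d, RightSide)) \<in> conn W" if z: "z \<in> halfs F \<times> UNIV" for z
  proof -
    obtain d s where "z = (d, s)" "d \<in> halfs F" using z by (cases z) auto
    then show ?thesis using conn_arc[of d W] conn_refl nxt_closed by (cases s) blast+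
  qed
  obtain a b where a: "a \<in> halfs F" "(x, (a, RightSide)) \<in> conn W" and b: "b \<in> halfs F" "(y, (b, RightSide)) \<in> conn W"
    using right x by metis
  have eq': "kappa W (a, RightSide) = kappa W (b, RightSide)"
    using kappa_conn[OF W a(2)] kappa_conn[OF W b(2)] eq by simp
  have "((a, RightSide), (b, RightSide)) \<in> conn W"
  proof (cases "hits (darts W) a")
    case True
    then have bh: "hits (darts W) b" and o: "orb W (first (darts W) a) = orb W (first (darts W) b)"
      using eq' by (auto split: if_splits)
    have "first (darts W) b \<in> orb W (first (darts W) a)" unfolding o by (rule orb_self)
    from conn_orb[OF W first_in[OF True] this] show ?thesis
      using conn_first[OF a(1)] conn_first[OF b(1)] conn_trans conn_sym by meson
  next
    case False
    then have "vert F a = vert F b" using eq' by (auto split: if_splits)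
    then obtain k where k: "(nxt F ^^ k) a = b" using vert_cycle a b by blast
    show ?thesis
      using conn_nxt_pow[OF a(1), of k W] False k by (simp add: hits_def del: Union_iff)
  qed
  then show ?thesis using a b conn_trans conn_sym by meson
qed

fun comp_of :: "'d set set \<Rightarrow> ('d \<times> side) set + 'v \<Rightarrow> 'd set + 'v" where
  "comp_of W (Inl X) = the_elem (kappa W ` X)"
| "comp_of W (Inr v) = Inr v"

lemma comp_of_class:
  assumes "W \<subseteq> edges F"
  shows "comp_of W (Inl (conn W `` {x})) = kappa W x"
proof -
  have "kappa W y = kappa W x" if "y \<in> conn W `` {x}" for y
    using kappa_conn[OF assms, of x y] that by simp
  moreover have "x \<in> conn W `` {x}" by (simp add: conn_refl)
  ultimately have "kappa W ` (conn W `` {x}) = {kappa W x}" by blast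
  then show ?thesis by simp
qed

lemma kappa_in:
  assumes W: "W \<subseteq> edges F" and "x \<in> halfs F \<times> UNIV"
  shows "kappa W x \<in> bd_comps (spanning F W)"
proof -
  have r: "kappa W (d, RightSide) \<in> bd_comps (spanning F W)" if "d \<in> halfs F" for d
    using first_in[of "darts W" d] that vert_closed hits_iff[OF that darts_subset[OF W]]
    by (auto simp: bd_comps_spanning simp del: Union_iff)
  obtain d s where "x = (d, s)" "d \<in> halfs F" using assms(2) by (cases x) auto
  then show ?thesis using r[of d] r[of "nxt F d"] nxt_closed by (cases s) simp_all
qed

text \<open>Isolated vertices of a state have two origins: those without half-edges in
  \<open>F\<close> are the free circles, the others are surrounded by an ordinary circle of the
  diagram, so a class of ends may well go to some \<open>Inr v\<close>.\<close>

lemma bij_comp_of: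
  assumes W: "W \<subseteq> edges F"
  shows "bij_betw (comp_of W) (state_circles W) (bd_comps (spanning F W))"
proof -
  let ?E = "halfs F \<times> (UNIV :: side set)"
  have cl: "\<exists>x\<in>?E. X = conn W `` {x}" if "Inl X \<in> state_circles W" for X
    using that by (auto simp: state_circles_eq[OF W] quotient_def)
  \<comment> \<open>The two origins cannot collide: on ends, \<open>kappa\<close> only produces
    vertices that carry half-edges in \<open>F\<close>.\<close>
  have free: "kappa W x \<noteq> Inr v" if x: "x \<in> ?E" and v: "v \<notin> vert F ` halfs F" for x v
  proof -
    obtain d s where "x = (d, s)" "d \<in> halfs F" using x by (cases x) auto
    then show ?thesis using v nxt_closed by (cases s) auto
  qed
  have free': "v \<in> verts F \<and> v \<notin> vert F ` halfs F" if "Inr v \<in> state_circles W" for v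
    using that by (auto simp: state_circles_eq[OF W])
  have "inj_on (comp_of W) (state_circles W)"
  proof (rule inj_onI)
    fix A B assume A: "A \<in> state_circles W" and B: "B \<in> state_circles W" and eq: "comp_of W A = comp_of W B"
    show "A = B"
    proof (cases A)
      case (Inl X)
      then obtain x where x: "x \<in> ?E" "X = conn W `` {x}" using cl A by blast
      show ?thesis
      proof (cases B)
        case B': (Inl Y)
        then obtain y where y: "y \<in> ?E" "Y = conn W `` {y}" using cl B by blast
        then have "kappa W x = kappa W y"
          using eq Inl B' x by (simp only: comp_of_class[OF W])
        then have "(x, y) \<in> conn W" using kappa_eq_conn[OF W] x y by blast
        then show ?thesis using Inl B' x y conn_class_eq by blast
      next
        case B': (Inr v)
        then have "kappa W x = Inr v" using eq Inl x by (simp only: comp_of_class[OF W] comp_of.simps(2))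
        then show ?thesis using free[OF x(1)] free' B B' by blast
      qed
    next
      case (Inr v)
      show ?thesis
      proof (cases B)
        case B': (Inl Y)
        then obtain y where y: "y \<in> ?E" "Y = conn W `` {y}" using cl B by blast
        then have "kappa W y = Inr v" using eq Inr B' by (simp only: comp_of_class[OF W] comp_of.simps(2))
        then show ?thesis using free[OF y(1)] free' A Inr by blast
      qed (use eq Inr in simp)
    qed
  qed
  moreover have "comp_of W ` state_circles W = bd_comps (spanning F W)"
  proof
    show "comp_of W ` state_circles W \<subseteq> bd_comps (spanning F W)"
    proof
      fix c assume "c \<in> comp_of W ` state_circles W"
      then obtain A where A: "A \<in> state_circles W" "c = comp_of W A" by blast
      show "c \<in> bd_comps (spanning F W)"
      proof (cases A)
        case (Inl X)
        then obtain x where x: "x \<in> ?E" "X = conn W `` {x}" using cl A by blast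
        show ?thesis
          unfolding A(2) Inl x(2) comp_of_class[OF W] by (rule kappa_in[OF W x(1)])
      next
        case (Inr v)
        then have "v \<in> verts F" "v \<notin> vert F ` darts W" using free'[of v] A darts_subset[OF W] by blast+
        then show ?thesis unfolding A(2) Inr bd_comps_spanning comp_of.simps by blast
      qed
    qed
    have img: "kappa W x \<in> comp_of W ` state_circles W" if "x \<in> ?E" for x
    proof (rule image_eqI)
      show "kappa W x = comp_of W (Inl (conn W `` {x}))" by (rule comp_of_class[OF W, symmetric])
      show "Inl (conn W `` {x}) \<in> state_circles W"
        using that by (auto simp: state_circles_eq[OF W] quotient_def)
    qed
    show "bd_comps (spanning F W) \<subseteq> comp_of W ` state_circles W"
    proof
      fix c assume "c \<in> bd_comps (spanning F W)"
      then consider d where "d \<in> darts W" "c = Inl (orb W d)"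
        | v where "v \<in> verts F" "v \<notin> vert F ` darts W" "c = Inr v"
        unfolding bd_comps_spanning by blast
      then show "c \<in> comp_of W ` state_circles W"
      proof cases
        case 1
        then have "kappa W (d, RightSide) = c" by (simp add: hits_self first_self del: Union_iff)
        then show ?thesis using img[of "(d, RightSide)"] 1 darts_subset[OF W] by blast
      next
        case 2
        show ?thesis
        proof (cases "v \<in> vert F ` halfs F")
          case True
          then obtain d where d: "d \<in> halfs F" "v = vert F d" by blast
          then have "kappa W (d, RightSide) = c"
            using 2 hits_iff[OF d(1) darts_subset[OF W]] by (simp del: Union_iff)
          then show ?thesis using img[of "(d, RightSide)"] d by blast
        next
          case False
          then have "Inr v \<in> state_circles W" using 2 by (simp add: state_circles_eq[OF W])
          then show ?thesis using 2 by (metis comp_of.simps(2) image_eqI)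
        qed
      qed
    qed
  qed
  ultimately show ?thesis by (simp add: bij_betw_def)
qed

end

text \<open>Paths from \<open>x\<close> in \<open>s\<close> never meet \<open>X\<close>, and outside
  \<open>X\<close> both relations offer the same steps, so neither can leave the common
  class.\<close>

lemma rtrancl_image_local:
  assumes eq: "\<And>u v. u \<notin> X \<Longrightarrow> (u, v) \<in> s \<longleftrightarrow> (u, v) \<in> s'" and dis: "\<And>y. (x, y) \<in> s\<^sup>* \<Longrightarrow> y \<notin> X"
  shows "s'\<^sup>* `` {x} = s\<^sup>* `` {x}"
proof -
  have "(x, y) \<in> s'\<^sup>*" if "(x, y) \<in> s\<^sup>*" for y
    using that
  proof induction
    case (step y z)
    then show ?case using eq[of y z] dis[of y] by (meson rtrancl.rtrancl_into_rtrancl)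
  qed simp
  moreover have "(x, y) \<in> s\<^sup>*" if "(x, y) \<in> s'\<^sup>*" for y
    using that
  proof induction
    case (step y z)
    then show ?case using eq[of y z] dis[of y] by (meson rtrancl.rtrancl_into_rtrancl)
  qed simp
  ultimately show ?thesis by blast
qed

section \<open>Deleting an edge\<close>

context wf_fatgraph
begin

text \<open>The state enters only through the joins at the crossings, and a join stays within one
  crossing; an end away from \<open>e\<close> therefore has the same neighbours before and
  after.\<close>

lemma strand_remove:
  assumes W: "W \<subseteq> edges F" "e \<in> W" and u: "fst u \<notin> e"
  shows "(u, v) \<in> strand W \<union> (strand W)\<inverse> \<longleftrightarrow> (u, v) \<in> strand (W - {e}) \<union> (strand (W - {e}))\<inverse>"
proof -
  note D = darts_remove[OF W]
  have e: "opp F d \<in> e" if "d \<in> e" for d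
    using edge_eq[of e d] W that by blast
  have rot: "fst (rot (medial F) x) \<in> e" if "fst x \<in> e" for x
  proof -
    obtain d s where "x = (d, s)" by (cases x)
    then show ?thesis using that e by (cases s) (simp_all add: medial_def)
  qed
  have "(u, v) \<in> strand W \<longleftrightarrow> (u, v) \<in> strand (W - {e})"
    unfolding strand_def D using u by auto
  moreover have "(v, u) \<in> strand W \<longleftrightarrow> (v, u) \<in> strand (W - {e})"
    unfolding strand_def D using u rot by auto
  ultimately show ?thesis by simp
qed

lemma conn_remove:
  assumes W: "W \<subseteq> edges F" "e \<in> W" and x: "\<And>y. (x, y) \<in> conn W \<Longrightarrow> fst y \<notin> e"
  shows "conn (W - {e}) `` {x} = conn W `` {x}"
  using strand_remove[OF W] x unfolding conn_def
  by (intro rtrancl_image_local[where X = "{u. fst u \<in> e}"]) simp_all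

lemma conn_remove':
  assumes W: "W \<subseteq> edges F" "e \<in> W" and x: "\<And>y. (x, y) \<in> conn (W - {e}) \<Longrightarrow> fst y \<notin> e"
  shows "conn W `` {x} = conn (W - {e}) `` {x}"
  using strand_remove[OF W] x unfolding conn_def
  by (intro rtrancl_image_local[where X = "{u. fst u \<in> e}"]) simp_all

lemma first_remove:
  assumes "hits D d" "first D d \<notin> e"
  shows "hits (D - e) d" "first (D - e) d = first D d"
proof -
  let ?k = "LEAST k. (nxt F ^^ k) d \<in> D"
  have k: "(nxt F ^^ ?k) d \<in> D - e"
    using first_in[OF assms(1)] assms(2) by (simp add: first_def)
  then show "hits (D - e) d" unfolding hits_def by blast
  have "(LEAST k. (nxt F ^^ k) d \<in> D - e) = ?k"
  proof (rule Least_equality)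
    show "(nxt F ^^ ?k) d \<in> D - e" by (rule k)
    show "?k \<le> l" if "(nxt F ^^ l) d \<in> D - e" for l using that by (intro Least_le) blast
  qed
  then show "first (D - e) d = first D d" by (simp only: first_def)
qed

text \<open>A circle avoiding \<open>e\<close> visits every half-edge at which \<open>first\<close>
  and \<open>face\<close> stop, so no stop lies in \<open>e\<close>; the deletion then changes
  neither map along the circle, and the orbits agree step by step.\<close>

lemma kappa_remove:
  assumes W: "W \<subseteq> edges F" "e \<in> W" and x: "x \<in> halfs F \<times> UNIV"
    and avoid: "\<And>y. (x, y) \<in> conn W \<Longrightarrow> fst y \<notin> e"
  shows "kappa (W - {e}) x = kappa W x"
proof -
  note D = darts_remove[OF W]
  have W': "W - {e} \<subseteq> edges F" using W by blast
  have right: "kappa (W - {e}) (d, RightSide) = kappa W (d, RightSide)"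
    if d: "d \<in> halfs F" and av: "\<And>y. ((d, RightSide), y) \<in> conn W \<Longrightarrow> fst y \<notin> e" for d
  proof (cases "hits (darts W) d")
    case True
    let ?a = "first (darts W) d"
    have a: "?a \<in> darts W" by (rule first_in[OF True])
    have av': "y \<notin> e" if "((?a, RightSide), (y, RightSide)) \<in> conn W" for y
      using av[OF conn_trans[OF conn_first[OF d] that]] by simp
    have ae: "?a \<notin> e" using av'[OF conn_refl] .
    note fr = first_remove[OF True ae]
    have "(face (W - {e}) ^^ k) ?a = (face W ^^ k) ?a" for k
    proof (induction k)
      case (Suc k)
      let ?y = "(face W ^^ k) ?a"
      have y: "?y \<in> darts W" by (rule face_pow_closed[OF W(1) a])
      have orb: "(face W ^^ k) ?a \<in> orb W ?a" for k by (auto simp: orb_def)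
      have "?y \<notin> e" by (rule av'[OF conn_orb[OF W(1) a orb]])
      then have y': "?y \<in> darts (W - {e})" using y D by blast
      have "face W ?y \<notin> e" using av'[OF conn_orb[OF W(1) a orb[of "Suc k"]]] by simp
      then have "first (darts W) (nxt F (opp F ?y)) \<notin> e" using face_eq[OF W(1) y] by simp
      then have "face (W - {e}) ?y = face W ?y"
        unfolding face_eq[OF W(1) y] face_eq[OF W' y'] D
        by (rule first_remove(2)[OF hits_nxt_opp[OF W(1) y]])
      then show ?case using Suc by simp
    qed simp
    then have "orb (W - {e}) ?a = orb W ?a" by (simp add: orb_def)
    then show ?thesis using True fr by (simp only: kappa_simps D if_True)
  next
    case False
    then have "\<not> hits (darts (W - {e})) d" unfolding hits_def by blast
    with False show ?thesis by (simp only: kappa_simps if_False)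
  qed
  obtain d s where ds: "x = (d, s)" "d \<in> halfs F" using x by (cases x) auto
  show ?thesis
  proof (cases s)
    case LeftSide
    have "((d, LeftSide), (nxt F d, RightSide)) \<in> conn W" using conn_arc ds by blast
    then have "kappa (W - {e}) (nxt F d, RightSide) = kappa W (nxt F d, RightSide)"
      using avoid conn_trans ds LeftSide by (intro right nxt_closed) blast+
    then show ?thesis using ds LeftSide by (simp only: kappa_simps(2))
  next
    case RightSide
    then show ?thesis using right ds avoid by simp
  qed
qed

text \<open>Circles that avoid the crossing of \<open>e\<close> belong to both states, with the same
  label; labels of circles meeting it belong to one state only. So the differences of boundary
  components are always the images of the meeting circles. The differences of circles can be
  smaller, namely when one and the same set of ends is a meeting circle in both states.\<close>

lemma saddle_circles:
  assumes W: "W \<subseteq> edges F" "e \<in> W"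
  shows "saddle (state_circles W) (state_circles (W - {e})) (restrict (g \<circ> comp_of W) (state_circles W)) =
    frag_extend (\<lambda>g'. frag_of (restrict (g' \<circ> comp_of (W - {e})) (state_circles (W - {e}))))
      (saddle (bd_comps (spanning F W)) (bd_comps (spanning F (W - {e}))) g)"
proof -
  let ?W' = "W - {e}"
  let ?S = "bd_comps (spanning F W)" and ?T = "bd_comps (spanning F ?W')"
  let ?S' = "state_circles W" and ?T' = "state_circles ?W'"
  let ?\<Phi> = "comp_of W" and ?\<Psi> = "comp_of ?W'"
  have W': "?W' \<subseteq> edges F" using W by blast
  note D = darts_remove[OF W]
  have eH: "d \<in> halfs F" "opp F d \<in> e" "d \<in> darts W" "e = {d, opp F d}" if "d \<in> e" for d
    using edge_eq[of e d] W that by blast+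
  have \<Phi>: "bij_betw ?\<Phi> ?S' ?S" by (rule bij_comp_of[OF W(1)])
  have \<Psi>: "bij_betw ?\<Psi> ?T' ?T" by (rule bij_comp_of[OF W'])
  note im\<Phi> = bij_betw_imp_surj_on[OF \<Phi>] and im\<Psi> = bij_betw_imp_surj_on[OF \<Psi>]
  define meets :: "('d \<times> side) set + 'v \<Rightarrow> bool" where
    "meets A \<longleftrightarrow> (\<exists>X. A = Inl X \<and> (\<exists>y\<in>X. fst y \<in> e))" for A
  have clS: "\<exists>x\<in>halfs F \<times> UNIV. X = conn W `` {x}" if "Inl X \<in> ?S'" for X
    using that by (auto simp: state_circles_eq[OF W(1)] quotient_def)
  have clT: "\<exists>x\<in>halfs F \<times> UNIV. X = conn ?W' `` {x}" if "Inl X \<in> ?T'" for X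
    using that by (auto simp: state_circles_eq[OF W'] quotient_def)
  have inS: "Inl (conn W `` {x}) \<in> ?S'" if "x \<in> halfs F \<times> UNIV" for x
    using that by (auto simp: state_circles_eq[OF W(1)] quotient_def)
  have inT: "Inl (conn ?W' `` {x}) \<in> ?T'" if "x \<in> halfs F \<times> UNIV" for x
    using that by (auto simp: state_circles_eq[OF W'] quotient_def)
  have Inr_iff: "Inr v \<in> ?S' \<longleftrightarrow> Inr v \<in> ?T'" for v
    by (auto simp: state_circles_eq[OF W(1)] state_circles_eq[OF W'])
  have common: "A \<in> ?T' \<and> ?\<Phi> A = ?\<Psi> A" if A: "A \<in> ?S'" "\<not> meets A" for A
  proof (cases A)
    case (Inl X)
    then obtain x where x: "x \<in> halfs F \<times> UNIV" "X = conn W `` {x}" using clS A by blast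
    have av: "fst y \<notin> e" if "(x, y) \<in> conn W" for y
      using A(2) that Inl x(2) by (auto simp: meets_def)
    have "X = conn ?W' `` {x}" using conn_remove[OF W av] x by simp
    moreover have "kappa ?W' x = kappa W x" by (rule kappa_remove[OF W x(1) av])
    ultimately show ?thesis
      using inT[OF x(1)] comp_of_class[OF W(1), of x] comp_of_class[OF W', of x] x(2) Inl
      by (simp del: comp_of.simps)
  next
    case (Inr v)
    then show ?thesis using A Inr_iff by simp
  qed
  have common': "A \<in> ?S'" if A: "A \<in> ?T'" "\<not> meets A" for A
  proof (cases A)
    case (Inl X)
    then obtain x where x: "x \<in> halfs F \<times> UNIV" "X = conn ?W' `` {x}" using clT A by blast
    have av: "fst y \<notin> e" if "(x, y) \<in> conn ?W'" for y
      using A(2) that Inl x(2) by (auto simp: meets_def)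
    have "X = conn W `` {x}" using conn_remove'[OF W av] x by simp
    then show ?thesis using inS[OF x(1)] Inl by simp
  next
    case (Inr v)
    then show ?thesis using A Inr_iff by simp
  qed
  \<comment> \<open>A meeting circle passes the right of some half-edge \<open>d'\<close> of
    \<open>e\<close>, so its label is an orbit containing \<open>d'\<close>; after the deletion no
    orbit contains \<open>d'\<close>.\<close>
  have \<Phi>_meets: "?\<Phi> A \<notin> ?T" if A: "A \<in> ?S'" "meets A" for A
  proof -
    obtain X d s where X: "A = Inl X" "(d, s) \<in> X" "d \<in> e" using A(2) by (auto simp: meets_def)
    then obtain x where x: "X = conn W `` {x}" using clS A by blast
    obtain d' where d': "d' \<in> e" "(x, (d', RightSide)) \<in> conn W"
    proof (cases s)
      case LeftSide
      have "((opp F d, RightSide), (opp F (opp F d), LeftSide)) \<in> conn W"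
        using eH[OF eH(2)[OF X(3)]] conn_keep by blast
      then have "((d, LeftSide), (opp F d, RightSide)) \<in> conn W"
        using opp(2)[OF eH(1)[OF X(3)]] conn_sym by simp
      then show ?thesis
        using that[OF eH(2)[OF X(3)]] X x LeftSide conn_trans by blast
    next
      case RightSide
      then show ?thesis using that[OF X(3)] X x by blast
    qed
    have "?\<Phi> A = kappa W x" using X x comp_of_class[OF W(1)] by (simp del: comp_of.simps)
    also have "\<dots> = kappa W (d', RightSide)" by (rule kappa_conn[OF W(1) d'(2)])
    also have "\<dots> = Inl (orb W d')"
      using eH(3)[OF d'(1)] by (simp add: hits_self first_self del: Union_iff)
    finally have 1: "?\<Phi> A = Inl (orb W d')" .
    have "d' \<notin> orb ?W' a" if "a \<in> darts ?W'" for a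
      using face_pow_closed[OF W' that] d'(1) D unfolding orb_def by auto
    then have "orb W d' \<noteq> orb ?W' a" if "a \<in> darts ?W'" for a
      using orb_self[of d' W] that by blast
    then show ?thesis unfolding 1 bd_comps_spanning by blast
  qed
  \<comment> \<open>After the deletion the label may be an isolated vertex instead of an orbit, so
    bijectivity is used: a boundary component of both states is the label of a circle avoiding
    \<open>e\<close>, and \<open>?\<Psi>\<close> is injective.\<close>
  have \<Psi>_meets: "?\<Psi> A \<notin> ?S" if A: "A \<in> ?T'" "meets A" for A
  proof
    assume "?\<Psi> A \<in> ?S"
    then obtain B where B: "B \<in> ?S'" "?\<Phi> B = ?\<Psi> A" using im\<Phi> by (metis imageE)
    have "?\<Psi> A \<in> ?T" using im\<Psi> A(1) by blast
    then have nB: "\<not> meets B" using \<Phi>_meets[OF B(1)] B(2) by auto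
    then have "B \<in> ?T'" "?\<Psi> B = ?\<Psi> A" using common[OF B(1)] B(2) by auto
    then have "B = A" using inj_onD[OF bij_betw_imp_inj_on[OF \<Psi>], of B A] A(1) by blast
    then show False using nB A(2) by simp
  qed
  have ST: "?\<Phi> ` {A \<in> ?S'. meets A} = ?S - ?T"
  proof
    show "?\<Phi> ` {A \<in> ?S'. meets A} \<subseteq> ?S - ?T" using \<Phi>_meets im\<Phi> by blast
    show "?S - ?T \<subseteq> ?\<Phi> ` {A \<in> ?S'. meets A}"
    proof
      fix c assume c: "c \<in> ?S - ?T"
      then obtain A where A: "A \<in> ?S'" "c = ?\<Phi> A" using im\<Phi> by blast
      have "meets A"
      proof (rule ccontr)
        assume n: "\<not> meets A"
        note cA = common[OF A(1) n]
        then have "?\<Psi> A \<in> ?T" using im\<Psi> by blast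
        then show False using A c cA by simp
      qed
      then show "c \<in> ?\<Phi> ` {A \<in> ?S'. meets A}" using A by blast
    qed
  qed
  have TS: "?\<Psi> ` {A \<in> ?T'. meets A} = ?T - ?S"
  proof
    show "?\<Psi> ` {A \<in> ?T'. meets A} \<subseteq> ?T - ?S" using \<Psi>_meets im\<Psi> by blast
    show "?T - ?S \<subseteq> ?\<Psi> ` {A \<in> ?T'. meets A}"
    proof
      fix c assume c: "c \<in> ?T - ?S"
      then obtain A where A: "A \<in> ?T'" "c = ?\<Psi> A" using im\<Psi> by blast
      have "meets A"
      proof (rule ccontr)
        assume n: "\<not> meets A"
        have "A \<in> ?S'" by (rule common'[OF A(1) n])
        then have "?\<Phi> A \<in> ?S" "?\<Phi> A = ?\<Psi> A" using im\<Phi> common n by blast+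
        then show False using A c by simp
      qed
      then show "c \<in> ?\<Psi> ` {A \<in> ?T'. meets A}" using A by blast
    qed
  qed
  show ?thesis
  proof (cases "\<exists>A. meets A \<and> A \<in> ?S' \<and> A \<in> ?T'")
    case False
    have "?S' - ?T' = {A \<in> ?S'. meets A}" "?T' - ?S' = {A \<in> ?T'. meets A}"
      using False common common' by blast+
    then show ?thesis
      using False common ST TS by (intro saddle_transport[OF \<Phi> \<Psi>]) (simp_all only:, blast)
  next
    case True
    text \<open>A single circle passes through the crossing before and after: both saddles vanish.\<close>
    then obtain X d s where X: "Inl X \<in> ?S'" "Inl X \<in> ?T'" "(d, s) \<in> X" "d \<in> e"
      by (auto simp: meets_def)
    obtain x x' where x: "X = conn W `` {x}" "X = conn ?W' `` {x'}" using clS clT X by meson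
    have cW: "z \<in> X" if "y \<in> X" "(y, z) \<in> conn W" for y z
      using that x(1) conn_trans by blast
    have cW': "z \<in> X" if "y \<in> X" "(y, z) \<in> conn ?W'" for y z
      using that x(2) conn_trans by blast
    have keep: "((d, RightSide), (opp F d, LeftSide)) \<in> conn W" if "d \<in> e" for d
      using eH[OF that] conn_keep by blast
    have cut: "((d, LeftSide), (d, RightSide)) \<in> conn ?W'" if "d \<in> e" for d
      using eH(1)[OF that] that D conn_cut by blast
    \<comment> \<open>The old joins and the new ones together connect all four ends of the crossing,
      so the common circle contains all of them and no other circle can meet the crossing.\<close>
    have sides: "(a, t) \<in> X" if "(a, u) \<in> X" "a \<in> e" for a t u
      using cW'[OF that(1), of "(a, t)"] cut[OF that(2)] conn_sym[OF cut[OF that(2)]] that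
      by (cases t; cases u) auto
    have "(opp F d, LeftSide) \<in> X"
      by (rule cW[OF sides[OF X(3,4)] keep[OF X(4)]])
    then have full: "(a, t) \<in> X" if "a \<in> e" for a t
      using sides[OF X(3,4)] sides eH[OF X(4)] that by blast
    have "A = Inl X" if A: "A \<in> ?S'" "meets A" for A
    proof -
      obtain Y a t where Y: "A = Inl Y" "(a, t) \<in> Y" "a \<in> e" using A(2) by (auto simp: meets_def)
      then obtain y where y: "Y = conn W `` {y}" using clS A(1) by blast
      have "(a, t) \<in> conn W `` {x}" "(a, t) \<in> conn W `` {y}" using full[OF Y(3)] x Y y by auto
      then have "conn W `` {x} = conn W `` {y}"
        using conn_class_eq[of x "(a, t)" W] conn_class_eq[of y "(a, t)" W] by simp
      then show ?thesis using Y y x by simp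
    qed
    moreover have "A = Inl X" if A: "A \<in> ?T'" "meets A" for A
    proof -
      obtain Y a t where Y: "A = Inl Y" "(a, t) \<in> Y" "a \<in> e" using A(2) by (auto simp: meets_def)
      then obtain y where y: "Y = conn ?W' `` {y}" using clT A(1) by blast
      have "(a, t) \<in> conn ?W' `` {x'}" "(a, t) \<in> conn ?W' `` {y}" using full[OF Y(3)] x Y y by auto
      then have "conn ?W' `` {x'} = conn ?W' `` {y}"
        using conn_class_eq[of x' "(a, t)" ?W'] conn_class_eq[of y "(a, t)" ?W'] by simp
      then show ?thesis using Y y x by simp
    qed
    moreover have "meets (Inl X)" using X(3,4) by (auto simp: meets_def intro!: bexI[of _ "(d, s)"])
    ultimately have mS: "{A \<in> ?S'. meets A} = {Inl X}" and mT: "{A \<in> ?T'. meets A} = {Inl X}"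
      using X by blast+
    have "?S' - ?T' \<subseteq> {A \<in> ?S'. meets A} - ?T'" "?T' - ?S' \<subseteq> {A \<in> ?T'. meets A} - ?S'"
      using common common' by blast+
    then have "?S' - ?T' = {}" "?T' - ?S' = {}" using mS mT X by auto
    then have "saddle ?S' ?T' f = 0" for f by (intro saddle_zero) simp_all
    moreover have "?S - ?T = {?\<Phi> (Inl X)}" "?T - ?S = {?\<Psi> (Inl X)}"
      unfolding ST[symmetric] TS[symmetric] mS mT by simp_all
    then have "saddle ?S ?T g = 0" by (intro saddle_zero) simp_all
    ultimately show ?thesis by simp
  qed
qed

section \<open>The isomorphism of complexes\<close>

lemma finite_edges: "finite (edges F)"
  by (simp add: edges_def finite_halfs)

lemma inj_edge_crossing: "inj edge_crossing"
  by (rule injI) (auto simp: edge_crossing_def)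

lemma crossings_medial: "crossings (medial F) = edge_crossing ` edges F"
proof -
  have cr: "{x, rot (medial F) x, rot (medial F) (rot (medial F) x), rot (medial F) (rot (medial F) (rot (medial F) x))}
      = edge_crossing {fst x, opp F (fst x)}" if xE: "x \<in> halfs F \<times> UNIV" for x
  proof -
    obtain d s where x: "x = (d, s)" "d \<in> halfs F" using xE by (cases x) auto
    have "(UNIV :: side set) = {LeftSide, RightSide}" by (auto intro: side.exhaust)
    then show ?thesis
      using x opp(2)[of d] by (cases s) (auto simp: medial_def edge_crossing_def)
  qed
  have "crossings (medial F) = (\<lambda>x. edge_crossing {fst x, opp F (fst x)}) ` (halfs F \<times> (UNIV :: side set))"
    unfolding crossings_def ends_medial by (rule image_cong[OF refl]) (rule cr)
  also have "\<dots> = edge_crossing ` edges F"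
    by (auto simp: edges_def image_iff)
  finally show ?thesis .
qed

definition smoothed :: "'d set set \<Rightarrow> ('d \<times> side) set set" where
  "smoothed W = edge_crossing ` (edges F - W)"

lemma circles_smoothed: "circles (medial F) (smoothed W) = state_circles W"
  by (simp add: smoothed_def state_circles_def)

lemma smoothed_remove: "e \<in> W \<Longrightarrow> W \<subseteq> edges F \<Longrightarrow> insert (edge_crossing e) (smoothed W) = smoothed (W - {e})"
  by (auto simp: smoothed_def)

lemma smoothed_mem: "e \<in> edges F \<Longrightarrow> edge_crossing e \<in> smoothed W \<longleftrightarrow> e \<notin> W"
  using inj_edge_crossing by (auto simp: smoothed_def inj_def)

lemma smoothed_eqD: "W \<subseteq> edges F \<Longrightarrow> W' \<subseteq> edges F \<Longrightarrow> smoothed W = smoothed W' \<Longrightarrow> W = W'"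
  using smoothed_mem[of _ W] smoothed_mem[of _ W'] by blast

lemma card_smoothed: "W \<subseteq> edges F \<Longrightarrow> int (card (smoothed W)) = height F W"
  using card_mono[OF finite_edges, of W] card_Diff_subset[OF finite_subset[OF _ finite_edges], of W]
    card_image[OF inj_on_subset[OF inj_edge_crossing subset_UNIV], of "edges F - W"]
  by (simp add: smoothed_def height_def of_nat_diff)

fun relabel :: "('v, 'd) chrom_gen \<Rightarrow> ('v \<Rightarrow> vgen) \<times> ('d \<times> side, 'v) kh_gen \<times> rgen list" where
  "relabel (W, f, g, w) = (f, (smoothed W, restrict (g \<circ> comp_of W) (state_circles W)), w)"

text \<open>Plays the role of \<open>D\<close> in \<open>homology_relabel\<close>: large enough to
  contain the values of the differential without any bookkeeping of degrees, small enough for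
  \<open>relabel\<close> to be injective.\<close>

definition gens :: "('v, 'd) chrom_gen set" where
  "gens = {(W, f, g, w). W \<subseteq> edges F \<and> g \<in> V_words (bd_comps (spanning F W))}"

lemma transport_words:
  assumes W: "W \<subseteq> edges F"
  shows "bij_betw (\<lambda>g. restrict (g \<circ> comp_of W) (state_circles W))
    (V_words (bd_comps (spanning F W))) (V_words (state_circles W))"
proof -
  let ?S = "state_circles W" and ?B = "bd_comps (spanning F W)"
  note b = bij_comp_of[OF W]
  let ?i = "inv_into ?S (comp_of W)"
  show ?thesis
  proof (rule bij_betw_byWitness[where f' = "\<lambda>g. restrict (g \<circ> ?i) ?B"])
    show "\<forall>g\<in>V_words ?B. restrict (restrict (g \<circ> comp_of W) ?S \<circ> ?i) ?B = g"
    proof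
      fix g assume "g \<in> V_words ?B"
      then have g: "g \<in> extensional ?B" by (simp add: V_words_def PiE_def)
      show "restrict (restrict (g \<circ> comp_of W) ?S \<circ> ?i) ?B = g"
        using bij_betw_inv_into_right[OF b] bij_betwE[OF bij_betw_inv_into[OF b]]
        by (intro extensionalityI[OF _ g]) auto
    qed
    show "\<forall>g\<in>V_words ?S. restrict (restrict (g \<circ> ?i) ?B \<circ> comp_of W) ?S = g"
    proof
      fix g assume "g \<in> V_words ?S"
      then have g: "g \<in> extensional ?S" by (simp add: V_words_def PiE_def)
      show "restrict (restrict (g \<circ> ?i) ?B \<circ> comp_of W) ?S = g"
        using bij_betw_inv_into_left[OF b] bij_betwE[OF b]
        by (intro extensionalityI[OF _ g]) auto
    qed
  qed (auto simp: V_words_def)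
qed

lemma V_deg_transport:
  assumes W: "W \<subseteq> edges F"
  shows "V_deg (state_circles W) (restrict (g \<circ> comp_of W) (state_circles W)) = V_deg (bd_comps (spanning F W)) g"
  using sum.reindex_bij_betw[OF bij_comp_of[OF W], of "\<lambda>c. vdeg (g c)"] by (simp add: V_deg_def)

lemma inj_on_relabel: "inj_on relabel gens"
proof (rule inj_onI)
  fix x y assume x: "x \<in> gens" and y: "y \<in> gens" and eq: "relabel x = relabel y"
  obtain W f g w where X: "x = (W, f, g, w)" by (cases x)
  obtain W' f' g' w' where Y: "y = (W', f', g', w')" by (cases y)
  have sub: "W \<subseteq> edges F" "W' \<subseteq> edges F" and g: "g \<in> V_words (bd_comps (spanning F W))" "g' \<in> V_words (bd_comps (spanning F W'))"
    using x y by (auto simp: X Y gens_def)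
  have W: "W = W'" using eq smoothed_eqD[OF sub] by (simp add: X Y)
  then have "g = g'"
    using eq g inj_onD[OF bij_betw_imp_inj_on[OF transport_words[OF sub(1)]], of g g'] by (simp add: X Y)
  then show "x = y" using W eq by (simp add: X Y)
qed

lemma chrom_basis_gens: "chrom_basis F i j \<subseteq> gens"
  by (auto simp: chrom_basis_def gens_def)

text \<open>The height has three roles at once: homological degree, word length and internal shift.
  The shift is already part of the Khovanov degree, where the number of 1-smoothings is added, so
  only the degrees of \<open>f\<close> and \<open>w\<close> are left to the tensor complex.\<close>

lemma relabel_in_basis_iff:
  assumes W: "W \<subseteq> edges F" and g: "g \<in> V_words (bd_comps (spanning F W))"
  shows "relabel (W, f, g, w) \<in> basis (tensor_complex (unnorm_khovanov (medial F) cs) (V_words (verts F)) (V_deg (verts F))) i j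
    \<longleftrightarrow> (W, f, g, w) \<in> chrom_basis F i j"
proof -
  have "restrict (g \<circ> comp_of W) (state_circles W) \<in> V_words (state_circles W)"
    using transport_words[OF W] g by (auto simp: bij_betw_def)
  moreover have "smoothed W \<subseteq> crossings (medial F)"
    unfolding crossings_medial smoothed_def by blast
  ultimately show ?thesis
    using W g V_deg_transport[OF W, of g]
    by (auto simp: tensor_complex_def unnorm_khovanov_def kh_basis_def chrom_basis_def
        circles_smoothed card_smoothed R_words_def)
qed

lemma bij_relabel:
  "bij_betw relabel (chrom_basis F i j)
    (basis (tensor_complex (unnorm_khovanov (medial F) cs) (V_words (verts F)) (V_deg (verts F))) i j)"
  (is "bij_betw _ _ ?B")
proof (rule bij_betw_imageI)
  show "inj_on relabel (chrom_basis F i j)"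
    by (rule inj_on_subset[OF inj_on_relabel chrom_basis_gens])
  show "relabel ` chrom_basis F i j = ?B"
  proof
    show "relabel ` chrom_basis F i j \<subseteq> ?B"
    proof (rule image_subsetI)
      fix x assume x: "x \<in> chrom_basis F i j"
      obtain W f g w where "x = (W, f, g, w)" by (cases x)
      then show "relabel x \<in> ?B"
        using x relabel_in_basis_iff[of W g f w cs i j] by (auto simp: chrom_basis_def)
    qed
    show "?B \<subseteq> relabel ` chrom_basis F i j"
    proof
      fix y assume y: "y \<in> ?B"
      obtain f S h w where Y: "y = (f, (S, h), w)" by (cases y) auto
      have S: "S \<subseteq> edge_crossing ` edges F" and h: "h \<in> V_words (circles (medial F) S)"
        using y by (auto simp: Y tensor_complex_def unnorm_khovanov_def kh_basis_def crossings_medial)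
      define W where "W = {e \<in> edges F. edge_crossing e \<notin> S}"
      have W: "W \<subseteq> edges F" by (auto simp: W_def)
      have sm: "smoothed W = S" using S by (auto simp: W_def smoothed_def)
      then have "h \<in> V_words (state_circles W)" using h circles_smoothed by metis
      then obtain g where g: "g \<in> V_words (bd_comps (spanning F W))" "h = restrict (g \<circ> comp_of W) (state_circles W)"
        using bij_betw_imp_surj_on[OF transport_words[OF W]] by blast
      then have "y = relabel (W, f, g, w)" by (simp add: Y sm)
      then show "y \<in> relabel ` chrom_basis F i j"
        using y relabel_in_basis_iff[OF W g(1)] by blast
    qed
  qed
qed

lemma keys_chrom_diff:
  assumes W: "W \<subseteq> edges F"
  shows "Poly_Mapping.keys (chrom_diff F es (W, f, g, w)) \<subseteq> gens"
proof -
  have "Poly_Mapping.keys (chrom_edge_map F e (W, f, g, w)) \<subseteq> gens" for e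
    unfolding chrom_edge_map.simps
  proof (intro keys_frag_extend_subset)
    fix g' w' assume "g' \<in> Poly_Mapping.keys (saddle (bd_comps (spanning F W)) (bd_comps (spanning F (W - {e}))) g)"
    then have "g' \<in> V_words (bd_comps (spanning F (W - {e})))" using keys_saddle by blast
    then show "Poly_Mapping.keys (frag_of (W - {e}, f, g', w')) \<subseteq> gens"
      using W by (auto simp: gens_def)
  qed
  then show ?thesis
    unfolding chrom_diff.simps
    by (intro order_trans[OF keys_sum] UN_least order_trans[OF keys_cmul]) blast
qed

lemma frag_extend_relabel_edge:
  assumes W: "W \<subseteq> edges F" and e: "e \<in> W"
  shows "frag_extend (\<lambda>b'. frag_extend (\<lambda>w'. frag_of (f, b', w')) (r_delta w))
      (kh_edge_map (medial F) (edge_crossing e) (smoothed W, restrict (g \<circ> comp_of W) (state_circles W)))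
    = frag_extend (\<lambda>x. frag_of (relabel x)) (chrom_edge_map F e (W, f, g, w))"
  by (simp add: circles_smoothed smoothed_remove[OF e W] saddle_circles[OF W e] frag_extend_frag_extend)

text \<open>Listing the crossings in the order of the edges makes the signs equal: an edge absent
  from \<open>W\<close> is a crossing that is already 1-smoothed.\<close>

lemma diff_relabel:
  assumes W: "W \<subseteq> edges F" and es: "set es \<subseteq> edges F"
  shows "diff (tensor_complex (unnorm_khovanov (medial F) (map edge_crossing es)) A dg) (relabel (W, f, g, w))
    = frag_extend (\<lambda>x. frag_of (relabel x)) (chrom_diff F es (W, f, g, w))"
proof -
  let ?L = "medial F" and ?h = "restrict (g \<circ> comp_of W) (state_circles W)"
  let ?t = "frag_extend (\<lambda>b'. frag_extend (\<lambda>w'. frag_of (f, b', w')) (r_delta w))"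
  let ?r = "frag_extend (\<lambda>x. frag_of (relabel x))"
  let ?K = "{k. k < length es \<and> es ! k \<in> W}"
  let ?sgn = "\<lambda>k. (-1) ^ card {l. l < k \<and> es ! l \<notin> W} :: int"
  have mem: "map edge_crossing es ! k \<in> smoothed W \<longleftrightarrow> es ! k \<notin> W" if "k < length es" for k
  proof -
    have "es ! k \<in> edges F" using es that nth_mem by blast
    then show ?thesis using that by (simp add: smoothed_mem)
  qed
  have K: "{k. k < length (map edge_crossing es) \<and> map edge_crossing es ! k \<notin> smoothed W} = ?K"
    using mem by auto
  have sgn: "{l. l < k \<and> map edge_crossing es ! l \<in> smoothed W} = {l. l < k \<and> es ! l \<notin> W}" if "k \<in> ?K" for k
    using mem that by auto
  have fin: "finite ?K" by simp
  have "kh_diff ?L (map edge_crossing es) (smoothed W, ?h) =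
      (\<Sum>k\<in>?K. frag_cmul (?sgn k) (kh_edge_map ?L (edge_crossing (es ! k)) (smoothed W, ?h)))"
    unfolding kh_diff.simps K by (intro sum.cong refl) (simp only: sgn, simp)
  then have "?t (kh_diff ?L (map edge_crossing es) (smoothed W, ?h)) =
      (\<Sum>k\<in>?K. frag_cmul (?sgn k) (?t (kh_edge_map ?L (edge_crossing (es ! k)) (smoothed W, ?h))))"
    by (simp only: frag_extend_sum[OF fin] frag_extend_cmul o_def)
  also have "\<dots> = (\<Sum>k\<in>?K. frag_cmul (?sgn k) (?r (chrom_edge_map F (es ! k) (W, f, g, w))))"
    by (intro sum.cong refl) (simp only: frag_extend_relabel_edge[OF W] mem_Collect_eq)
  also have "\<dots> = ?r (chrom_diff F es (W, f, g, w))"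
    by (simp only: chrom_diff.simps frag_extend_sum[OF fin] frag_extend_cmul o_def)
  finally show ?thesis by (simp add: tensor_complex_def unnorm_khovanov_def del: chrom_diff.simps kh_diff.simps)
qed

lemma homology_unnorm_chromatic:
  assumes "set es = edges F"
  shows "homology (unnorm_chromatic F es) i j \<cong>
    homology (tensor_complex (unnorm_khovanov (medial F) (map edge_crossing es)) (V_words (verts F)) (V_deg (verts F))) i j"
proof (rule homology_relabel[where \<gamma> = relabel and D = gens])
  fix i b assume "b \<in> basis (unnorm_chromatic F es) i j"
  then have b: "b \<in> chrom_basis F i j" by (simp add: unnorm_chromatic_def)
  obtain W f g w where B: "b = (W, f, g, w)" "W \<subseteq> edges F"
    using b by (cases b) (auto simp: chrom_basis_def)
  show "Poly_Mapping.keys (diff (unnorm_chromatic F es) b) \<subseteq> gens"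
    using keys_chrom_diff[OF B(2)] B(1) by (simp add: unnorm_chromatic_def del: chrom_diff.simps)
  show "diff (tensor_complex (unnorm_khovanov (medial F) (map edge_crossing es)) (V_words (verts F)) (V_deg (verts F))) (relabel b)
      = frag_extend (\<lambda>x. frag_of (relabel x)) (diff (unnorm_chromatic F es) b)"
    using diff_relabel[OF B(2)] assms B(1)
    by (simp add: unnorm_chromatic_def del: chrom_diff.simps relabel.simps)
qed (simp_all add: unnorm_chromatic_def bij_relabel inj_on_relabel chrom_basis_gens)

end

theorem theorem6p2:
  fixes F :: "('v, 'd) fatgraph"
    and es :: "'d set list"
    and L :: "('d \<times> side, 'v) diagram"
    and ori :: "('d \<times> side) set \<times> 'v set"
    and i j :: int
  assumes "is_fatgraph F"
    and "genus F = 0"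
    and "distinct es" and "set es = edges F"
    and "L = medial F"
    and "link_orientation L ori"
  defines "Kh \<equiv> unnorm_khovanov L (map edge_crossing es)"
  shows "homology (unnorm_chromatic F es) i j \<cong>
      sum_group {(p, q, r). p + q + r = j} (\<lambda>(p, q, r).
        tensor_group
          (tensor_group (homology Kh i p) ((R_power i q)\<lparr>carrier := R_image i q\<rparr>) \<times>\<times>
           tensor_group (cycles Kh i p) (R_power i q Mod R_image i q))
          (V_power (verts F) r))
    \<and> homology (chromatic F es) i j =
        homology (unnorm_chromatic F es) (i + int (card (edges F))) j"
proof
  interpret wf_fatgraph F by unfold_locales fact
  have "finite (verts F)" using assms(1) by (simp add: is_fatgraph_def)
  then show "homology (unnorm_chromatic F es) i j \<cong>
      sum_group {(p, q, r). p + q + r = j} (\<lambda>(p, q, r).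
        tensor_group
          (tensor_group (homology Kh i p) ((R_power i q)\<lparr>carrier := R_image i q\<rparr>) \<times>\<times>
           tensor_group (cycles Kh i p) (R_power i q Mod R_image i q))
          (V_power (verts F) r))"
    unfolding Kh_def assms(5)
    by (rule iso_trans[OF homology_unnorm_chromatic[OF assms(4)] homology_tensor_complex_sum])
  show "homology (chromatic F es) i j = homology (unnorm_chromatic F es) (i + int (card (edges F))) j"
    by (simp add: chromatic_def homology_shift)
qed

end
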